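(* Let $\eta(x)$ be a divisor, over the field $\mathfrak{T}$, of the cyclotomic polynomial $\Phi_p(x)=x^{p-1}+\cdots+x+1$ with $\deg(\eta(x))<p-1$ (provided that such a nontrivial polynomial exists). Let $G=\langle a\mid a^p=1\rangle$ and $M_\eta=\eta(a)RG$. Then the $RG$-module $M_\eta$ is indecomposable and $$H^1(G,\widehat{M_\eta})\cong R/(\eta(1)R),$$ where $R/(\eta(1)R)$ is the additive group of the factor ring of $R$ by the ideal $\eta(1)R$.
   Context: Setting: $p$ is a prime, $G=\langle a\mid a^p=1\rangle$ is the cyclic group of order $p$, $R$ is the ring of integers of a ramified finite extension $\mathfrak{T}$ of the field of $p$-adic numbers (so $\mathfrak T$ is the field of fractions of $R$), and $F$ is a field containing $R$. For an $RG$-module $M$ that is free of finite rank over $R$, put $FM=F\otimes_R M$ and $\widehat{M}=FM^+/M$ (the quotient of the additive group of $FM$ by the additive group of $M$), an $RG$-module. $H^1(G,\widehat M)$ is the first cohomology group: $1$-cocycles $\mathfrak f:G\to\widehat M$, i.e. maps with $\mathfrak f(xy)=x\mathfrak f(y)+\mathfrak f(x)$ for $x,y\in G$, modulo coboundaries, i.e. cocycles of the form $\mathfrak f(g)=(g-1)x+M$ for all $g\in G$, with some $x\in FM$.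
   Formalization: The divisor η(x) is assumed to have leading coefficient a unit of R (e.g. monic); for other scalar multiples of η the module is unchanged up to isomorphism but R/(η(1)R) changes or is undefined, so the claim fails. *)

theory Defs
  imports "HOL-Algebra.Algebra" "HOL-Algebra.Algebraic_Closure_Type"
begin

section \<open>The \<open>p\<close>-adic numbers and their finite extensions\<close>

text \<open>
  The \<open>p\<close>-adic integers, as the inverse limit of the rings of integers modulo \<open>p ^ n\<close>: compatible
  sequences of reduced residues.
\<close>

definition padic_ints :: "nat \<Rightarrow> (nat \<Rightarrow> int) ring" where
  "padic_ints p = \<lparr>
     carrier = {x. \<forall>n. x n \<in> {0..<int p ^ n} \<and> x (Suc n) mod int p ^ n = x n},
     monoid.mult = (\<lambda>x y n. x n * y n mod int p ^ n),
     one = (\<lambda>n. 1 mod int p ^ n),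
     ring.zero = (\<lambda>n. 0),
     add = (\<lambda>x y n. (x n + y n) mod int p ^ n)\<rparr>"

text \<open>
  The extension field is the whole type \<open>'a\<close>. Its structure over the field of \<open>p\<close>-adic numbers is
  given by an embedding \<open>\<iota>\<close> of the \<open>p\<close>-adic integers: this extends uniquely to their field of
  fractions, and the image of the latter is \<open>padic_subfield p \<iota>\<close>.
\<close>

definition padic_subfield :: "nat \<Rightarrow> ((nat \<Rightarrow> int) \<Rightarrow> 'a::field) \<Rightarrow> 'a set" where
  "padic_subfield p \<iota> =
     {\<iota> x / \<iota> y |x y. x \<in> carrier (padic_ints p) \<and> y \<in> carrier (padic_ints p) \<and>
                    y \<noteq> \<zero>\<^bsub>padic_ints p\<^esub>}"

definition finite_padic_extension :: "nat \<Rightarrow> ((nat \<Rightarrow> int) \<Rightarrow> 'a::field) \<Rightarrow> bool" where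
  "finite_padic_extension p \<iota> \<longleftrightarrow>
     \<iota> \<in> ring_hom (padic_ints p) ring_of_type_algebra \<and>
     inj_on \<iota> (carrier (padic_ints p)) \<and>
     ring.finite_dimension (ring_of_type_algebra :: 'a ring) (padic_subfield p \<iota>) UNIV"

definition ring_of_integers :: "nat \<Rightarrow> ((nat \<Rightarrow> int) \<Rightarrow> 'a::field) \<Rightarrow> 'a ring" where
  "ring_of_integers p \<iota> = ring_of_type_algebra\<lparr>carrier :=
     {x. \<exists>f :: 'a poly. Polynomial.lead_coeff f = 1 \<and>
           (\<forall>i. Polynomial.coeff f i \<in> \<iota> ` carrier (padic_ints p)) \<and> poly f x = 0}\<rparr>"

text \<open>
  The ramification index is the exponent \<open>e\<close> for which the ideal generated by \<open>p\<close> is the \<open>e\<close>-th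
  power of the maximal ideal.
\<close>

definition ramified :: "nat \<Rightarrow> ('a, 'm) ring_scheme \<Rightarrow> bool" where
  "ramified p R \<longleftrightarrow>
     (\<exists>P (e::nat). maximalideal P R \<and> e > 1 \<and>
        PIdl\<^bsub>R\<^esub> ([p] \<cdot>\<^bsub>R\<^esub> \<one>\<^bsub>R\<^esub>) = P [^]\<^bsub>ideals_set R\<^esub> e)"


section \<open>Modules\<close>

text \<open>
  A module record carries a multiplication and a unit, which play no role for modules; they are
  copied from \<open>N\<close>.
\<close>

definition module_of :: "('b, 'm) ring_scheme \<Rightarrow> ('r \<Rightarrow> 'b \<Rightarrow> 'b) \<Rightarrow> ('r, 'b) module" where
  "module_of N s = \<lparr>carrier = carrier N, monoid.mult = monoid.mult N, one = one N,
     ring.zero = ring.zero N, add = add N, module.smult = s\<rparr>"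

definition indecomposable_module ::
    "('r, 'm) ring_scheme \<Rightarrow> ('r, 'b, 'n) module_scheme \<Rightarrow> bool" where
  "indecomposable_module S M \<longleftrightarrow>
     module S M \<and> carrier M \<noteq> {\<zero>\<^bsub>M\<^esub>} \<and>
     (\<forall>A B. submodule A S M \<and> submodule B S M \<and>
        A \<inter> B = {\<zero>\<^bsub>M\<^esub>} \<and> A <+>\<^bsub>M\<^esub> B = carrier M \<longrightarrow> A = {\<zero>\<^bsub>M\<^esub>} \<or> B = {\<zero>\<^bsub>M\<^esub>})"

text \<open>
  The tensor product of two modules over a commutative ring, as an abelian group: the free abelian
  group on the pairs modulo the bilinearity relations. Groups built from modules (here and below)
  are monoid records, hence written multiplicatively; the operation of the free abelian group is
  the addition of finitely supported functions.
\<close>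

definition tensor_group ::
    "('r, 'a, 'm) module_scheme \<Rightarrow> ('r, 'b, 'n) module_scheme \<Rightarrow> ('a \<times> 'b \<Rightarrow>\<^sub>0 int) monoid" where
  "tensor_group A B = free_Abelian_group (carrier A \<times> carrier B)"

definition tensor_relations ::
    "('r, 'k) ring_scheme \<Rightarrow> ('r, 'a, 'm) module_scheme \<Rightarrow> ('r, 'b, 'n) module_scheme \<Rightarrow>
     ('a \<times> 'b \<Rightarrow>\<^sub>0 int) set" where
  "tensor_relations R A B = generate (tensor_group A B)
     ({frag_of (x \<oplus>\<^bsub>A\<^esub> x', y) - frag_of (x, y) - frag_of (x', y) |x x' y.
         x \<in> carrier A \<and> x' \<in> carrier A \<and> y \<in> carrier B} \<union>
      {frag_of (x, y \<oplus>\<^bsub>B\<^esub> y') - frag_of (x, y) - frag_of (x, y') |x y y'.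
         x \<in> carrier A \<and> y \<in> carrier B \<and> y' \<in> carrier B} \<union>
      {frag_of (r \<odot>\<^bsub>A\<^esub> x, y) - frag_of (x, r \<odot>\<^bsub>B\<^esub> y) |r x y.
         r \<in> carrier R \<and> x \<in> carrier A \<and> y \<in> carrier B})"

definition tensor_product ::
    "('r, 'k) ring_scheme \<Rightarrow> ('r, 'a, 'm) module_scheme \<Rightarrow> ('r, 'b, 'n) module_scheme \<Rightarrow>
     ('a \<times> 'b \<Rightarrow>\<^sub>0 int) set monoid" where
  "tensor_product R A B = tensor_group A B Mod tensor_relations R A B"

definition pure_tensor ::
    "('r, 'k) ring_scheme \<Rightarrow> ('r, 'a, 'm) module_scheme \<Rightarrow> ('r, 'b, 'n) module_scheme \<Rightarrow>
     'a \<Rightarrow> 'b \<Rightarrow> ('a \<times> 'b \<Rightarrow>\<^sub>0 int) set" where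
  "pure_tensor R A B x y = tensor_relations R A B #>\<^bsub>tensor_group A B\<^esub> frag_of (x, y)"


section \<open>Group rings and modules over them\<close>

text \<open>
  The group \<open>G\<close> is assumed to be finite, so that no support condition is needed.
\<close>

definition group_ring :: "('r, 'k) ring_scheme \<Rightarrow> ('g, 'l) monoid_scheme \<Rightarrow> ('g \<Rightarrow> 'r) ring" where
  "group_ring R G = \<lparr>
     carrier = carrier G \<rightarrow>\<^sub>E carrier R,
     monoid.mult = (\<lambda>u v. \<lambda>g\<in>carrier G. \<Oplus>\<^bsub>R\<^esub>h\<in>carrier G. u h \<otimes>\<^bsub>R\<^esub> v (inv\<^bsub>G\<^esub> h \<otimes>\<^bsub>G\<^esub> g)),
     one = (\<lambda>g\<in>carrier G. if g = \<one>\<^bsub>G\<^esub> then \<one>\<^bsub>R\<^esub> else \<zero>\<^bsub>R\<^esub>),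
     ring.zero = (\<lambda>g\<in>carrier G. \<zero>\<^bsub>R\<^esub>),
     add = (\<lambda>u v. \<lambda>g\<in>carrier G. u g \<oplus>\<^bsub>R\<^esub> v g)\<rparr>"

text \<open>The element \<open>r g\<close> of the group ring, for a scalar \<open>r\<close> and a group element \<open>g\<close>.\<close>

definition group_ring_term ::
    "('r, 'k) ring_scheme \<Rightarrow> ('g, 'l) monoid_scheme \<Rightarrow> 'r \<Rightarrow> 'g \<Rightarrow> 'g \<Rightarrow> 'r" where
  "group_ring_term R G r g = (\<lambda>h\<in>carrier G. if h = g then r else \<zero>\<^bsub>R\<^esub>)"

text \<open>The value at \<open>a \<in> G\<close> of a polynomial over the field \<open>'a\<close>, in the group algebra over \<open>'a\<close>.\<close>

definition poly_at ::
    "('g, 'l) monoid_scheme \<Rightarrow> 'a::field poly \<Rightarrow> 'g \<Rightarrow> 'g \<Rightarrow> 'a" where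
  "poly_at G \<eta> a = (\<Oplus>\<^bsub>group_ring ring_of_type_algebra G\<^esub>i\<in>{..Polynomial.degree \<eta>}.
     group_ring_term ring_of_type_algebra G (Polynomial.coeff \<eta> i) (a [^]\<^bsub>G\<^esub> i))"

text \<open>
  The module \<open>\<eta>(a) RG\<close> over \<open>RG\<close>, where \<open>R\<close> is a subring of the field \<open>'a\<close>; products are formed in
  the group algebra over \<open>'a\<close>.
\<close>

definition poly_module ::
    "('a::field, 'k) ring_scheme \<Rightarrow> ('g, 'l) monoid_scheme \<Rightarrow> 'g \<Rightarrow> 'a poly \<Rightarrow>
     ('g \<Rightarrow> 'a, 'g \<Rightarrow> 'a) module" where
  "poly_module R G a \<eta> =
     (let A = group_ring (ring_of_type_algebra :: 'a ring) G
      in module_of (A\<lparr>carrier := {poly_at G \<eta> a \<otimes>\<^bsub>A\<^esub> u |u. u \<in> carrier (group_ring R G)}\<rparr>)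
           (monoid.mult A))"

text \<open>
  For a module \<open>M\<close> over \<open>RG\<close> and an \<open>R\<close>-algebra \<open>F\<close> with structure map \<open>j\<close>, the following is the
  group \<open>FM = F \<otimes> M\<close> (tensor product over \<open>R\<close>), on which \<open>g \<in> G\<close> acts by
  \<open>g (f \<otimes> m) = f \<otimes> g m\<close>. Elements of quotient groups are cosets, and since \<open>g\<close> acts on the group and
  stabilizes the subgroup, it acts on the quotient by taking images of cosets. This is used for both
  quotients, that is, for \<open>FM\<close> and for \<open>FM / M\<close>.
\<close>

definition scalar_module ::
    "('r, 'k) ring_scheme \<Rightarrow> ('g, 'l) monoid_scheme \<Rightarrow> ('g \<Rightarrow> 'r, 'b, 'n) module_scheme \<Rightarrow>
     ('r, 'b) module" where
  "scalar_module R G M = module_of M (\<lambda>r m. group_ring_term R G r \<one>\<^bsub>G\<^esub> \<odot>\<^bsub>M\<^esub> m)"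

definition algebra_module :: "('f, 'k) ring_scheme \<Rightarrow> ('r \<Rightarrow> 'f) \<Rightarrow> ('r, 'f) module" where
  "algebra_module F j = module_of F (\<lambda>r f. j r \<otimes>\<^bsub>F\<^esub> f)"

definition base_change ::
    "('r, 'k) ring_scheme \<Rightarrow> ('g, 'l) monoid_scheme \<Rightarrow> ('f, 'h) ring_scheme \<Rightarrow> ('r \<Rightarrow> 'f) \<Rightarrow>
     ('g \<Rightarrow> 'r, 'b, 'n) module_scheme \<Rightarrow> ('f \<times> 'b \<Rightarrow>\<^sub>0 int) set monoid" where
  "base_change R G F j M = tensor_product R (algebra_module F j) (scalar_module R G M)"

definition base_change_act ::
    "('r, 'k) ring_scheme \<Rightarrow> ('g, 'l) monoid_scheme \<Rightarrow> ('g \<Rightarrow> 'r, 'b, 'n) module_scheme \<Rightarrow>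
     'g \<Rightarrow> ('f \<times> 'b \<Rightarrow>\<^sub>0 int) set \<Rightarrow> ('f \<times> 'b \<Rightarrow>\<^sub>0 int) set" where
  "base_change_act R G M g C =
     frag_extend (\<lambda>(f, m). frag_of (f, group_ring_term R G \<one>\<^bsub>R\<^esub> g \<odot>\<^bsub>M\<^esub> m)) ` C"

text \<open>The group \<open>FM / M\<close>, where \<open>m \<in> M\<close> is identified with \<open>1 \<otimes> m\<close>.\<close>

definition hat_module ::
    "('r, 'k) ring_scheme \<Rightarrow> ('g, 'l) monoid_scheme \<Rightarrow> ('f, 'h) ring_scheme \<Rightarrow> ('r \<Rightarrow> 'f) \<Rightarrow>
     ('g \<Rightarrow> 'r, 'b, 'n) module_scheme \<Rightarrow> ('f \<times> 'b \<Rightarrow>\<^sub>0 int) set set monoid" where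
  "hat_module R G F j M = base_change R G F j M Mod
     (pure_tensor R (algebra_module F j) (scalar_module R G M) \<one>\<^bsub>F\<^esub> ` carrier M)"

definition hat_act ::
    "('r, 'k) ring_scheme \<Rightarrow> ('g, 'l) monoid_scheme \<Rightarrow> ('g \<Rightarrow> 'r, 'b, 'n) module_scheme \<Rightarrow>
     'g \<Rightarrow> ('f \<times> 'b \<Rightarrow>\<^sub>0 int) set set \<Rightarrow> ('f \<times> 'b \<Rightarrow>\<^sub>0 int) set set" where
  "hat_act R G M g D = base_change_act R G M g ` D"


section \<open>First cohomology\<close>

text \<open>
  The abelian group \<open>A\<close> of coefficients is a monoid record, written multiplicatively, on which \<open>G\<close>
  acts by \<open>act\<close>.
\<close>

definition cocycles1 ::
    "('g, 'l) monoid_scheme \<Rightarrow> ('c, 'm) monoid_scheme \<Rightarrow> ('g \<Rightarrow> 'c \<Rightarrow> 'c) \<Rightarrow> ('g \<Rightarrow> 'c) monoid" where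
  "cocycles1 G A act = \<lparr>
     carrier = {f \<in> carrier G \<rightarrow>\<^sub>E carrier A.
       \<forall>x\<in>carrier G. \<forall>y\<in>carrier G. f (x \<otimes>\<^bsub>G\<^esub> y) = act x (f y) \<otimes>\<^bsub>A\<^esub> f x},
     monoid.mult = (\<lambda>f h. \<lambda>g\<in>carrier G. f g \<otimes>\<^bsub>A\<^esub> h g),
     one = (\<lambda>g\<in>carrier G. \<one>\<^bsub>A\<^esub>)\<rparr>"

definition coboundaries1 ::
    "('g, 'l) monoid_scheme \<Rightarrow> ('c, 'm) monoid_scheme \<Rightarrow> ('g \<Rightarrow> 'c \<Rightarrow> 'c) \<Rightarrow> ('g \<Rightarrow> 'c) set" where
  "coboundaries1 G A act =
     {(\<lambda>g\<in>carrier G. act g x \<otimes>\<^bsub>A\<^esub> inv\<^bsub>A\<^esub> x) |x. x \<in> carrier A}"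

definition cohomology1 ::
    "('g, 'l) monoid_scheme \<Rightarrow> ('c, 'm) monoid_scheme \<Rightarrow> ('g \<Rightarrow> 'c \<Rightarrow> 'c) \<Rightarrow>
     ('g \<Rightarrow> 'c) set monoid" where
  "cohomology1 G A act = cocycles1 G A act Mod coboundaries1 G A act"

end

theory Submission
  imports Defs "Jordan_Normal_Form.Char_Poly"
begin

text \<open>
  Write \<open>K\<close> for the field \<open>'a\<close>. Substituting \<open>a\<close> for \<open>x\<close> identifies \<open>K[x]/(x ^ p - 1)\<close> with the group
  algebra \<open>KG\<close>, and \<open>R[x]\<close> maps onto \<open>RG\<close>, so that \<open>M\<close> consists of the values at \<open>a\<close> of the
  multiples \<open>\<eta> h\<close> with \<open>h\<close> in \<open>R[x]\<close>. A divisor of \<open>x ^ p - 1\<close> whose leading coefficient lies in \<open>R\<close>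
  has all its coefficients in \<open>R\<close>, since its roots are roots of unity and integral elements form a
  ring (\<open>integral_over_subring\<close>, \<open>unity_divisor_integral\<close>). Hence both \<open>\<eta>\<close> and the complementary
  factor \<open>\<theta>\<close> of \<open>\<Phi> = \<eta> \<theta>\<close> are integral; here \<open>\<Phi>\<close> is the \<open>p\<close>-th cyclotomic polynomial, and \<open>\<Phi>(a)\<close> is
  the norm element of the group.

  \<^emph>\<open>Indecomposability.\<close> Ramification provides a prime ideal \<open>P\<close> of \<open>R\<close> that contains \<open>p\<close>
  (\<open>ramified_prime\<close>). If \<open>s\<close> in \<open>R[x]\<close> vanishes at a \<open>p\<close>-th root of unity \<open>\<zeta>\<close>, then the Frobenius
  congruence gives \<open>s(1) ^ p \<equiv> s(\<zeta>) ^ p = 0\<close> modulo \<open>p\<close>, so \<open>s(1)\<close> lies in \<open>P\<close>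
  (\<open>root_of_unity_zero_imp_dvd\<close>). Therefore \<open>s(a)\<close> can be cancelled in \<open>KG\<close> whenever \<open>s(1)\<close> is outside \<open>P\<close>
  (\<open>unity_poly_dvd_cancel\<close>), and for every \<open>s\<close> this applies to \<open>s\<close> or to \<open>1 - s\<close>. This is the form in
  which \<open>RG\<close> is local, and a cyclic module over a local ring is indecomposable
  (\<open>indecomposable_M\<close>).

  \<^emph>\<open>Cohomology.\<close> For a cyclic group with generator \<open>a\<close>, evaluation at \<open>a\<close> identifies cocycles with
  elements of norm zero and coboundaries with multiples of \<open>a - 1\<close> (\<open>cohomology1_iso\<close>). The
  augmentation \<open>m \<mapsto> \<Sum> m(g)\<close> of \<open>M\<close> extends to an \<open>F\<close>-valued homomorphism \<open>ev\<close> on \<open>FM\<close>, and three facts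
  about it, which follow from the universal property of the tensor product, determine the
  cohomology:
  \<^item> the norm of \<open>v\<close> is \<open>ev(v) \<otimes> \<Phi>(a)\<close>, where \<open>\<Phi>(a) = \<eta>(a) \<theta>(a)\<close> belongs to \<open>M\<close> (\<open>norm_eq\<close>), and it
    lies in \<open>M\<close> if and only if \<open>ev(v)\<close> lies in \<open>R\<close> (\<open>pure_\<nu>_mem_W_iff\<close>);
  \<^item> \<open>ev\<close> maps \<open>M\<close> onto the ideal \<open>\<eta>(1) R\<close>;
  \<^item> modulo \<open>(a - 1) FM\<close>, the element \<open>v\<close> is \<open>ev(v) / \<eta>(1) \<otimes> \<eta>(a)\<close> (\<open>mod_augmentation\<close>), where
    \<open>\<eta>(1)\<close> is nonzero because it divides \<open>\<Phi>(1) = p\<close>.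

  So \<open>ev\<close> induces an isomorphism from the elements of norm zero in \<open>FM / M\<close>, modulo the multiples of
  \<open>a - 1\<close>, onto \<open>R / \<eta>(1) R\<close>.
\<close>

(* Below, ring_hom is the set of homomorphisms between ring records, not the locale of
   homomorphisms between types. *)
hide_const (open) Ring_Hom.ring_hom

section \<open>Integral elements of a field\<close>

locale type_subring =
  fixes A :: "'a::comm_ring_1 set"
  assumes one_mem: "1 \<in> A"
    and diff_mem: "x \<in> A \<Longrightarrow> y \<in> A \<Longrightarrow> x - y \<in> A"
    and mult_mem: "x \<in> A \<Longrightarrow> y \<in> A \<Longrightarrow> x * y \<in> A"
begin

lemma zero_mem: "0 \<in> A"
  using diff_mem[OF one_mem one_mem] by simp

lemma uminus_mem: "x \<in> A \<Longrightarrow> - x \<in> A"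
  using diff_mem[OF zero_mem] by simp

lemma add_mem: "x \<in> A \<Longrightarrow> y \<in> A \<Longrightarrow> x + y \<in> A"
  using diff_mem[of x "- y"] uminus_mem by simp

lemma sum_mem: "(\<And>i. i \<in> I \<Longrightarrow> f i \<in> A) \<Longrightarrow> sum f I \<in> A"
  by (induction I rule: infinite_finite_induct) (auto intro: zero_mem add_mem)

lemma prod_mem: "(\<And>i. i \<in> I \<Longrightarrow> f i \<in> A) \<Longrightarrow> prod f I \<in> A"
  by (induction I rule: infinite_finite_induct) (auto intro: one_mem mult_mem)

lemma power_mem: "x \<in> A \<Longrightarrow> x ^ n \<in> A"
  by (induction n) (auto intro: one_mem mult_mem)

lemma of_nat_mem: "of_nat n \<in> A"
  by (induction n) (auto intro: zero_mem one_mem add_mem)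

end

definition poly_over :: "'a::zero set \<Rightarrow> 'a poly set" where
  "poly_over A = {f. \<forall>i. Polynomial.coeff f i \<in> A}"

context type_subring
begin

lemma poly_over_subring: "type_subring (poly_over A)"
  by unfold_locales
    (auto simp: poly_over_def coeff_mult intro: zero_mem one_mem diff_mem mult_mem sum_mem)

lemma const_poly_over: "c \<in> A \<Longrightarrow> [:c:] \<in> poly_over A"
  by (auto simp: poly_over_def coeff_pCons zero_mem split: nat.splits)

lemma monom_poly_over: "c \<in> A \<Longrightarrow> Polynomial.monom c i \<in> poly_over A"
  by (auto simp: poly_over_def zero_mem)

lemma poly_mem: "f \<in> poly_over A \<Longrightarrow> x \<in> A \<Longrightarrow> poly f x \<in> A"
  by (auto simp: poly_altdef poly_over_def intro!: sum_mem mult_mem power_mem)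

end

definition integral_over :: "'a::field set \<Rightarrow> 'a set" where
  "integral_over A = {x. \<exists>f. Polynomial.lead_coeff f = 1 \<and> f \<in> poly_over A \<and> poly f x = 0}"

definition lin_span :: "'a::comm_ring_1 set \<Rightarrow> 'a set \<Rightarrow> 'a set" where
  "lin_span A B = {\<Sum>b\<in>B. c b * b |c. \<forall>b\<in>B. c b \<in> A}"

context type_subring
begin

lemma lin_span_zero: "0 \<in> lin_span A B"
  unfolding lin_span_def by (rule CollectI, rule exI[of _ "\<lambda>_. 0"]) (auto intro: zero_mem)

lemma lin_span_add: "x \<in> lin_span A B \<Longrightarrow> y \<in> lin_span A B \<Longrightarrow> x + y \<in> lin_span A B"
  unfolding lin_span_def
proof clarify
  fix c d assume "\<forall>b\<in>B. c b \<in> A" "\<forall>b\<in>B. d b \<in> A"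
  then show "\<exists>e. (\<Sum>b\<in>B. c b * b) + (\<Sum>b\<in>B. d b * b) = (\<Sum>b\<in>B. e b * b) \<and> (\<forall>b\<in>B. e b \<in> A)"
    by (intro exI[of _ "\<lambda>b. c b + d b"]) (auto simp: sum.distrib algebra_simps intro: add_mem)
qed

lemma lin_span_smult: "r \<in> A \<Longrightarrow> x \<in> lin_span A B \<Longrightarrow> r * x \<in> lin_span A B"
  unfolding lin_span_def
proof clarify
  fix c assume "\<forall>b\<in>B. c b \<in> A" "r \<in> A"
  then show "\<exists>e. r * (\<Sum>b\<in>B. c b * b) = (\<Sum>b\<in>B. e b * b) \<and> (\<forall>b\<in>B. e b \<in> A)"
    by (intro exI[of _ "\<lambda>b. r * c b"]) (auto simp: sum_distrib_left algebra_simps intro: mult_mem)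
qed

lemma lin_span_sum: "(\<And>i. i \<in> I \<Longrightarrow> f i \<in> lin_span A B) \<Longrightarrow> sum f I \<in> lin_span A B"
  by (induction I rule: infinite_finite_induct) (auto intro: lin_span_zero lin_span_add)

lemma lin_span_base:
  assumes "finite B" "x \<in> B"
  shows "x \<in> lin_span A B"
proof -
  have "(\<Sum>b\<in>B. (if b = x then 1 else 0) * b) = (\<Sum>b\<in>B. if b = x then x else 0)"
    by (intro sum.cong) auto
  also have "\<dots> = x" using assms by simp
  finally show ?thesis unfolding lin_span_def
    by (intro CollectI exI[of _ "\<lambda>b. if b = x then 1 else 0"]) (auto intro: zero_mem one_mem)
qed

lemma lin_span_mult_closed:
  assumes "\<And>b. b \<in> B \<Longrightarrow> z * b \<in> lin_span A B" "x \<in> lin_span A B"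
  shows "z * x \<in> lin_span A B"
proof -
  obtain c where c: "x = (\<Sum>b\<in>B. c b * b)" "\<forall>b\<in>B. c b \<in> A"
    using assms(2) unfolding lin_span_def by auto
  have "z * x = (\<Sum>b\<in>B. c b * (z * b))"
    unfolding c(1) by (simp add: sum_distrib_left algebra_simps)
  also have "\<dots> \<in> lin_span A B"
    by (rule lin_span_sum, rule lin_span_smult) (use c(2) assms(1) in auto)
  finally show ?thesis .
qed

end

text \<open>
  The determinant is a polynomial expression with integer coefficients in the entries, and so each
  coefficient of the characteristic polynomial is one in the entries of the matrix.
\<close>

lemma (in type_subring) char_poly_over:
  assumes N: "N \<in> carrier_mat n n" and el: "\<And>i k. i < n \<Longrightarrow> k < n \<Longrightarrow> N $$ (i, k) \<in> A"
  shows "char_poly N \<in> poly_over A"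
proof -
  interpret P: type_subring "poly_over A" by (rule poly_over_subring)
  have X: "[:0, 1:] \<in> poly_over A"
    by (auto simp: poly_over_def coeff_pCons zero_mem one_mem split: nat.splits)
  have ent: "char_poly_matrix N $$ (i, k) \<in> poly_over A" if "i < n" "k < n" for i k
    using that N P.add_mem[OF X const_poly_over[OF uminus_mem[OF el[OF that]]]]
      const_poly_over[OF uminus_mem[OF el[OF that]]]
    by (cases "i = k") (auto simp: char_poly_matrix_def)
  have C: "char_poly_matrix N \<in> carrier_mat n n" using N by simp
  have sg: "signof q \<in> poly_over A" for q :: "nat \<Rightarrow> nat"
    by (auto simp: sign_def intro: P.one_mem P.uminus_mem)
  show ?thesis unfolding char_poly_def det_def'[OF C]
    by (intro P.sum_mem P.mult_mem P.prod_mem sg ent) (auto simp: permutes_in_image)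
qed

locale field_subring = type_subring A for A :: "'a::field set"
begin

text \<open>
  Multiplication by \<open>z\<close> on the generators is a matrix over \<open>A\<close>, of which \<open>z\<close> is an eigenvalue, so
  \<open>z\<close> is a root of its characteristic polynomial.
\<close>

lemma integral_if_stabilizes_lin_span:
  assumes fin: "finite B" and nz: "\<exists>b\<in>B. b \<noteq> 0"
    and stab: "\<And>b. b \<in> B \<Longrightarrow> z * b \<in> lin_span A B"
  shows "z \<in> integral_over A"
proof -
  obtain bs where bs: "set bs = B" "distinct bs"
    using finite_distinct_list[OF fin] by blast
  define n where "n = length bs"
  have "\<forall>b\<in>B. \<exists>c. z * b = (\<Sum>b'\<in>B. c b' * b') \<and> (\<forall>b'\<in>B. c b' \<in> A)"
    using stab unfolding lin_span_def by auto
  then obtain c where c: "\<And>b. b \<in> B \<Longrightarrow> z * b = (\<Sum>b'\<in>B. c b b' * b')"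
      "\<And>b b'. b \<in> B \<Longrightarrow> b' \<in> B \<Longrightarrow> c b b' \<in> A"
    by metis
  define N where "N = mat n n (\<lambda>(i, k). c (bs ! i) (bs ! k))"
  define v where "v = vec n (\<lambda>i. bs ! i)"
  have N: "N \<in> carrier_mat n n" and v: "v \<in> carrier_vec n"
    by (auto simp: N_def v_def)
  have inB: "bs ! i \<in> B" if "i < n" for i using that bs n_def by auto
  have "N *\<^sub>v v = z \<cdot>\<^sub>v v"
  proof (rule eq_vecI)
    fix i assume i: "i < dim_vec (z \<cdot>\<^sub>v v)"
    then have i: "i < n" by (simp add: v_def)
    have "(N *\<^sub>v v) $ i = (\<Sum>k<n. c (bs ! i) (bs ! k) * bs ! k)"
      using i by (simp add: N_def v_def scalar_prod_def atLeast0LessThan)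
    also have "\<dots> = (\<Sum>b'\<in>B. c (bs ! i) b' * b')"
      using bs bij_betw_nth[of bs "{..<n}" B] unfolding n_def
      by (intro sum.reindex_bij_betw) auto
    also have "\<dots> = (z \<cdot>\<^sub>v v) $ i"
      using c(1)[OF inB[OF i]] i by (simp add: v_def)
    finally show "(N *\<^sub>v v) $ i = (z \<cdot>\<^sub>v v) $ i" .
  qed (auto simp: N_def v_def)
  moreover have "v \<noteq> 0\<^sub>v n"
  proof -
    obtain i where "i < n" "bs ! i \<noteq> 0"
      using nz bs unfolding n_def by (metis in_set_conv_nth)
    then have "v $ i \<noteq> 0\<^sub>v n $ i" by (simp add: v_def)
    then show ?thesis by metis
  qed
  ultimately have "eigenvalue N z"
    using N v unfolding eigenvalue_def eigenvector_def by auto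
  then have "poly (char_poly N) z = 0"
    using eigenvalue_root_char_poly[OF N] by simp
  moreover have "char_poly N \<in> poly_over A"
    using N c(2) inB by (intro char_poly_over[OF N]) (auto simp: N_def)
  moreover have "Polynomial.lead_coeff (char_poly N) = 1"
    using degree_monic_char_poly[OF N] by simp
  ultimately show ?thesis unfolding integral_over_def by auto
qed

lemma integral_over_base: "A \<subseteq> integral_over A"
proof
  fix x assume "x \<in> A"
  then show "x \<in> integral_over A" unfolding integral_over_def
    by (intro CollectI exI[of _ "[:- x, 1:]"])
      (auto simp: poly_over_def coeff_pCons zero_mem one_mem uminus_mem split: nat.splits)
qed

lemma power_degree_in_span:
  assumes "Polynomial.lead_coeff f = 1" "f \<in> poly_over A" "poly f x = 0"
  shows "\<exists>c. (\<forall>i. c i \<in> A) \<and> x ^ Polynomial.degree f = (\<Sum>i<Polynomial.degree f. c i * x ^ i)"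
proof -
  have "0 = (\<Sum>i\<le>Polynomial.degree f. Polynomial.coeff f i * x ^ i)"
    using assms(3) by (simp add: poly_altdef)
  also have "\<dots> = (\<Sum>i<Polynomial.degree f. Polynomial.coeff f i * x ^ i) + x ^ Polynomial.degree f"
    using assms(1) by (simp flip: lessThan_Suc_atMost)
  finally have "x ^ Polynomial.degree f = (\<Sum>i<Polynomial.degree f. - Polynomial.coeff f i * x ^ i)"
    by (simp add: sum_negf eq_neg_iff_add_eq_0 add.commute)
  then show ?thesis using assms(2)
    by (intro exI[of _ "\<lambda>i. - Polynomial.coeff f i"]) (auto simp: poly_over_def intro: uminus_mem)
qed

text \<open>
  For monic equations of degrees \<open>m\<close> and \<open>n\<close> of \<open>x\<close> and \<open>y\<close>, the module generated by the products
  \<open>x ^ i * y ^ k\<close> with \<open>i < m\<close> and \<open>k < n\<close> is stable under \<open>x\<close> and \<open>y\<close>, hence under every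
  polynomial expression in them.
\<close>

lemma common_stable_span:
  assumes "x \<in> integral_over A" "y \<in> integral_over A"
  obtains B where "finite B" "1 \<in> B" "\<And>b. b \<in> B \<Longrightarrow> x * b \<in> lin_span A B"
    "\<And>b. b \<in> B \<Longrightarrow> y * b \<in> lin_span A B"
proof -
  obtain f where f: "Polynomial.lead_coeff f = 1" "f \<in> poly_over A" "poly f x = 0"
    using assms(1) unfolding integral_over_def by auto
  obtain g where g: "Polynomial.lead_coeff g = 1" "g \<in> poly_over A" "poly g y = 0"
    using assms(2) unfolding integral_over_def by auto
  define m where "m = Polynomial.degree f"
  define n where "n = Polynomial.degree g"
  obtain c where c: "\<And>i. c i \<in> A" "x ^ m = (\<Sum>i<m. c i * x ^ i)"
    using power_degree_in_span[OF f] m_def by auto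
  obtain d where d: "\<And>i. d i \<in> A" "y ^ n = (\<Sum>i<n. d i * y ^ i)"
    using power_degree_in_span[OF g] n_def by auto
  have pos: "m > 0" "n > 0"
    using c(2) d(2) by (auto intro: ccontr)
  define B where "B = (\<lambda>(i, k). x ^ i * y ^ k) ` ({..<m} \<times> {..<n})"
  have fin: "finite B" by (auto simp: B_def)
  have mem: "x ^ i * y ^ k \<in> lin_span A B" if "i < m" "k < n" for i k
    using that by (intro lin_span_base fin) (auto simp: B_def)
  have "x * (x ^ i * y ^ k) \<in> lin_span A B" if "i < m" "k < n" for i k
  proof (cases "Suc i = m")
    case False
    then show ?thesis using mem[of "Suc i" k] that by (simp add: mult.assoc)
  next
    case True
    then have "x * (x ^ i * y ^ k) = x ^ m * y ^ k" by (auto simp: mult.assoc)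
    also have "\<dots> = (\<Sum>i<m. c i * (x ^ i * y ^ k))"
      unfolding c(2) by (simp add: sum_distrib_right mult.assoc)
    also have "\<dots> \<in> lin_span A B"
      by (rule lin_span_sum, rule lin_span_smult) (use mem that c(1) in auto)
    finally show ?thesis .
  qed
  moreover have "y * (x ^ i * y ^ k) \<in> lin_span A B" if "i < m" "k < n" for i k
  proof (cases "Suc k = n")
    case False
    then show ?thesis using mem[of i "Suc k"] that by (simp add: mult.left_commute)
  next
    case True
    then have "y * (x ^ i * y ^ k) = y ^ n * x ^ i" by (auto simp: algebra_simps)
    also have "\<dots> = (\<Sum>k<n. d k * (x ^ i * y ^ k))"
      unfolding d(2) by (simp add: sum_distrib_right sum_distrib_left algebra_simps)
    also have "\<dots> \<in> lin_span A B"
      by (rule lin_span_sum, rule lin_span_smult) (use mem that d(1) in auto)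
    finally show ?thesis .
  qed
  moreover have "1 \<in> B"
    unfolding B_def using pos by (intro image_eqI[of _ _ "(0, 0)"]) auto
  ultimately show ?thesis
    using fin by (intro that[of B]) (auto simp: B_def)
qed

lemma integral_over_subring: "type_subring (integral_over A)"
proof
  show "1 \<in> integral_over A" using one_mem integral_over_base by auto
  fix x y assume xy: "x \<in> integral_over A" "y \<in> integral_over A"
  obtain B where B: "finite B" "1 \<in> B" "\<And>b. b \<in> B \<Longrightarrow> x * b \<in> lin_span A B"
    "\<And>b. b \<in> B \<Longrightarrow> y * b \<in> lin_span A B"
    using common_stable_span[OF xy] by blast
  have nz: "\<exists>b\<in>B. b \<noteq> 0" using B(2) by (intro bexI[of _ 1]) auto
  note int = integral_if_stabilizes_lin_span[OF B(1) nz]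
  show "x * y \<in> integral_over A"
  proof (rule int)
    fix b assume b: "b \<in> B"
    show "x * y * b \<in> lin_span A B"
      using lin_span_mult_closed[of B x "y * b"] B(3) B(4)[OF b] by (simp add: mult.assoc)
  qed
  show "x - y \<in> integral_over A"
  proof (rule int)
    fix b assume b: "b \<in> B"
    have "(x - y) * b = x * b + (- 1) * (y * b)" by (simp add: algebra_simps)
    also have "\<dots> \<in> lin_span A B"
      using B(3)[OF b] B(4)[OF b] by (intro lin_span_add lin_span_smult[OF uminus_mem[OF one_mem]])
    finally show "(x - y) * b \<in> lin_span A B" .
  qed
qed

end

section \<open>Polynomials dividing \<open>x ^ p - 1\<close> over an integral closure\<close>

interpretation to_ac: field_hom "to_ac :: 'a::field \<Rightarrow> 'a alg_closure"
  by unfold_locales auto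

interpretation to_ac_poly: map_poly_inj_idom_hom "to_ac :: 'a::field \<Rightarrow> 'a alg_closure" ..

lemma to_ac_field_subring:
  assumes "field_subring A"
  shows "field_subring (to_ac ` A)"
proof -
  interpret field_subring A by fact
  show ?thesis
    by unfold_locales
      (auto simp flip: to_ac_1 to_ac_diff to_ac_mult intro: one_mem diff_mem mult_mem)
qed

text \<open>
  Roots of unity live in the algebraic closure, but the conclusions drawn from them concern elements
  of the base field; integrality passes between the two because a monic equation with coefficients
  from the base field descends along the embedding.
\<close>

lemma to_ac_mem_integral_over_iff:
  "to_ac x \<in> integral_over (to_ac ` A) \<longleftrightarrow> x \<in> integral_over A"
proof
  assume "x \<in> integral_over A"
  then obtain f where "Polynomial.lead_coeff f = 1" "f \<in> poly_over A" "poly f x = 0"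
    unfolding integral_over_def by auto
  then show "to_ac x \<in> integral_over (to_ac ` A)"
    unfolding integral_over_def
    by (intro CollectI exI[of _ "map_poly to_ac f"]) (auto simp: poly_over_def)
next
  assume "to_ac x \<in> integral_over (to_ac ` A)"
  then obtain g where g: "Polynomial.lead_coeff g = 1" "g \<in> poly_over (to_ac ` A)" "poly g (to_ac x) = 0"
    unfolding integral_over_def by auto
  define f where "f = map_poly of_ac g"
  have f: "g = map_poly to_ac f"
    using g(2) by (auto simp: f_def poly_eq_iff coeff_map_poly poly_over_def intro!: to_ac_of_ac[symmetric])
  have "f \<in> poly_over A"
    using g(2) unfolding f poly_over_def by auto
  moreover have "Polynomial.lead_coeff f = 1"
    using g(1) unfolding f by (metis to_ac.hom_lead_coeff to_ac_1 to_ac_eq_iff)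
  moreover have "poly f x = 0"
    using g(3) unfolding f by simp
  ultimately show "x \<in> integral_over A"
    unfolding integral_over_def by auto
qed

lemma root_of_unity_integral:
  assumes "field_subring A" "(\<zeta> :: 'a::field) ^ n = 1" "n > 0"
  shows "\<zeta> \<in> integral_over A"
proof -
  interpret field_subring A by fact
  let ?f = "Polynomial.monom 1 n - 1 :: 'a poly"
  interpret P: type_subring "poly_over A" by (rule poly_over_subring)
  have "Polynomial.degree ?f = n"
    using assms(3) by (intro antisym degree_le le_degree) auto
  then have "Polynomial.lead_coeff ?f = 1" using assms(3) by simp
  moreover have "?f \<in> poly_over A"
    by (intro P.diff_mem P.one_mem monom_poly_over one_mem)
  moreover have "poly ?f \<zeta> = 0" using assms(2) by (simp add: poly_monom)
  ultimately show ?thesis unfolding integral_over_def by blast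
qed

text \<open>
  The inner binomial coefficients \<open>p choose k\<close> are divisible by \<open>p\<close>.
\<close>

lemma (in type_subring) add_power_prime:
  assumes p: "Factorial_Ring.prime p" and x: "x \<in> A" and y: "y \<in> A"
  shows "\<exists>w\<in>A. (x + y) ^ p = x ^ p + y ^ p + of_nat p * w"
proof -
  have dv: "p dvd (p choose k)" if "k \<in> {1..<p}" for k
  proof -
    have "k * (p choose k) = p * ((p - 1) choose (k - 1))"
      using that by (intro times_binomial_minus1_eq) auto
    then have "p dvd k * (p choose k)" by simp
    then show ?thesis
      using that p prime_dvd_mult_iff[of p k] by (auto dest: dvd_imp_le)
  qed
  have p0: "p > 0" using p prime_gt_0_nat by auto
  have "{..p} = insert 0 (insert p {1..<p})" using p0 by auto
  then have "(x + y) ^ p = x ^ p + y ^ p + (\<Sum>k\<in>{1..<p}. of_nat (p choose k) * x ^ k * y ^ (p - k))"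
    using p0 by (simp add: binomial_ring)
  also have "(\<Sum>k\<in>{1..<p}. of_nat (p choose k) * x ^ k * y ^ (p - k))
      = of_nat p * (\<Sum>k\<in>{1..<p}. of_nat ((p choose k) div p) * x ^ k * y ^ (p - k))"
    using dv by (auto simp: sum_distrib_left mult.assoc simp flip: of_nat_mult intro!: sum.cong)
      (metis dvd_mult_div_cancel mult.assoc of_nat_mult dv atLeastLessThan_iff One_nat_def)
  finally show ?thesis
    using x y by (intro bexI[of _ "\<Sum>k\<in>{1..<p}. of_nat ((p choose k) div p) * x ^ k * y ^ (p - k)"])
      (auto intro!: sum_mem mult_mem of_nat_mem power_mem)
qed

lemma (in type_subring) sum_power_prime:
  assumes p: "Factorial_Ring.prime p" and "finite I" and "\<And>i. i \<in> I \<Longrightarrow> f i \<in> A"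
  shows "\<exists>w\<in>A. (\<Sum>i\<in>I. f i) ^ p = (\<Sum>i\<in>I. f i ^ p) + of_nat p * w"
  using assms(2,3)
proof (induction I rule: finite_induct)
  case empty
  then show ?case using p prime_gt_0_nat[OF p] by (intro bexI[OF _ zero_mem]) (simp add: zero_power)
next
  case (insert i I)
  have "f i \<in> A" "sum f I \<in> A" using insert.prems by (auto intro!: sum_mem)
  obtain w where w: "w \<in> A" "(\<Sum>i\<in>I. f i) ^ p = (\<Sum>i\<in>I. f i ^ p) + of_nat p * w"
    using insert by auto
  obtain v where v: "v \<in> A" "(f i + (\<Sum>i\<in>I. f i)) ^ p = f i ^ p + (\<Sum>i\<in>I. f i) ^ p + of_nat p * v"
    using add_power_prime[OF p, of "f i" "\<Sum>i\<in>I. f i"] \<open>f i \<in> A\<close> \<open>sum f I \<in> A\<close> by blast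
  show ?case using insert v w
    by (intro bexI[of _ "v + w"]) (auto simp: algebra_simps intro: add_mem)
qed

text \<open>
  The Frobenius congruence turns \<open>s(\<zeta>)\<close> and \<open>s(1)\<close> into the same element modulo \<open>p\<close>, so
  \<open>s(1) ^ p\<close> is divisible by \<open>p\<close> as soon as \<open>s(\<zeta>) = 0\<close>. The quotient is integral because it is so
  in the algebraic closure, where \<open>\<zeta>\<close> lives.
\<close>

lemma root_of_unity_zero_imp_dvd:
  fixes s :: "'a::field poly"
  assumes A: "field_subring A" and p: "Factorial_Ring.prime p" and p0: "of_nat p \<noteq> (0::'a)"
    and s: "s \<in> poly_over (integral_over A)"
    and \<zeta>: "\<zeta> ^ p = 1" "poly (map_poly to_ac s) \<zeta> = 0"
  shows "\<exists>r\<in>integral_over A. poly s 1 ^ p = of_nat p * r"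
proof -
  interpret L: field_subring "to_ac ` A" by (rule to_ac_field_subring[OF A])
  define B where "B = integral_over (to_ac ` A)"
  interpret B: type_subring B unfolding B_def by (rule L.integral_over_subring)
  have "\<zeta> \<in> B"
    unfolding B_def using \<zeta>(1) p prime_gt_0_nat
    by (intro root_of_unity_integral L.field_subring_axioms) auto
  define n where "n = Polynomial.degree s"
  define c where "c i = to_ac (Polynomial.coeff s i)" for i
  have c: "c i \<in> B" for i
    using s by (auto simp: c_def B_def to_ac_mem_integral_over_iff poly_over_def)
  have s\<zeta>: "poly (map_poly to_ac s) \<zeta> = (\<Sum>i\<le>n. c i * \<zeta> ^ i)"
    by (simp add: poly_altdef c_def n_def)
  have s1: "to_ac (poly s 1) = (\<Sum>i\<le>n. c i)"
    by (simp add: poly_altdef c_def n_def to_ac_sum)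
  obtain w where w: "w \<in> B" "(\<Sum>i\<le>n. c i * \<zeta> ^ i) ^ p = (\<Sum>i\<le>n. (c i * \<zeta> ^ i) ^ p) + of_nat p * w"
    using B.sum_power_prime[OF p, of "{..n}" "\<lambda>i. c i * \<zeta> ^ i"] c \<open>\<zeta> \<in> B\<close>
    by (auto intro: B.mult_mem B.power_mem)
  obtain v where v: "v \<in> B" "(\<Sum>i\<le>n. c i) ^ p = (\<Sum>i\<le>n. c i ^ p) + of_nat p * v"
    using B.sum_power_prime[OF p, of "{..n}" c] c by auto
  have "(c i * \<zeta> ^ i) ^ p = c i ^ p" for i
    using \<zeta>(1) by (simp add: power_mult_distrib flip: power_mult) (simp add: power_mult mult.commute[of i])
  then have "(\<Sum>i\<le>n. c i ^ p) = - of_nat p * w"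
    using w(2) \<zeta>(2) s\<zeta> p prime_gt_0_nat[of p] by (simp add: eq_neg_iff_add_eq_0 zero_power)
  then have eq: "to_ac (poly s 1) ^ p = of_nat p * (v - w)"
    using v(2) s1 by (simp add: algebra_simps)
  define r where "r = poly s 1 ^ p / of_nat p"
  have "of_nat p \<noteq> (0 :: 'a alg_closure)" using p0 by (simp flip: to_ac_of_nat)
  then have "to_ac r = v - w" unfolding r_def using eq by (simp add: field_simps)
  then have "to_ac r \<in> B" using v w by (simp add: B.diff_mem)
  then have "r \<in> integral_over A" by (simp add: B_def to_ac_mem_integral_over_iff)
  moreover have "poly s 1 ^ p = of_nat p * r" unfolding r_def using p0 by simp
  ultimately show ?thesis by auto
qed

lemma prod_linear_dvd_cancel:
  fixes s m :: "'a::field poly"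
  assumes "(\<Prod>\<zeta>\<in>#Z. [:- \<zeta>, 1:]) dvd s * m" "\<And>\<zeta>. \<zeta> \<in># Z \<Longrightarrow> poly s \<zeta> \<noteq> 0"
  shows "(\<Prod>\<zeta>\<in>#Z. [:- \<zeta>, 1:]) dvd m"
  using assms
proof (induction Z arbitrary: m)
  case empty
  then show ?case by simp
next
  case (add \<zeta> Z)
  obtain k where k: "s * m = [:- \<zeta>, 1:] * (\<Prod>\<zeta>\<in>#Z. [:- \<zeta>, 1:]) * k"
    using add.prems(1) unfolding dvd_def by (simp only: image_mset_add_mset prod_mset.add_mset) blast
  have "poly (s * m) \<zeta> = 0" unfolding k by simp
  then have "poly m \<zeta> = 0" using add.prems(2)[of \<zeta>] by simp
  then obtain m' where m': "m = [:- \<zeta>, 1:] * m'"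
    unfolding poly_eq_0_iff_dvd dvd_def by blast
  have "[:- \<zeta>, 1:] * (s * m') = [:- \<zeta>, 1:] * ((\<Prod>\<zeta>\<in>#Z. [:- \<zeta>, 1:]) * k)"
    using k unfolding m' by (simp only: mult_ac)
  then have "s * m' = (\<Prod>\<zeta>\<in>#Z. [:- \<zeta>, 1:]) * k"
    by (subst (asm) mult_left_cancel) auto
  then have "(\<Prod>\<zeta>\<in>#Z. [:- \<zeta>, 1:]) dvd m'"
    using add.IH[of m'] add.prems(2) by auto
  then show ?case unfolding m' by (simp add: mult_dvd_mono del: mult_pCons_left)
qed

lemma unity_poly_splits:
  assumes "f dvd (Polynomial.monom 1 p - 1 :: 'a::field poly)" "p > 0"
  obtains Z where "map_poly to_ac f = Polynomial.smult (to_ac (Polynomial.lead_coeff f)) (\<Prod>\<zeta>\<in>#Z. [:- \<zeta>, 1:])"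
    "\<And>\<zeta>. \<zeta> \<in># Z \<Longrightarrow> \<zeta> ^ p = 1"
proof -
  have "Polynomial.coeff (Polynomial.monom 1 p - 1 :: 'a poly) p = 1" using assms(2) by simp
  then have "f \<noteq> 0" using assms(1) by (metis coeff_0 dvd_0_left_iff zero_neq_one)
  then obtain Z where "map_poly to_ac f
      = Polynomial.smult (Polynomial.lead_coeff (map_poly to_ac f)) (\<Prod>\<zeta>\<in>#Z. [:- \<zeta>, 1:])"
    using alg_closed_imp_factorization[of "map_poly to_ac f"] by auto
  then have Z: "map_poly to_ac f = Polynomial.smult (to_ac (Polynomial.lead_coeff f)) (\<Prod>\<zeta>\<in>#Z. [:- \<zeta>, 1:])"
    by (simp only: to_ac.hom_lead_coeff)
  have "\<zeta> ^ p = 1" if "\<zeta> \<in># Z" for \<zeta>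
  proof -
    have "poly (\<Prod>\<zeta>\<in>#Z. [:- \<zeta>, 1:]) \<zeta> = 0" using that
      by (auto simp: poly_prod_mset prod_mset_zero_iff)
    then have "poly (map_poly to_ac f) \<zeta> = 0" unfolding Z by simp
    moreover have "map_poly to_ac f dvd Polynomial.monom 1 p - 1"
    proof -
      obtain k where "Polynomial.monom 1 p - 1 = f * k" using assms(1) unfolding dvd_def by blast
      then have "map_poly to_ac (Polynomial.monom 1 p - 1) = map_poly to_ac f * map_poly to_ac k"
        by (simp only: to_ac_poly.hom_mult)
      moreover have "map_poly to_ac (Polynomial.monom 1 p - 1) = Polynomial.monom 1 p - 1"
        by (simp add: hom_distribs)
      ultimately show ?thesis by (metis dvd_triv_left)
    qed
    ultimately have "poly (Polynomial.monom 1 p - 1) \<zeta> = 0"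
      unfolding dvd_def by (metis mult_zero_left poly_mult)
    then show ?thesis by (simp add: poly_monom)
  qed
  then show ?thesis using that Z by blast
qed

lemma (in type_subring) prod_linear_poly_over:
  "(\<And>\<zeta>. \<zeta> \<in># Z \<Longrightarrow> \<zeta> \<in> A) \<Longrightarrow> (\<Prod>\<zeta>\<in>#Z. [:- \<zeta>, 1:]) \<in> poly_over A"
proof (induction Z)
  case empty
  interpret P: type_subring "poly_over A" by (rule poly_over_subring)
  show ?case using P.one_mem by simp
next
  case (add \<zeta> Z)
  interpret P: type_subring "poly_over A" by (rule poly_over_subring)
  have "[:- \<zeta>, 1:] \<in> poly_over A"
    using add.prems[of \<zeta>]
    by (auto simp: poly_over_def coeff_pCons intro: zero_mem one_mem uminus_mem split: nat.splits)
  then show ?case using add by (simp add: P.mult_mem del: mult_pCons_left)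
qed

text \<open>
  Over the algebraic closure the roots of such a divisor are roots of unity, hence integral, and its
  coefficients are polynomial expressions in them.
\<close>

lemma unity_divisor_integral:
  fixes f :: "'a::field poly"
  assumes A: "field_subring A" and "f dvd Polynomial.monom 1 p - 1" "p > 0"
    and lc: "Polynomial.lead_coeff f \<in> integral_over A"
  shows "f \<in> poly_over (integral_over A)"
proof -
  interpret L: field_subring "to_ac ` A" by (rule to_ac_field_subring[OF A])
  define B where "B = integral_over (to_ac ` A)"
  interpret B: type_subring B unfolding B_def by (rule L.integral_over_subring)
  obtain Z where Z: "map_poly to_ac f = Polynomial.smult (to_ac (Polynomial.lead_coeff f)) (\<Prod>\<zeta>\<in>#Z. [:- \<zeta>, 1:])"
    "\<And>\<zeta>. \<zeta> \<in># Z \<Longrightarrow> \<zeta> ^ p = 1"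
    using unity_poly_splits[OF assms(2,3)] by metis
  have "\<zeta> \<in> B" if "\<zeta> \<in># Z" for \<zeta>
    unfolding B_def using Z(2)[OF that] assms(3)
    by (intro root_of_unity_integral L.field_subring_axioms) auto
  then have "(\<Prod>\<zeta>\<in>#Z. [:- \<zeta>, 1:]) \<in> poly_over B" by (rule B.prod_linear_poly_over)
  moreover have "to_ac (Polynomial.lead_coeff f) \<in> B"
    using lc unfolding B_def to_ac_mem_integral_over_iff .
  ultimately have "map_poly to_ac f \<in> poly_over B"
    unfolding Z(1) by (auto simp: poly_over_def intro: B.mult_mem)
  then show ?thesis by (auto simp: poly_over_def B_def to_ac_mem_integral_over_iff)
qed

text \<open>
  By the preceding congruence \<open>s\<close> has no root in common with \<open>x ^ p - 1\<close>. The latter splits over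
  the algebraic closure, so its linear factors can be moved past \<open>s\<close> one at a time, repeated ones
  included.
\<close>

lemma unity_poly_dvd_cancel:
  fixes s m :: "'a::field poly"
  assumes A: "field_subring A" and p: "Factorial_Ring.prime p" and p0: "of_nat p \<noteq> (0::'a)"
    and s: "s \<in> poly_over (integral_over A)"
    and nd: "\<not> (\<exists>r\<in>integral_over A. poly s 1 ^ p = of_nat p * r)"
    and dv: "Polynomial.monom 1 p - 1 dvd s * m"
  shows "Polynomial.monom 1 p - 1 dvd m"
proof -
  let ?X = "Polynomial.monom 1 p - 1 :: 'a poly"
  have p1: "p > 0" using p prime_gt_0_nat by auto
  obtain Z where Z: "map_poly to_ac ?X = Polynomial.smult (to_ac (Polynomial.lead_coeff ?X)) (\<Prod>\<zeta>\<in>#Z. [:- \<zeta>, 1:])"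
    "\<And>\<zeta>. \<zeta> \<in># Z \<Longrightarrow> \<zeta> ^ p = 1"
    using unity_poly_splits[OF dvd_refl p1] by metis
  have "Polynomial.coeff ?X p = 1" using p1 by simp
  then have nz: "Polynomial.lead_coeff ?X \<noteq> 0" by (metis leading_coeff_0_iff coeff_0 zero_neq_one)
  obtain k where "s * m = ?X * k" using dv unfolding dvd_def by blast
  then have "map_poly to_ac s * map_poly to_ac m = map_poly to_ac ?X * map_poly to_ac k"
    by (simp flip: to_ac_poly.hom_mult)
  then have "(\<Prod>\<zeta>\<in>#Z. [:- \<zeta>, 1:]) dvd map_poly to_ac s * map_poly to_ac m"
    unfolding Z(1) by simp
  then have "(\<Prod>\<zeta>\<in>#Z. [:- \<zeta>, 1:]) dvd map_poly to_ac m"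
    by (rule prod_linear_dvd_cancel) (use root_of_unity_zero_imp_dvd[OF A p p0 s] nd Z(2) in auto)
  then have "map_poly to_ac ?X dvd map_poly to_ac m"
    unfolding Z(1) using nz by (simp add: smult_dvd_iff)
  then show ?thesis by (rule to_ac.dvd_map_poly_hom_imp_dvd)
qed


section \<open>The ring of integers\<close>

lemma padic_int_mem:
  "(\<lambda>n. k mod int p ^ n) \<in> carrier (padic_ints p)" if "p > 0"
  using that by (auto simp: padic_ints_def mod_mod_cancel)

lemma padic_image_subring:
  assumes p: "p > 0" and h: "\<iota> \<in> ring_hom (padic_ints p) (ring_of_type_algebra :: 'a::field ring)"
  shows "field_subring (\<iota> ` carrier (padic_ints p))"
proof -
  let ?Z = "padic_ints p"
  have add: "\<iota> (x \<oplus>\<^bsub>?Z\<^esub> y) = \<iota> x + \<iota> y" and mult: "\<iota> (x \<otimes>\<^bsub>?Z\<^esub> y) = \<iota> x * \<iota> y"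
    if "x \<in> carrier ?Z" "y \<in> carrier ?Z" for x y
    using ring_hom_add[OF h that] ring_hom_mult[OF h that] by (auto simp: ring_of_type_algebra_def)
  have one: "\<iota> \<one>\<^bsub>?Z\<^esub> = 1" using ring_hom_one[OF h] by (simp add: ring_of_type_algebra_def)
  have cl: "x \<oplus>\<^bsub>?Z\<^esub> y \<in> carrier ?Z" "x \<otimes>\<^bsub>?Z\<^esub> y \<in> carrier ?Z"
    if "x \<in> carrier ?Z" "y \<in> carrier ?Z" for x y
  proof -
    have a: "x (Suc n) mod int p ^ n = x n" "y (Suc n) mod int p ^ n = y n" for n
      using that by (auto simp: padic_ints_def)
    have "(x (Suc n) + y (Suc n)) mod int p ^ n = (x n + y n) mod int p ^ n" for n
      using a by (metis mod_add_eq)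
    moreover have "(x (Suc n) * y (Suc n)) mod int p ^ n = (x n * y n) mod int p ^ n" for n
      using a by (metis mod_mult_eq)
    ultimately show "x \<oplus>\<^bsub>?Z\<^esub> y \<in> carrier ?Z" "x \<otimes>\<^bsub>?Z\<^esub> y \<in> carrier ?Z"
      using p by (auto simp: padic_ints_def mod_mod_cancel)
  qed
  have one_mem: "\<one>\<^bsub>?Z\<^esub> \<in> carrier ?Z"
    using padic_int_mem[OF p, of 1] by (simp add: padic_ints_def)
  have zero_mem: "(\<lambda>n. 0) \<in> carrier ?Z"
    using padic_int_mem[OF p, of 0] by simp
  have zero: "\<iota> (\<lambda>n. 0) = 0"
  proof -
    have "\<iota> (\<lambda>n. 0) = \<iota> (\<lambda>n. 0) + \<iota> (\<lambda>n. 0)"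
      using add[OF zero_mem zero_mem] by (simp add: padic_ints_def)
    then show ?thesis by (metis add_cancel_right_left)
  qed
  \<comment> \<open>Subtraction is reduced to multiplication by \<open>- 1\<close>.\<close>
  define u where "u = (\<lambda>n. (- 1) mod int p ^ n)"
  have u: "u \<in> carrier ?Z" unfolding u_def by (rule padic_int_mem[OF p])
  have "u \<oplus>\<^bsub>?Z\<^esub> \<one>\<^bsub>?Z\<^esub> = (\<lambda>n. 0)"
    unfolding u_def by (simp add: padic_ints_def mod_add_eq)
  then have m1: "\<iota> u = - 1"
    using add[OF u one_mem] one zero by (simp add: eq_neg_iff_add_eq_0)
  show ?thesis
  proof
    show "1 \<in> \<iota> ` carrier ?Z" using one one_mem by force
    fix a b assume "a \<in> \<iota> ` carrier ?Z" "b \<in> \<iota> ` carrier ?Z"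
    then obtain x y where xy: "x \<in> carrier ?Z" "y \<in> carrier ?Z" "a = \<iota> x" "b = \<iota> y" by auto
    show "a * b \<in> \<iota> ` carrier ?Z"
      using mult[OF xy(1,2)] cl[OF xy(1,2)] xy by force
    have "a - b = \<iota> (x \<oplus>\<^bsub>?Z\<^esub> (u \<otimes>\<^bsub>?Z\<^esub> y))"
      using add[OF xy(1) cl(2)[OF u xy(2)]] mult[OF u xy(2)] m1 xy by simp
    then show "a - b \<in> \<iota> ` carrier ?Z"
      using cl(1)[OF xy(1) cl(2)[OF u xy(2)]] by blast
  qed
qed

lemma padic_extension_of_nat_nonzero:
  assumes p: "p > 1" and "finite_padic_extension p (\<iota> :: _ \<Rightarrow> 'a::field)"
  shows "of_nat p \<noteq> (0 :: 'a)"
proof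
  assume p_zero: "of_nat p = (0 :: 'a)"
  let ?Z = "padic_ints p"
  have h: "\<iota> \<in> ring_hom ?Z (ring_of_type_algebra :: 'a ring)" and inj: "inj_on \<iota> (carrier ?Z)"
    using assms(2) by (auto simp: finite_padic_extension_def)
  have add: "\<iota> (x \<oplus>\<^bsub>?Z\<^esub> y) = \<iota> x + \<iota> y" if "x \<in> carrier ?Z" "y \<in> carrier ?Z" for x y
    using ring_hom_add[OF h that] by (auto simp: ring_of_type_algebra_def)
  have one: "\<iota> \<one>\<^bsub>?Z\<^esub> = 1" using ring_hom_one[OF h] by (simp add: ring_of_type_algebra_def)
  have mem: "(\<lambda>n. k mod int p ^ n) \<in> carrier ?Z" for k using p by (intro padic_int_mem) auto
  have e1: "\<one>\<^bsub>?Z\<^esub> = (\<lambda>n. 1 mod int p ^ n)" by (simp add: padic_ints_def)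
  have "\<iota> (\<lambda>n. int k mod int p ^ n) = of_nat k" for k
  proof (induction k)
    case 0
    have "\<iota> (\<lambda>n. 0) = \<iota> (\<lambda>n. 0) + \<iota> (\<lambda>n. 0)"
      using add[OF mem[of 0] mem[of 0]] by (simp add: padic_ints_def)
    then have "\<iota> (\<lambda>n. 0) = 0" by (metis add_cancel_right_left)
    then show ?case by simp
  next
    case (Suc k)
    have "(\<lambda>n. int (Suc k) mod int p ^ n) = (\<lambda>n. int k mod int p ^ n) \<oplus>\<^bsub>?Z\<^esub> \<one>\<^bsub>?Z\<^esub>"
      by (simp add: padic_ints_def mod_add_eq add.commute)
    then show ?case using add[OF mem[of "int k"] mem[of 1]] one Suc by (simp add: e1)
  qed
  note nat = this
  from p_zero nat[of p] nat[of 0]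
  have "(\<lambda>n. int p mod int p ^ n) = (\<lambda>n. int 0 mod int p ^ n)"
    using inj_onD[OF inj _ mem[of "int p"] mem[of "int 0"]] by simp
  \<comment> \<open>In the component modulo \<open>p ^ 2\<close> the element \<open>p\<close> is visibly nonzero.\<close>
  then have "int p mod int p ^ 2 = 0" by (metis mod_0 of_nat_0)
  then have "int p ^ 2 dvd int p" by auto
  moreover have "int p * 1 < int p * int p" using p by (intro mult_strict_left_mono) auto
  ultimately show False using p by (simp add: power2_eq_square zdvd_not_zless)
qed

abbreviation subring_record :: "'a::field set \<Rightarrow> 'a ring" where
  "subring_record A \<equiv> ring_of_type_algebra\<lparr>carrier := A\<rparr>"

lemma ring_of_integers_eq:
  "ring_of_integers p \<iota> = subring_record (integral_over (\<iota> ` carrier (padic_ints p)))"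
  by (simp add: ring_of_integers_def integral_over_def poly_over_def conj_assoc)

lemma ring_of_type_algebra_simps [simp]:
  "carrier ring_of_type_algebra = UNIV"
  "monoid.mult ring_of_type_algebra = (*)" "add ring_of_type_algebra = (+)"
  "\<one>\<^bsub>ring_of_type_algebra\<^esub> = 1" "\<zero>\<^bsub>ring_of_type_algebra\<^esub> = 0"
  by (simp_all add: ring_of_type_algebra_def fun_eq_iff)

lemma cring_subring_record:
  assumes "field_subring A"
  shows "cring (subring_record A)"
proof -
  interpret field_subring A by fact
  have "\<exists>y\<in>A. x + y = 0" if "x \<in> A" for x
    using uminus_mem[OF that] by (intro bexI[of _ "- x"]) auto
  then show ?thesis
    by (intro cringI abelian_groupI comm_monoidI)
      (auto simp: algebra_simps intro: zero_mem one_mem add_mem mult_mem)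
qed

text \<open>
  The ideal \<open>p R\<close> is a positive power of the maximal ideal \<open>P\<close>, hence contained in it. The
  conclusion lists the properties of a prime ideal over \<open>p\<close> in terms of the operations of the type.
\<close>

lemma ramified_prime:
  assumes "field_subring A" "ramified p (subring_record A)"
  obtains P where "1 \<notin> P" "\<And>x y. x \<in> P \<Longrightarrow> y \<in> P \<Longrightarrow> x + y \<in> P"
    "\<And>r. r \<in> A \<Longrightarrow> of_nat p * r \<in> P" "\<And>x n. x \<in> A \<Longrightarrow> x ^ n \<in> P \<Longrightarrow> x \<in> P"
proof -
  let ?R = "subring_record A"
  interpret field_subring A by fact
  interpret cring ?R by (rule cring_subring_record[OF assms(1)])
  obtain P and e :: nat where P: "maximalideal P ?R" "e > 1"
    "PIdl\<^bsub>?R\<^esub> ([p] \<cdot>\<^bsub>?R\<^esub> \<one>\<^bsub>?R\<^esub>) = P [^]\<^bsub>ideals_set ?R\<^esub> e"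
    using assms(2) unfolding ramified_def by auto
  interpret P: maximalideal P ?R by fact
  interpret P': primeideal P ?R by (rule maximalideal_prime[OF P(1)])
  interpret I: semiring "ideals_set ?R" by (rule ideals_set_is_semiring)
  have mul: "[n] \<cdot>\<^bsub>?R\<^esub> \<one>\<^bsub>?R\<^esub> = of_nat n" for n :: nat
  proof (induction n)
    case 0
    then show ?case by (simp add: add_pow_def nat_pow_def)
  next
    case (Suc n)
    have "[Suc n] \<cdot>\<^bsub>?R\<^esub> \<one>\<^bsub>?R\<^esub> = [n] \<cdot>\<^bsub>?R\<^esub> \<one>\<^bsub>?R\<^esub> \<oplus>\<^bsub>?R\<^esub> \<one>\<^bsub>?R\<^esub>"
      by (simp only: add_pow_def nat_pow_def) simp
    then show ?case unfolding Suc by (simp add: add.commute)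
  qed
  have PI: "P \<in> carrier (ideals_set ?R)"
    by (simp add: ideals_set_def P.ideal_axioms)
  obtain k where k: "e = Suc k" using P(2) by (cases e) auto
  have "P [^]\<^bsub>ideals_set ?R\<^esub> k \<in> carrier (ideals_set ?R)"
    by (rule I.nat_pow_closed[OF PI])
  then have "ideal (P [^]\<^bsub>ideals_set ?R\<^esub> k) ?R" by (simp add: ideals_set_def)
  then have "P [^]\<^bsub>ideals_set ?R\<^esub> e \<subseteq> P"
    using ideal_prod_inter[OF _ P.ideal_axioms] by (force simp: k ideals_set_def)
  moreover have "of_nat p \<in> PIdl\<^bsub>?R\<^esub> (of_nat p)"
    using cgenideal_self[of "of_nat p"] of_nat_mem by simp
  ultimately have pP: "of_nat p \<in> P" using P(3) mul by auto
  show ?thesis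
  proof (rule that[of P])
    show "1 \<notin> P" using P.one_imp_carrier P.I_notcarr by auto
    show "x + y \<in> P" if "x \<in> P" "y \<in> P" for x y
      using P.a_closed[OF that] by simp
    show "of_nat p * r \<in> P" if "r \<in> A" for r
      using P.I_r_closed[OF pP] that by simp
    show "x \<in> P" if "x \<in> A" "x ^ n \<in> P" for x n
      using that
    proof (induction n)
      case 0
      then show ?case using \<open>1 \<notin> P\<close> by simp
    next
      case (Suc n)
      then show ?case using P'.I_prime[of x "x ^ n"] power_mem by auto
    qed
  qed
qed

section \<open>The group algebra of a finite cyclic group as a quotient of a polynomial ring\<close>

lemma finsum_subring_record:
  assumes "field_subring A" "\<And>i. i \<in> I \<Longrightarrow> f i \<in> A"
  shows "finsum (subring_record A) f I = sum f I"
proof -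
  interpret field_subring A by fact
  interpret cring "subring_record A" by (rule cring_subring_record[OF assms(1)])
  show ?thesis
    using assms(2)
  proof (induction I rule: infinite_finite_induct)
    case (insert i I)
    then show ?case by (simp add: finsum_insert Pi_iff)
  qed simp_all
qed

lemma subring_record_UNIV: "subring_record UNIV = ring_of_type_algebra"
  by (simp add: ring_of_type_algebra_def)

lemma field_subring_UNIV: "field_subring UNIV"
  by unfold_locales auto

abbreviation group_algebra :: "'a::field set \<Rightarrow> ('g, 'l) monoid_scheme \<Rightarrow> ('g \<Rightarrow> 'a) ring" where
  "group_algebra A G \<equiv> group_ring (subring_record A) G"

lemma group_algebra_simps [simp]:
  "carrier (group_algebra A G) = carrier G \<rightarrow>\<^sub>E A"
  "\<zero>\<^bsub>group_algebra A G\<^esub> = (\<lambda>g\<in>carrier G. 0)"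
  "u \<oplus>\<^bsub>group_algebra A G\<^esub> v = (\<lambda>g\<in>carrier G. u g + v g)"
  "\<one>\<^bsub>group_algebra A G\<^esub> = (\<lambda>g\<in>carrier G. if g = \<one>\<^bsub>G\<^esub> then 1 else 0)"
  by (auto simp: group_ring_def restrict_def)

definition convolution :: "('g, 'l) monoid_scheme \<Rightarrow> ('g \<Rightarrow> 'a::field) \<Rightarrow> ('g \<Rightarrow> 'a) \<Rightarrow> 'g \<Rightarrow> 'a" where
  "convolution G u v = (\<lambda>g\<in>carrier G. \<Sum>h\<in>carrier G. u h * v (inv\<^bsub>G\<^esub> h \<otimes>\<^bsub>G\<^esub> g))"

lemma group_algebra_mult:
  assumes "field_subring A" "group G" "u \<in> carrier G \<rightarrow>\<^sub>E A" "v \<in> carrier G \<rightarrow>\<^sub>E A"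
  shows "u \<otimes>\<^bsub>group_algebra A G\<^esub> v = convolution G u v"
proof -
  interpret field_subring A by fact
  interpret G: group G by fact
  have "(\<Oplus>\<^bsub>subring_record A\<^esub>h\<in>carrier G. u h * v (inv\<^bsub>G\<^esub> h \<otimes>\<^bsub>G\<^esub> g))
      = (\<Sum>h\<in>carrier G. u h * v (inv\<^bsub>G\<^esub> h \<otimes>\<^bsub>G\<^esub> g))" if "g \<in> carrier G" for g
    using assms(3,4) that by (intro finsum_subring_record[OF assms(1)]) (auto simp: PiE_iff intro!: mult_mem)
  then show ?thesis
    unfolding convolution_def group_ring_def by (auto simp: fun_eq_iff)
qed

locale finite_cyclic = group G for G :: "'g monoid" (structure) +
  fixes a :: 'g and p :: nat
  assumes a_mem: "a \<in> carrier G" and gen: "generate G {a} = carrier G"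
    and order_p: "Coset.order G = p" and p_pos: "p > 0"
begin

lemma finite_carrier: "finite (carrier G)"
  using order_p p_pos unfolding Coset.order_def by (metis card.infinite less_numeral_extra(3))

lemma ord_a: "ord a = p"
  using generate_pow_card[OF a_mem] gen order_p by (simp add: Coset.order_def)

lemma carrier_eq: "carrier G = (\<lambda>i. a [^] i) ` {..<p}"
proof -
  have "carrier G = {a [^] k |k. k \<in> (UNIV :: nat set)}"
    using generate_pow_nat[OF a_mem] ord_a p_pos gen by simp
  also have "\<dots> = {a [^] k |k. k \<in> {0..p - 1}}"
    using ord_elems[OF finite_carrier a_mem] ord_a by simp
  also have "{0..p - 1} = {..<p}" using p_pos by auto
  finally show ?thesis by blast
qed

lemma pow_mem: "a [^] (i :: nat) \<in> carrier G"
  using a_mem by simp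

lemma pow_p: "a [^] p = \<one>"
  using pow_ord_eq_1[OF a_mem] ord_a by simp

lemma pow_inj: "i < p \<Longrightarrow> k < p \<Longrightarrow> a [^] i = a [^] k \<longleftrightarrow> i = k"
  using ord_inj[OF a_mem] ord_a by (auto simp: inj_on_def)

lemma obtain_pow:
  assumes "g \<in> carrier G"
  obtains i where "i < p" "g = a [^] i"
  using assms carrier_eq by auto

lemma m_commute: "g \<in> carrier G \<Longrightarrow> h \<in> carrier G \<Longrightarrow> g \<otimes> h = h \<otimes> g"
  by (elim obtain_pow) (simp add: a_mem nat_pow_mult add.commute)

text \<open>
  Computations in the group algebra are carried out with polynomials: \<open>pv\<close> turns out to be a ring
  homomorphism with kernel \<open>x ^ p - 1\<close> that maps the polynomials over \<open>A\<close> onto the group ring over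
  \<open>A\<close>.
\<close>

abbreviation pv :: "'a::field poly \<Rightarrow> 'g \<Rightarrow> 'a" where
  "pv f \<equiv> poly_at G f a"

lemma abelian_monoid_group_algebra: "abelian_monoid (group_algebra (UNIV :: 'a::field set) G)"
proof (rule abelian_monoidI)
  fix x y z :: "'g \<Rightarrow> 'a"
  assume "x \<in> carrier (group_algebra UNIV G)"
  then have x: "restrict x (carrier G) = x" by (simp add: PiE_iff extensional_restrict)
  show "\<zero>\<^bsub>group_algebra UNIV G\<^esub> \<oplus>\<^bsub>group_algebra UNIV G\<^esub> x = x"
    using x by (simp cong: restrict_cong)
qed (auto simp: algebra_simps cong: restrict_cong)

lemma finsum_group_algebra:
  assumes "finite I" and "\<And>i. i \<in> I \<Longrightarrow> F i \<in> extensional (carrier G)"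
  shows "finsum (group_algebra (UNIV :: 'a::field set) G) F I = (\<lambda>g\<in>carrier G. \<Sum>i\<in>I. F i g)"
proof -
  interpret abelian_monoid "group_algebra (UNIV :: 'a set) G"
    by (rule abelian_monoid_group_algebra)
  show ?thesis
    using assms
  proof (induction I rule: finite_induct)
    case empty
    show ?case by simp
  next
    case (insert i I)
    have "finsum (group_algebra UNIV G) F (insert i I)
        = F i \<oplus>\<^bsub>group_algebra UNIV G\<^esub> finsum (group_algebra UNIV G) F I"
      using insert by (intro finsum_insert) (auto simp: PiE_iff)
    then show ?case using insert by (simp cong: restrict_cong)
  qed
qed

lemma poly_at_UNIV: "pv f = finsum (group_algebra UNIV G)
    (\<lambda>i. group_ring_term ring_of_type_algebra G (Polynomial.coeff f i) (a [^] i)) {..Polynomial.degree f}"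
  by (simp add: poly_at_def subring_record_UNIV)

lemma pv_ext: "pv f \<in> extensional (carrier G)"
  unfolding poly_at_UNIV by (subst finsum_group_algebra) (auto simp: group_ring_term_def)

lemma pv_apply:
  assumes "g \<in> carrier G" "Polynomial.degree f \<le> n"
  shows "pv f g = (\<Sum>i\<le>n. if a [^] i = g then Polynomial.coeff f i else 0)"
proof -
  have "pv f g = (\<Sum>i\<le>Polynomial.degree f. if a [^] i = g then Polynomial.coeff f i else 0)"
    unfolding poly_at_UNIV using assms(1)
    by (subst finsum_group_algebra) (auto simp: group_ring_term_def intro!: sum.cong)
  also have "\<dots> = (\<Sum>i\<le>n. if a [^] i = g then Polynomial.coeff f i else 0)"
    using assms(2) by (intro sum.mono_neutral_left) (auto simp: coeff_eq_0)
  finally show ?thesis .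
qed

lemma pv_eqI: "(\<And>g. g \<in> carrier G \<Longrightarrow> pv f g = u g) \<Longrightarrow> u \<in> extensional (carrier G) \<Longrightarrow> pv f = u"
  using pv_ext by (rule extensionalityI)

lemma pv_add_apply: "g \<in> carrier G \<Longrightarrow> pv (f + h) g = pv f g + pv h g"
  using pv_apply[of g "f + h" "max (Polynomial.degree f) (Polynomial.degree h)"]
    pv_apply[of g f "max (Polynomial.degree f) (Polynomial.degree h)"]
    pv_apply[of g h "max (Polynomial.degree f) (Polynomial.degree h)"]
  by (auto simp: degree_add_le_max simp flip: sum.distrib intro!: sum.cong)

lemma pv_add: "pv (f + h) = (\<lambda>g\<in>carrier G. pv f g + pv h g)"
  by (rule pv_eqI) (auto simp: pv_add_apply)

lemma pv_smult_apply: "g \<in> carrier G \<Longrightarrow> pv (Polynomial.smult c f) g = c * pv f g"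
  using pv_apply[of g "Polynomial.smult c f" "Polynomial.degree f"] pv_apply[of g f "Polynomial.degree f"]
  by (auto simp: sum_distrib_left intro!: sum.cong)

lemma pv_0: "pv 0 = (\<lambda>g\<in>carrier G. 0)"
  by (rule pv_eqI) (auto simp: pv_apply[OF _ order_refl] intro!: sum.neutral)

lemma pv_pCons_apply:
  assumes g: "g \<in> carrier G"
  shows "pv (pCons c f) g = (if g = \<one> then c else 0) + pv f (inv a \<otimes> g)"
proof -
  have eq: "a [^] Suc i = g \<longleftrightarrow> a [^] i = inv a \<otimes> g" for i :: nat
  proof -
    have "a [^] Suc i = a \<otimes> a [^] i"
      using a_mem by (simp add: m_commute)
    then show ?thesis using g a_mem by (metis inv_solve_left pow_mem)
  qed
  have "pv (pCons c f) g = (\<Sum>i\<le>Suc (Polynomial.degree f). if a [^] i = g then Polynomial.coeff (pCons c f) i else 0)"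
    using g degree_pCons_le[of c f] by (intro pv_apply) auto
  also have "\<dots> = (if g = \<one> then c else 0) + (\<Sum>i\<le>Polynomial.degree f. if a [^] i = inv a \<otimes> g then Polynomial.coeff f i else 0)"
    unfolding sum.atMost_Suc_shift eq coeff_pCons_Suc by auto
  also have "(\<Sum>i\<le>Polynomial.degree f. if a [^] i = inv a \<otimes> g then Polynomial.coeff f i else 0) = pv f (inv a \<otimes> g)"
    using g a_mem by (intro pv_apply[symmetric]) auto
  finally show ?thesis .
qed

lemma pv_1: "pv 1 = (\<lambda>g\<in>carrier G. if g = \<one> then 1 else 0)"
  by (rule pv_eqI) (auto simp: pv_apply[OF _ order_refl])

text \<open>
  Induction on \<open>f\<close>: a factor \<open>x\<close> in the polynomial translates the argument by \<open>a\<close>, which is a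
  reindexing of the sum.
\<close>

lemma pv_mult_apply:
  "g \<in> carrier G \<Longrightarrow> pv (f * h) g = (\<Sum>x\<in>carrier G. pv f x * pv h (inv x \<otimes> g))"
proof (induction f arbitrary: g)
  case 0
  have "(\<Sum>x\<in>carrier G. pv 0 x * pv h (inv x \<otimes> g)) = 0"
    by (intro sum.neutral) (auto simp: pv_0)
  then show ?case using 0 by (simp add: pv_0)
next
  case (pCons c f)
  have ag: "inv a \<otimes> g \<in> carrier G" using pCons.prems a_mem by simp
  have "(\<Sum>x\<in>carrier G. pv (pCons c f) x * pv h (inv x \<otimes> g))
      = (\<Sum>x\<in>carrier G. if x = \<one> then c * pv h g else 0)
        + (\<Sum>x\<in>carrier G. pv f (inv a \<otimes> x) * pv h (inv x \<otimes> g))"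
    unfolding sum.distrib[symmetric] using pCons.prems
    by (intro sum.cong) (auto simp: pv_pCons_apply distrib_right)
  also have "(\<Sum>x\<in>carrier G. if x = \<one> then c * pv h g else 0) = c * pv h g"
    using finite_carrier by simp
  also have "(\<Sum>x\<in>carrier G. pv f (inv a \<otimes> x) * pv h (inv x \<otimes> g))
      = (\<Sum>y\<in>carrier G. pv f y * pv h (inv y \<otimes> (inv a \<otimes> g)))"
  proof (rule sum.reindex_bij_witness[where i = "\<lambda>y. a \<otimes> y" and j = "\<lambda>x. inv a \<otimes> x"])
    fix x assume x: "x \<in> carrier G"
    show "a \<otimes> (inv a \<otimes> x) = x" "inv a \<otimes> (a \<otimes> x) = x"
      using x a_mem by (simp_all flip: m_assoc)
    show "inv a \<otimes> x \<in> carrier G" "a \<otimes> x \<in> carrier G"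
      using x a_mem by simp_all
    have "inv (inv a \<otimes> x) \<otimes> (inv a \<otimes> g) = inv x \<otimes> (a \<otimes> (inv a \<otimes> g))"
      using x a_mem pCons.prems by (simp add: inv_mult_group m_assoc)
    also have "a \<otimes> (inv a \<otimes> g) = g"
      using a_mem pCons.prems by (simp flip: m_assoc)
    finally show "pv f (inv a \<otimes> x) * pv h (inv (inv a \<otimes> x) \<otimes> (inv a \<otimes> g))
        = pv f (inv a \<otimes> x) * pv h (inv x \<otimes> g)"
      by simp
  qed
  also have "\<dots> = pv (f * h) (inv a \<otimes> g)" using pCons.IH[OF ag] by simp
  also have "c * pv h g + pv (f * h) (inv a \<otimes> g) = pv (pCons c f * h) g"
    using pCons.prems ag by (simp add: pv_add_apply pv_smult_apply pv_pCons_apply)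
  finally show ?case by simp
qed

lemma pv_mult: "pv (f * h) = convolution G (pv f) (pv h)"
  by (rule pv_eqI) (auto simp: pv_mult_apply convolution_def)

lemma pv_monom: "pv (Polynomial.monom r i) = (\<lambda>h\<in>carrier G. if h = a [^] i then r else 0)"
proof (rule pv_eqI)
  fix g assume g: "g \<in> carrier G"
  have "pv (Polynomial.monom r i) g
      = (\<Sum>k\<le>i. if a [^] k = g then Polynomial.coeff (Polynomial.monom r i) k else 0)"
    by (rule pv_apply[OF g degree_monom_le])
  also have "\<dots> = (\<Sum>k\<le>i. if k = i then (if a [^] i = g then r else 0) else 0)"
    by (intro sum.cong) auto
  finally have "pv (Polynomial.monom r i) g = (if a [^] i = g then r else 0)" by simp
  then show "pv (Polynomial.monom r i) g = (\<lambda>h\<in>carrier G. if h = a [^] i then r else 0) g"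
    using g by auto
qed auto

lemma pv_monom_term: "pv (Polynomial.monom r i) = group_ring_term (subring_record A) G r (a [^] i)"
  by (auto simp: pv_monom group_ring_term_def restrict_def)

lemma sum_pv: "(\<Sum>g\<in>carrier G. pv f g) = poly f 1"
proof -
  have "(\<Sum>g\<in>carrier G. pv f g)
      = (\<Sum>g\<in>carrier G. \<Sum>i\<le>Polynomial.degree f. if a [^] i = g then Polynomial.coeff f i else 0)"
    by (intro sum.cong) (auto simp: pv_apply)
  also have "\<dots> = (\<Sum>i\<le>Polynomial.degree f. \<Sum>g\<in>carrier G. if a [^] i = g then Polynomial.coeff f i else 0)"
    by (rule sum.swap)
  also have "\<dots> = (\<Sum>i\<le>Polynomial.degree f. Polynomial.coeff f i)"
    using finite_carrier a_mem by (intro sum.cong) auto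
  finally show ?thesis by (simp add: poly_altdef)
qed

lemma pv_apply_pow:
  assumes "Polynomial.degree f < p" "k < p"
  shows "pv f (a [^] k) = Polynomial.coeff f k"
proof -
  have "pv f (a [^] k) = (\<Sum>i\<le>p - 1. if i = k then Polynomial.coeff f k else 0)"
    using assms by (subst pv_apply[where n = "p - 1"]) (auto simp: a_mem pow_inj intro!: sum.cong)
  then show ?thesis using assms by simp
qed

lemma pv_surj:
  assumes A: "field_subring A" and u: "u \<in> carrier G \<rightarrow>\<^sub>E A"
  obtains f where "f \<in> poly_over A" "pv f = u"
proof -
  interpret field_subring A by fact
  interpret P: type_subring "poly_over A" by (rule poly_over_subring)
  define f where "f = (\<Sum>i<p. Polynomial.monom (u (a [^] i)) i)"
  have mem: "f \<in> poly_over A"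
    unfolding f_def using u a_mem by (intro P.sum_mem monom_poly_over) (auto simp: PiE_iff)
  have cf: "Polynomial.coeff f k = (if k < p then u (a [^] k) else 0)" for k
    unfolding f_def by (simp add: coeff_sum)
  have deg: "Polynomial.degree f < p"
    using p_pos cf by (intro degree_lessI) auto
  have "pv f = u"
  proof (rule pv_eqI)
    show "u \<in> extensional (carrier G)" using u by (simp add: PiE_iff)
    fix g assume "g \<in> carrier G"
    then obtain k where "k < p" "g = a [^] k" by (rule obtain_pow)
    then show "pv f g = u g" using deg cf by (simp add: pv_apply_pow)
  qed
  then show ?thesis using mem that by blast
qed

lemma pv_closed:
  assumes A: "field_subring A" and f: "f \<in> poly_over A"
  shows "pv f \<in> carrier G \<rightarrow>\<^sub>E A"
proof -
  interpret field_subring A by fact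
  show ?thesis
    using f pv_ext[of f]
    by (auto simp: PiE_iff pv_apply[OF _ order_refl] poly_over_def intro!: sum_mem zero_mem)
qed

lemma pv_unity: "pv (Polynomial.monom 1 p - 1) = pv 0"
proof -
  have eq: "pv (Polynomial.monom 1 p) = pv 1"
    by (auto simp: pv_monom pv_1 pow_p fun_eq_iff)
  have "pv (Polynomial.monom 1 p - 1) g = pv 0 g" if "g \<in> carrier G" for g
  proof -
    have "pv 1 g = pv (Polynomial.monom 1 p - 1) g + pv 1 g"
      using pv_add_apply[OF that, of "Polynomial.monom 1 p - 1" 1] unfolding diff_add_cancel eq .
    then show ?thesis using that by (simp add: pv_0)
  qed
  then show ?thesis
    by (intro pv_eqI pv_ext)
qed

text \<open>
  Below degree \<open>p\<close> the coefficients of a polynomial are the values of \<open>pv\<close> at the distinct powers of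
  \<open>a\<close>; a general polynomial is reduced modulo \<open>x ^ p - 1\<close>.
\<close>

lemma pv_eq_0_iff: "pv f = pv 0 \<longleftrightarrow> Polynomial.monom 1 p - 1 dvd f"
proof
  let ?X = "Polynomial.monom 1 p - 1 :: 'a poly"
  have X: "pv (?X * k) = pv 0" for k
    using pv_mult[of 0 k] by (simp add: pv_mult pv_unity)
  show "pv f = pv 0" if "?X dvd f" using that X by (auto elim: dvdE)
  assume f0: "pv f = pv 0"
  have degX: "Polynomial.degree ?X = p"
    using p_pos by (intro antisym degree_le le_degree) auto
  have X0: "?X \<noteq> 0" using degX p_pos by auto
  define r where "r = f mod ?X"
  have dec: "f = ?X * (f div ?X) + r" unfolding r_def by simp
  have deg: "Polynomial.degree r < p"
    using degree_mod_less[OF X0, of f] degX p_pos unfolding r_def by auto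
  have "pv f g = pv r g" if "g \<in> carrier G" for g
    using that pv_add_apply[OF that, of "?X * (f div ?X)" r] dec X[of "f div ?X"] by (simp add: pv_0)
  then have "Polynomial.coeff r k = 0" if "k < p" for k
    using pv_apply_pow[OF deg that] f0 pow_mem[of k] by (simp add: pv_0)
  then have "r = 0" using deg by (metis leading_coeff_0_iff)
  then show "?X dvd f" unfolding r_def by (simp add: mod_eq_0_iff_dvd)
qed

lemma pv_diff_eq:
  fixes f h :: "'a::field poly"
  shows "pv f = pv h \<longleftrightarrow> pv (f - h) = pv 0"
proof -
  have "pv f g = pv (f - h) g + pv h g" if "g \<in> carrier G" for g
    using pv_add_apply[OF that, of "f - h" h] by simp
  then have "(\<forall>g\<in>carrier G. pv f g = pv h g) \<longleftrightarrow> (\<forall>g\<in>carrier G. pv (f - h) g = pv 0 g)"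
    by (simp add: pv_0)
  moreover have "pv f' = pv h' \<longleftrightarrow> (\<forall>g\<in>carrier G. pv f' g = pv h' g)" for f' h' :: "'a poly"
    using extensionalityI[OF pv_ext[of f'] pv_ext[of h']] by auto
  ultimately show ?thesis by simp
qed

lemma group_algebra_pv_add: "pv f \<oplus>\<^bsub>group_algebra A G\<^esub> pv h = pv (f + h)"
  by (simp add: pv_add)

lemma group_algebra_pv_mult:
  assumes "field_subring A" "f \<in> poly_over A" "h \<in> poly_over A"
  shows "pv f \<otimes>\<^bsub>group_algebra A G\<^esub> pv h = pv (f * h)"
  using assms by (simp add: group_algebra_mult is_group pv_closed pv_mult)

lemma group_algebra_carrier_eq:
  assumes "field_subring A"
  shows "carrier (group_algebra A G) = pv ` poly_over A"
proof (intro subset_antisym subsetI)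
  fix u assume "u \<in> carrier (group_algebra A G)"
  then obtain f where "f \<in> poly_over A" "pv f = u"
    using pv_surj[OF assms, of u] by auto
  then show "u \<in> pv ` poly_over A" by blast
next
  fix u assume "u \<in> pv ` poly_over A"
  then show "u \<in> carrier (group_algebra A G)"
    using pv_closed[OF assms] unfolding group_algebra_simps by blast
qed

lemma group_algebra_one_pv: "\<one>\<^bsub>group_algebra A G\<^esub> = pv 1"
  by (simp add: pv_1)

lemma group_algebra_zero_pv: "\<zero>\<^bsub>group_algebra A G\<^esub> = pv 0"
  by (simp add: pv_0)

text \<open>
  All ring axioms are inherited from the polynomials over \<open>A\<close>.
\<close>

lemma cring_group_algebra:
  assumes A: "field_subring A"
  shows "cring (group_algebra A G)"
proof -
  interpret field_subring A by fact
  interpret P: type_subring "poly_over A" by (rule poly_over_subring)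
  note carrier = group_algebra_carrier_eq[OF A]
  note mult = group_algebra_pv_mult[OF A]
  note ops = group_algebra_pv_add group_algebra_one_pv group_algebra_zero_pv
  note closed = P.add_mem P.mult_mem P.zero_mem P.one_mem
  note [simp del] = group_algebra_simps
  show ?thesis
  proof (rule cringI)
    show "abelian_group (group_algebra A G)"
    proof (rule abelian_groupI)
      fix u assume "u \<in> carrier (group_algebra A G)"
      then obtain f where f: "f \<in> poly_over A" "u = pv f" unfolding carrier by auto
      have "pv (- f) \<oplus>\<^bsub>group_algebra A G\<^esub> u = \<zero>\<^bsub>group_algebra A G\<^esub>"
        unfolding f ops by simp
      then show "\<exists>v\<in>carrier (group_algebra A G). v \<oplus>\<^bsub>group_algebra A G\<^esub> u = \<zero>\<^bsub>group_algebra A G\<^esub>"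
        unfolding carrier using P.uminus_mem[OF f(1)] by blast
    qed (auto simp: carrier ops closed add.assoc add.commute add.left_commute)
    show "comm_monoid (group_algebra A G)"
    proof (rule comm_monoidI)
      fix u v w
      assume "u \<in> carrier (group_algebra A G)" "v \<in> carrier (group_algebra A G)"
        "w \<in> carrier (group_algebra A G)"
      then obtain f h k where f: "f \<in> poly_over A" "h \<in> poly_over A" "k \<in> poly_over A"
          "u = pv f" "v = pv h" "w = pv k"
        unfolding carrier by auto
      then show "u \<otimes>\<^bsub>group_algebra A G\<^esub> v \<otimes>\<^bsub>group_algebra A G\<^esub> w
          = u \<otimes>\<^bsub>group_algebra A G\<^esub> (v \<otimes>\<^bsub>group_algebra A G\<^esub> w)"
        by (simp add: mult closed mult.assoc)
    next
      fix u v
      assume "u \<in> carrier (group_algebra A G)" "v \<in> carrier (group_algebra A G)"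
      then obtain f h where f: "f \<in> poly_over A" "h \<in> poly_over A" "u = pv f" "v = pv h"
        unfolding carrier by auto
      then show "u \<otimes>\<^bsub>group_algebra A G\<^esub> v = v \<otimes>\<^bsub>group_algebra A G\<^esub> u"
        by (simp add: mult mult.commute)
      show "u \<otimes>\<^bsub>group_algebra A G\<^esub> v \<in> carrier (group_algebra A G)"
        unfolding carrier using f by (simp add: mult closed)
    qed (auto simp: carrier ops mult closed)
  next
    fix u v w
    assume "u \<in> carrier (group_algebra A G)" "v \<in> carrier (group_algebra A G)"
      "w \<in> carrier (group_algebra A G)"
    then obtain f h k where f: "f \<in> poly_over A" "h \<in> poly_over A" "k \<in> poly_over A"
        "u = pv f" "v = pv h" "w = pv k"
      unfolding carrier by auto
    then show "(u \<oplus>\<^bsub>group_algebra A G\<^esub> v) \<otimes>\<^bsub>group_algebra A G\<^esub> w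
        = u \<otimes>\<^bsub>group_algebra A G\<^esub> w \<oplus>\<^bsub>group_algebra A G\<^esub> v \<otimes>\<^bsub>group_algebra A G\<^esub> w"
      by (simp add: mult closed ops distrib_right)
  qed
qed

end

section \<open>The module generated by a divisor\<close>

locale divisor_module = finite_cyclic G a p for G :: "'g monoid" (structure) and a p +
  fixes A :: "'a::field set" and \<eta> :: "'a poly"
  assumes A: "field_subring A"
begin

sublocale A: field_subring A by (rule A)
sublocale AP: type_subring "poly_over A" by (rule A.poly_over_subring)

abbreviation RG :: "('g \<Rightarrow> 'a) ring" where "RG \<equiv> group_algebra A G"
abbreviation M :: "('g \<Rightarrow> 'a, 'g \<Rightarrow> 'a) module" where "M \<equiv> poly_module (subring_record A) G a \<eta>"

lemma UNIV_mult: "pv f \<otimes>\<^bsub>group_ring ring_of_type_algebra G\<^esub> pv h = pv (f * h)" for f :: "'a poly"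
  using group_algebra_pv_mult[OF field_subring_UNIV, of f h]
  by (simp add: poly_over_def subring_record_UNIV)

lemma M_carrier: "carrier M = (\<lambda>h. pv (\<eta> * h)) ` poly_over A"
proof -
  have "carrier M = {pv \<eta> \<otimes>\<^bsub>group_ring ring_of_type_algebra G\<^esub> u |u. u \<in> carrier RG}"
    by (simp add: poly_module_def module_of_def Let_def del: group_algebra_simps)
  also have "\<dots> = (\<lambda>u. pv \<eta> \<otimes>\<^bsub>group_ring ring_of_type_algebra G\<^esub> u) ` carrier RG"
    by blast
  finally show ?thesis
    unfolding group_algebra_carrier_eq[OF A] by (simp add: image_image UNIV_mult)
qed

lemma M_mem: "h \<in> poly_over A \<Longrightarrow> pv (\<eta> * h) \<in> carrier M"
  unfolding M_carrier by blast

lemma obtain_M: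
  assumes "m \<in> carrier M"
  obtains h where "h \<in> poly_over A" "m = pv (\<eta> * h)"
  using assms unfolding M_carrier by blast

lemma obtain_RG:
  assumes "u \<in> carrier RG"
  obtains h where "h \<in> poly_over A" "u = pv h"
  using assms unfolding group_algebra_carrier_eq[OF A] by blast

lemma M_add: "pv f \<oplus>\<^bsub>M\<^esub> pv h = pv (f + h)"
  using group_algebra_pv_add[where f = f and A = UNIV and h = h]
  by (simp add: poly_module_def module_of_def Let_def subring_record_UNIV del: group_algebra_simps)

lemma M_zero: "\<zero>\<^bsub>M\<^esub> = pv 0"
  using group_algebra_zero_pv[where A = UNIV]
  by (simp add: poly_module_def module_of_def Let_def subring_record_UNIV del: group_algebra_simps)

lemma M_smult: "pv f \<odot>\<^bsub>M\<^esub> pv h = pv (f * h)"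
  by (simp add: poly_module_def module_of_def Let_def UNIV_mult)

lemma abelian_group_M: "abelian_group M"
proof (rule abelian_groupI)
  fix u v w assume "u \<in> carrier M" "v \<in> carrier M" "w \<in> carrier M"
  then obtain f g h where f: "f \<in> poly_over A" "g \<in> poly_over A" "h \<in> poly_over A"
      "u = pv (\<eta> * f)" "v = pv (\<eta> * g)" "w = pv (\<eta> * h)"
    by (metis obtain_M)
  then show "u \<oplus>\<^bsub>M\<^esub> v \<oplus>\<^bsub>M\<^esub> w = u \<oplus>\<^bsub>M\<^esub> (v \<oplus>\<^bsub>M\<^esub> w)"
    by (simp add: M_add add.assoc)
next
  fix u v assume "u \<in> carrier M" "v \<in> carrier M"
  then obtain f g where f: "f \<in> poly_over A" "g \<in> poly_over A"
      "u = pv (\<eta> * f)" "v = pv (\<eta> * g)"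
    by (metis obtain_M)
  then show "u \<oplus>\<^bsub>M\<^esub> v = v \<oplus>\<^bsub>M\<^esub> u" by (simp add: M_add add.commute)
  show "u \<oplus>\<^bsub>M\<^esub> v \<in> carrier M"
    using M_mem[OF AP.add_mem[OF f(1,2)]] f by (simp add: M_add distrib_left)
next
  fix u assume "u \<in> carrier M"
  then obtain f where f: "f \<in> poly_over A" "u = pv (\<eta> * f)" by (metis obtain_M)
  then show "\<zero>\<^bsub>M\<^esub> \<oplus>\<^bsub>M\<^esub> u = u" by (simp add: M_zero M_add)
  show "\<exists>v\<in>carrier M. v \<oplus>\<^bsub>M\<^esub> u = \<zero>\<^bsub>M\<^esub>"
    using M_mem[OF AP.uminus_mem[OF f(1)]] f by (intro bexI[of _ "pv (\<eta> * - f)"]) (simp_all add: M_zero M_add)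
next
  show "\<zero>\<^bsub>M\<^esub> \<in> carrier M" using M_mem[OF AP.zero_mem] by (simp add: M_zero)
qed

lemma module_M: "module RG M"
proof (rule moduleI[OF cring_group_algebra[OF A] abelian_group_M])
  note [simp del] = group_algebra_simps
  fix x u assume "x \<in> carrier RG" "u \<in> carrier M"
  then obtain r f where f: "r \<in> poly_over A" "x = pv r" "f \<in> poly_over A" "u = pv (\<eta> * f)"
    by (metis obtain_M obtain_RG)
  have "x \<odot>\<^bsub>M\<^esub> u = pv (\<eta> * (r * f))" using f by (simp add: M_smult mult.left_commute)
  then show "x \<odot>\<^bsub>M\<^esub> u \<in> carrier M" using M_mem[OF AP.mult_mem[OF f(1,3)]] by simp
next
  note [simp del] = group_algebra_simps
  fix x y u assume "x \<in> carrier RG" "y \<in> carrier RG" "u \<in> carrier M"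
  then obtain r s f where f: "r \<in> poly_over A" "x = pv r" "s \<in> poly_over A" "y = pv s"
      "f \<in> poly_over A" "u = pv (\<eta> * f)"
    by (metis obtain_M obtain_RG)
  then show "(x \<oplus>\<^bsub>RG\<^esub> y) \<odot>\<^bsub>M\<^esub> u = x \<odot>\<^bsub>M\<^esub> u \<oplus>\<^bsub>M\<^esub> y \<odot>\<^bsub>M\<^esub> u"
    "x \<otimes>\<^bsub>RG\<^esub> y \<odot>\<^bsub>M\<^esub> u = x \<odot>\<^bsub>M\<^esub> (y \<odot>\<^bsub>M\<^esub> u)"
    by (simp_all add: group_algebra_pv_add group_algebra_pv_mult[OF A] M_smult M_add
        distrib_right mult.assoc)
next
  note [simp del] = group_algebra_simps
  fix x u v assume "x \<in> carrier RG" "u \<in> carrier M" "v \<in> carrier M"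
  then obtain r f g where "x = pv r" "u = pv (\<eta> * f)" "v = pv (\<eta> * g)"
    by (metis obtain_M obtain_RG)
  then show "x \<odot>\<^bsub>M\<^esub> (u \<oplus>\<^bsub>M\<^esub> v) = x \<odot>\<^bsub>M\<^esub> u \<oplus>\<^bsub>M\<^esub> x \<odot>\<^bsub>M\<^esub> v"
    by (simp add: M_smult M_add distrib_left)
next
  note [simp del] = group_algebra_simps
  fix u assume "u \<in> carrier M"
  then obtain f where "u = pv (\<eta> * f)" by (metis obtain_M)
  then show "\<one>\<^bsub>RG\<^esub> \<odot>\<^bsub>M\<^esub> u = u" by (simp add: group_algebra_one_pv M_smult)
qed

text \<open>
  If \<open>\<eta>(a) = \<alpha> + \<beta>\<close> along a decomposition and \<open>\<alpha> = s \<eta>(a)\<close>, then \<open>s \<beta>\<close> lies in both summands, so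
  \<open>s \<beta> = 0\<close> and \<open>(1 - s) \<alpha> = 0\<close>. The assumption \<open>local\<close>, which replaces invertibility of \<open>s\<close> or \<open>1 - s\<close>
  by cancellability, then makes \<open>\<alpha>\<close> or \<open>\<beta>\<close> vanish, and the other one generates the whole module.
\<close>

lemma indecomposable_M:
  assumes nz: "\<not> Polynomial.monom 1 p - 1 dvd \<eta>"
    and local: "\<And>s. s \<in> poly_over A \<Longrightarrow>
      (\<forall>m. Polynomial.monom 1 p - 1 dvd s * m \<longrightarrow> Polynomial.monom 1 p - 1 dvd m) \<or>
      (\<forall>m. Polynomial.monom 1 p - 1 dvd (1 - s) * m \<longrightarrow> Polynomial.monom 1 p - 1 dvd m)"
  shows "indecomposable_module RG M"
proof -
  interpret M: module RG M by (rule module_M)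
  have one: "pv \<eta> \<in> carrier M" using M_mem[OF AP.one_mem] by simp
  have "pv \<eta> \<noteq> \<zero>\<^bsub>M\<^esub>" using nz by (simp add: M_zero pv_eq_0_iff)
  then have nt: "carrier M \<noteq> {\<zero>\<^bsub>M\<^esub>}" using one by blast
  have zero_summand: "D = {\<zero>\<^bsub>M\<^esub>}"
    if sub: "submodule C RG M" "submodule D RG M" and int: "C \<inter> D = {\<zero>\<^bsub>M\<^esub>}" and mem: "pv \<eta> \<in> C" for C D
  proof -
    have "carrier M \<subseteq> C"
    proof
      fix m assume "m \<in> carrier M"
      then obtain h where h: "h \<in> poly_over A" "m = pv (\<eta> * h)" by (rule obtain_M)
      have "pv h \<in> carrier RG" using h(1) unfolding group_algebra_carrier_eq[OF A] by blast
      then have "pv h \<odot>\<^bsub>M\<^esub> pv \<eta> \<in> C" using M.submoduleE(4)[OF sub(1)] mem by blast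
      then show "m \<in> C" using h by (simp add: M_smult mult.commute)
    qed
    then show ?thesis using M.submoduleE(1)[OF sub(2)] int by blast
  qed
  have "C = {\<zero>\<^bsub>M\<^esub>} \<or> D = {\<zero>\<^bsub>M\<^esub>}"
    if sub: "submodule C RG M" "submodule D RG M" and int: "C \<inter> D = {\<zero>\<^bsub>M\<^esub>}"
      and dec: "C <+>\<^bsub>M\<^esub> D = carrier M" for C D
  proof -
    have "pv \<eta> \<in> C <+>\<^bsub>M\<^esub> D" using one dec by simp
    then obtain \<alpha> \<beta> where ab: "\<alpha> \<in> C" "\<beta> \<in> D" "pv \<eta> = \<alpha> \<oplus>\<^bsub>M\<^esub> \<beta>"
      unfolding set_add_def' by auto
    obtain s where s: "s \<in> poly_over A" "\<alpha> = pv (\<eta> * s)"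
      using M.submoduleE(1)[OF sub(1)] ab(1) obtain_M by blast
    obtain t where t: "t \<in> poly_over A" "\<beta> = pv (\<eta> * t)"
      using M.submoduleE(1)[OF sub(2)] ab(2) obtain_M by blast
    have st: "pv \<eta> = pv (\<eta> * s + \<eta> * t)" using ab(3) s t by (simp add: M_add)
    have prod: "pv s \<odot>\<^bsub>M\<^esub> \<beta> = pv t \<odot>\<^bsub>M\<^esub> \<alpha>" using s t by (simp add: M_smult mult_ac)
    have "pv s \<in> carrier RG" "pv t \<in> carrier RG"
      using s t unfolding group_algebra_carrier_eq[OF A] by blast+
    then have "pv s \<odot>\<^bsub>M\<^esub> \<beta> \<in> D" "pv t \<odot>\<^bsub>M\<^esub> \<alpha> \<in> C"
      using M.submoduleE(4)[OF sub(1)] M.submoduleE(4)[OF sub(2)] ab by blast+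
    then have "pv s \<odot>\<^bsub>M\<^esub> \<beta> \<in> C \<inter> D" using prod by simp
    then have sb0: "pv (s * (\<eta> * t)) = pv 0"
      unfolding int t(2) M_smult M_zero by simp
    have "pv ((1 - s) * (\<eta> * s)) = pv 0"
    proof -
      have "pv (s * (\<eta> * s + \<eta> * t)) = pv (s * \<eta>)"
        by (simp only: UNIV_mult[symmetric, of s] st)
      then have "pv (s * (\<eta> * s + \<eta> * t) - s * \<eta>) = pv 0"
        using pv_diff_eq by blast
      then have "Polynomial.monom 1 p - 1 dvd s * (\<eta> * s + \<eta> * t) - s * \<eta>"
        unfolding pv_eq_0_iff .
      moreover have "Polynomial.monom 1 p - 1 dvd s * (\<eta> * t)"
        using sb0 unfolding pv_eq_0_iff .
      ultimately have "Polynomial.monom 1 p - 1 dvd s * (\<eta> * t) - (s * (\<eta> * s + \<eta> * t) - s * \<eta>)"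
        by (rule dvd_diff[rotated])
      also have "s * (\<eta> * t) - (s * (\<eta> * s + \<eta> * t) - s * \<eta>) = (1 - s) * (\<eta> * s)"
        by (simp add: algebra_simps)
      finally show ?thesis unfolding pv_eq_0_iff .
    qed
    note sa0 = this[unfolded pv_eq_0_iff]
    have "Polynomial.monom 1 p - 1 dvd \<eta> * t \<or> Polynomial.monom 1 p - 1 dvd \<eta> * s"
      using local[OF s(1)]
    proof
      assume "\<forall>m. Polynomial.monom 1 p - 1 dvd s * m \<longrightarrow> Polynomial.monom 1 p - 1 dvd m"
      from spec[OF this] sb0[unfolded pv_eq_0_iff] have "Polynomial.monom 1 p - 1 dvd \<eta> * t" by (rule mp)
      then show ?thesis by (rule disjI1)
    next
      assume "\<forall>m. Polynomial.monom 1 p - 1 dvd (1 - s) * m \<longrightarrow> Polynomial.monom 1 p - 1 dvd m"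
      from spec[OF this] sa0 have "Polynomial.monom 1 p - 1 dvd \<eta> * s" by (rule mp)
      then show ?thesis by (rule disjI2)
    qed
    then have "\<beta> = \<zero>\<^bsub>M\<^esub> \<or> \<alpha> = \<zero>\<^bsub>M\<^esub>"
      unfolding s(2) t(2) M_zero pv_eq_0_iff .
    then show ?thesis
    proof
      assume "\<beta> = \<zero>\<^bsub>M\<^esub>"
      then have "pv \<eta> = \<alpha>" using ab(3) s by (simp add: M_zero M_add)
      then show ?thesis using zero_summand[OF sub int] ab(1) by simp
    next
      assume "\<alpha> = \<zero>\<^bsub>M\<^esub>"
      then have "pv \<eta> = \<beta>" using ab(3) t by (simp add: M_zero M_add)
      then show ?thesis using zero_summand[OF sub(2,1)] int ab(2) by (simp add: Int_commute)
    qed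
  qed
  then show ?thesis
    unfolding indecomposable_module_def using module_M nt by blast
qed

end

section \<open>First cohomology of a finite cyclic group\<close>

locale cyclic_action = finite_cyclic G a p + Q: comm_group Q
  for G :: "'g monoid" (structure) and a p and Q :: "('q, 'm) monoid_scheme" +
  fixes act :: "'g \<Rightarrow> 'q \<Rightarrow> 'q"
  assumes act_hom: "g \<in> carrier G \<Longrightarrow> act g \<in> hom Q Q"
    and act_mult: "g \<in> carrier G \<Longrightarrow> h \<in> carrier G \<Longrightarrow> q \<in> carrier Q \<Longrightarrow>
      act (g \<otimes> h) q = act g (act h q)"
    and act_one: "q \<in> carrier Q \<Longrightarrow> act \<one> q = q"
begin

lemma act_closed: "g \<in> carrier G \<Longrightarrow> q \<in> carrier Q \<Longrightarrow> act g q \<in> carrier Q"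
  using act_hom by (auto simp: hom_def)

lemma act_prod: "g \<in> carrier G \<Longrightarrow> q \<in> carrier Q \<Longrightarrow> r \<in> carrier Q \<Longrightarrow>
    act g (q \<otimes>\<^bsub>Q\<^esub> r) = act g q \<otimes>\<^bsub>Q\<^esub> act g r"
  using act_hom by (auto simp: hom_def)

lemma act_id: "g \<in> carrier G \<Longrightarrow> act g \<one>\<^bsub>Q\<^esub> = \<one>\<^bsub>Q\<^esub>"
  using hom_one[OF act_hom] Q.is_group by auto

lemma act_inv: "g \<in> carrier G \<Longrightarrow> q \<in> carrier Q \<Longrightarrow> act g (inv\<^bsub>Q\<^esub> q) = inv\<^bsub>Q\<^esub> (act g q)"
  using group_hom.hom_inv[of Q Q "act g" q] act_hom Q.is_group
  by (simp add: group_hom_def group_hom_axioms_def)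

text \<open>In additive notation, \<open>(1 + a + \<dots> + a ^ (n - 1)) q\<close>.\<close>

primrec partial_norm :: "'q \<Rightarrow> nat \<Rightarrow> 'q" where
  "partial_norm q 0 = \<one>\<^bsub>Q\<^esub>"
| "partial_norm q (Suc n) = act a (partial_norm q n) \<otimes>\<^bsub>Q\<^esub> q"

lemma partial_norm_closed: "q \<in> carrier Q \<Longrightarrow> partial_norm q n \<in> carrier Q"
  by (induction n) (auto simp: act_closed a_mem)

lemma partial_norm_add:
  assumes q: "q \<in> carrier Q"
  shows "partial_norm q (m + n) = act (a [^] m) (partial_norm q n) \<otimes>\<^bsub>Q\<^esub> partial_norm q m"
proof (induction m)
  case 0
  show ?case using q by (simp add: act_one partial_norm_closed)
next
  case (Suc m)
  have "a [^] Suc m = a \<otimes> a [^] m" using a_mem by (simp add: m_commute)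
  then show ?case
    using Suc q a_mem
    by (simp add: act_prod act_mult act_closed partial_norm_closed Q.m_assoc del: nat_pow_Suc)
qed

text \<open>
  When the full norm of \<open>q\<close> vanishes, its partial norms depend only on the power of \<open>a\<close>, which is what
  makes them a cocycle.
\<close>

lemma partial_norm_mod:
  assumes q: "q \<in> carrier Q" "partial_norm q p = \<one>\<^bsub>Q\<^esub>"
  shows "partial_norm q (n mod p) = partial_norm q n"
proof -
  have per: "partial_norm q (n + p) = partial_norm q n" for n
    using q a_mem by (simp add: partial_norm_add act_id partial_norm_closed)
  have "partial_norm q (n mod p + k * p) = partial_norm q (n mod p)" for k
  proof (induction k)
    case (Suc k)
    have "n mod p + Suc k * p = (n mod p + k * p) + p" by simp
    then show ?case using per[of "n mod p + k * p"] Suc by metis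
  qed simp
  from this[of "n div p"] show ?thesis by simp
qed

abbreviation Z1 where "Z1 \<equiv> cocycles1 G Q act"

lemma cocycle_closed: "f \<in> carrier Z1 \<Longrightarrow> g \<in> carrier G \<Longrightarrow> f g \<in> carrier Q"
  by (auto simp: cocycles1_def PiE_iff)

lemma cocycle_eq: "f \<in> carrier Z1 \<Longrightarrow> g \<in> carrier G \<Longrightarrow> h \<in> carrier G \<Longrightarrow>
    f (g \<otimes> h) = act g (f h) \<otimes>\<^bsub>Q\<^esub> f g"
  by (auto simp: cocycles1_def)

lemma cocycle_pow:
  assumes f: "f \<in> carrier Z1"
  shows "f (a [^] n) = partial_norm (f a) n"
proof (induction n)
  case 0
  have "f \<one> = f \<one> \<otimes>\<^bsub>Q\<^esub> f \<one>"
    using cocycle_eq[OF f, of \<one> \<one>] cocycle_closed[OF f, of \<one>] by (simp add: act_one)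
  then show ?case using cocycle_closed[OF f, of \<one>] by (simp add: Q.l_cancel_one)
next
  case (Suc n)
  have "a [^] Suc n = a \<otimes> a [^] n" using a_mem by (simp add: m_commute)
  then show ?case using Suc cocycle_eq[OF f a_mem pow_mem[of n]] by simp
qed

lemma cocycle_norm: "f \<in> carrier Z1 \<Longrightarrow> partial_norm (f a) p = \<one>\<^bsub>Q\<^esub>"
  using cocycle_pow[of f p] cocycle_pow[of f 0] pow_p by simp

lemma cocycle_ext:
  assumes "f \<in> carrier Z1" "h \<in> carrier Z1" "f a = h a"
  shows "f = h"
proof (rule extensionalityI)
  show "f \<in> extensional (carrier G)" "h \<in> extensional (carrier G)"
    using assms by (auto simp: cocycles1_def PiE_iff)
  fix g assume "g \<in> carrier G"
  then obtain i :: nat where "g = a [^] i" by (rule obtain_pow)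
  then show "f g = h g" using assms by (simp add: cocycle_pow)
qed

lemma cocycle_exists:
  assumes q: "q \<in> carrier Q" "partial_norm q p = \<one>\<^bsub>Q\<^esub>"
  obtains f where "f \<in> carrier Z1" "f a = q"
proof -
  \<comment> \<open>The exponent of \<open>g\<close> as a power of \<open>a\<close> is the representative below \<open>p\<close>.\<close>
  define f where "f = (\<lambda>g\<in>carrier G. partial_norm q (inv_into {..<p} (\<lambda>i :: nat. a [^] i) g))"
  have inj: "inj_on (\<lambda>i :: nat. a [^] i) {..<p}" by (auto simp: inj_on_def pow_inj)
  have f: "f (a [^] n) = partial_norm q n" for n
  proof -
    have "a [^] n = a [^] (n mod p)"
    proof -
      have "a [^] n = a [^] (p * (n div p) + n mod p)" by simp
      also have "\<dots> = (a [^] p) [^] (n div p) \<otimes> a [^] (n mod p)"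
        using a_mem by (simp only: nat_pow_mult nat_pow_pow nat_pow_closed)
      finally show ?thesis using a_mem by (simp add: pow_p)
    qed
    then have "f (a [^] n) = f (a [^] (n mod p))" by simp
    also have "\<dots> = partial_norm q (n mod p)"
      using inv_into_f_f[OF inj, of "n mod p"] p_pos a_mem by (simp add: f_def)
    finally show ?thesis using partial_norm_mod[OF q] by simp
  qed
  have "f a = q" using f[of 1] q a_mem by (simp add: act_id)
  moreover have "f \<in> carrier Z1"
  proof -
    have "f (g \<otimes> h) = act g (f h) \<otimes>\<^bsub>Q\<^esub> f g" if gh: "g \<in> carrier G" "h \<in> carrier G" for g h
    proof -
      obtain m n :: nat where mn: "g = a [^] m" "h = a [^] n" using obtain_pow[OF gh(1)] obtain_pow[OF gh(2)] by metis
      then have "g \<otimes> h = a [^] (m + n)" using a_mem by (simp add: nat_pow_mult)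
      then show ?thesis using f mn partial_norm_add[OF q(1)] by simp
    qed
    moreover have "f g \<in> carrier Q" if "g \<in> carrier G" for g
      using that q by (simp add: f_def partial_norm_closed)
    ultimately show ?thesis by (auto simp: cocycles1_def f_def)
  qed
  ultimately show ?thesis using that by blast
qed

lemma Z1_mult_closed:
  assumes "f \<in> carrier Z1" "h \<in> carrier Z1"
  shows "f \<otimes>\<^bsub>Z1\<^esub> h \<in> carrier Z1"
proof -
  have "(act x (f y) \<otimes>\<^bsub>Q\<^esub> f x) \<otimes>\<^bsub>Q\<^esub> (act x (h y) \<otimes>\<^bsub>Q\<^esub> h x)
      = act x (f y \<otimes>\<^bsub>Q\<^esub> h y) \<otimes>\<^bsub>Q\<^esub> (f x \<otimes>\<^bsub>Q\<^esub> h x)"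
    if "x \<in> carrier G" "y \<in> carrier G" for x y
    using that cocycle_closed[OF assms(1)] cocycle_closed[OF assms(2)]
    by (simp add: act_prod act_closed Q.m_ac)
  then show ?thesis
    using assms cocycle_eq[OF assms(1)] cocycle_eq[OF assms(2)]
      cocycle_closed[OF assms(1)] cocycle_closed[OF assms(2)]
    by (simp add: cocycles1_def)
qed

lemma group_Z1: "group Z1"
proof (rule groupI)
  show "\<one>\<^bsub>Z1\<^esub> \<in> carrier Z1" by (simp add: cocycles1_def act_id)
  fix f assume f: "f \<in> carrier Z1"
  show "\<one>\<^bsub>Z1\<^esub> \<otimes>\<^bsub>Z1\<^esub> f = f"
    by (rule extensionalityI[of _ "carrier G"])
      (use f cocycle_closed[OF f] in \<open>auto simp: cocycles1_def PiE_iff\<close>)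
  define h where "h = (\<lambda>g\<in>carrier G. inv\<^bsub>Q\<^esub> f g)"
  have "h \<in> carrier Z1"
    using cocycle_closed[OF f] cocycle_eq[OF f]
    by (simp add: cocycles1_def h_def act_inv Q.inv_mult act_closed)
  moreover have "h \<otimes>\<^bsub>Z1\<^esub> f = \<one>\<^bsub>Z1\<^esub>"
    by (rule extensionalityI[of _ "carrier G"])
      (use cocycle_closed[OF f] in \<open>auto simp: cocycles1_def h_def\<close>)
  ultimately show "\<exists>h\<in>carrier Z1. h \<otimes>\<^bsub>Z1\<^esub> f = \<one>\<^bsub>Z1\<^esub>" by blast
next
  fix f h k assume fhk: "f \<in> carrier Z1" "h \<in> carrier Z1" "k \<in> carrier Z1"
  show "f \<otimes>\<^bsub>Z1\<^esub> h \<otimes>\<^bsub>Z1\<^esub> k = f \<otimes>\<^bsub>Z1\<^esub> (h \<otimes>\<^bsub>Z1\<^esub> k)"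
    by (rule extensionalityI[of _ "carrier G"])
      (use cocycle_closed[OF fhk(1)] cocycle_closed[OF fhk(2)] cocycle_closed[OF fhk(3)] in
        \<open>auto simp: cocycles1_def Q.m_assoc\<close>)
qed (rule Z1_mult_closed)

lemma coboundary_cocycle:
  assumes y: "y \<in> carrier Q"
  shows "(\<lambda>g\<in>carrier G. act g y \<otimes>\<^bsub>Q\<^esub> inv\<^bsub>Q\<^esub> y) \<in> carrier Z1"
proof -
  have "act (g \<otimes> h) y \<otimes>\<^bsub>Q\<^esub> inv\<^bsub>Q\<^esub> y
      = act g (act h y \<otimes>\<^bsub>Q\<^esub> inv\<^bsub>Q\<^esub> y) \<otimes>\<^bsub>Q\<^esub> (act g y \<otimes>\<^bsub>Q\<^esub> inv\<^bsub>Q\<^esub> y)"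
    if gh: "g \<in> carrier G" "h \<in> carrier G" for g h
  proof -
    have c: "act g (act h y) \<in> carrier Q" "act g y \<in> carrier Q" "inv\<^bsub>Q\<^esub> (act g y) \<in> carrier Q"
      using gh y by (simp_all add: act_closed)
    have "inv\<^bsub>Q\<^esub> (act g y) \<otimes>\<^bsub>Q\<^esub> (act g y \<otimes>\<^bsub>Q\<^esub> inv\<^bsub>Q\<^esub> y) = inv\<^bsub>Q\<^esub> y"
      using y c by (simp flip: Q.m_assoc)
    then show ?thesis
      using gh y c by (simp add: act_mult act_prod act_closed act_inv Q.m_assoc)
  qed
  then show ?thesis using y by (simp add: cocycles1_def act_closed)
qed

text \<open>
  A cocycle is determined by its value at \<open>a\<close>, which can be any element of norm zero; coboundaries
  correspond to the values \<open>(a - 1) y\<close>.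
\<close>

theorem cohomology1_iso:
  assumes T: "group T"
    and closed: "\<And>q. q \<in> carrier Q \<Longrightarrow> partial_norm q p = \<one>\<^bsub>Q\<^esub> \<Longrightarrow> \<phi> q \<in> carrier T"
    and mult: "\<And>q r. q \<in> carrier Q \<Longrightarrow> r \<in> carrier Q \<Longrightarrow> partial_norm q p = \<one>\<^bsub>Q\<^esub> \<Longrightarrow>
      partial_norm r p = \<one>\<^bsub>Q\<^esub> \<Longrightarrow> \<phi> (q \<otimes>\<^bsub>Q\<^esub> r) = \<phi> q \<otimes>\<^bsub>T\<^esub> \<phi> r"
    and surj: "\<And>t. t \<in> carrier T \<Longrightarrow> \<exists>q\<in>carrier Q. partial_norm q p = \<one>\<^bsub>Q\<^esub> \<and> \<phi> q = t"
    and ker: "\<And>q. q \<in> carrier Q \<Longrightarrow> partial_norm q p = \<one>\<^bsub>Q\<^esub> \<Longrightarrow>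
      \<phi> q = \<one>\<^bsub>T\<^esub> \<longleftrightarrow> (\<exists>y\<in>carrier Q. q = act a y \<otimes>\<^bsub>Q\<^esub> inv\<^bsub>Q\<^esub> y)"
  shows "cohomology1 G Q act \<cong> T"
proof -
  let ?ev = "\<lambda>f. \<phi> (f a)"
  have ev: "f a \<in> carrier Q" "partial_norm (f a) p = \<one>\<^bsub>Q\<^esub>" if "f \<in> carrier Z1" for f
    using that cocycle_closed cocycle_norm a_mem by auto
  have ev_mult: "(f \<otimes>\<^bsub>Z1\<^esub> h) a = f a \<otimes>\<^bsub>Q\<^esub> h a" for f h
    using a_mem by (simp add: cocycles1_def)
  interpret E: group_hom Z1 T ?ev
  proof (intro group_hom.intro group_hom_axioms.intro group_Z1 T homI)
    show "?ev f \<in> carrier T" if "f \<in> carrier Z1" for f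
      using ev[OF that] by (rule closed)
    show "?ev (f \<otimes>\<^bsub>Z1\<^esub> h) = ?ev f \<otimes>\<^bsub>T\<^esub> ?ev h" if "f \<in> carrier Z1" "h \<in> carrier Z1" for f h
      unfolding ev_mult using ev[OF that(1)] ev[OF that(2)] by (intro mult)
  qed
  have "kernel Z1 T ?ev = coboundaries1 G Q act"
  proof (intro subset_antisym subsetI)
    fix f assume "f \<in> kernel Z1 T ?ev"
    then have f: "f \<in> carrier Z1" "\<phi> (f a) = \<one>\<^bsub>T\<^esub>" by (auto simp: kernel_def)
    then obtain y where y: "y \<in> carrier Q" "f a = act a y \<otimes>\<^bsub>Q\<^esub> inv\<^bsub>Q\<^esub> y"
      using ker[OF ev[OF f(1)]] by auto
    have "f = (\<lambda>g\<in>carrier G. act g y \<otimes>\<^bsub>Q\<^esub> inv\<^bsub>Q\<^esub> y)"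
      using f(1) coboundary_cocycle[OF y(1)] y(2) a_mem by (intro cocycle_ext) auto
    then show "f \<in> coboundaries1 G Q act" using y(1) unfolding coboundaries1_def by blast
  next
    fix f assume "f \<in> coboundaries1 G Q act"
    then obtain y where y: "y \<in> carrier Q" "f = (\<lambda>g\<in>carrier G. act g y \<otimes>\<^bsub>Q\<^esub> inv\<^bsub>Q\<^esub> y)"
      unfolding coboundaries1_def by blast
    have f: "f \<in> carrier Z1" using coboundary_cocycle[OF y(1)] y(2) by simp
    have "f a = act a y \<otimes>\<^bsub>Q\<^esub> inv\<^bsub>Q\<^esub> y" using y(2) a_mem by simp
    then have "\<phi> (f a) = \<one>\<^bsub>T\<^esub>" using ker[OF ev[OF f]] y(1) by blast
    then show "f \<in> kernel Z1 T ?ev" using f by (simp add: kernel_def)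
  qed
  moreover have "?ev ` carrier Z1 = carrier T"
  proof (intro subset_antisym subsetI)
    fix t assume "t \<in> carrier T"
    then obtain q where q: "q \<in> carrier Q" "partial_norm q p = \<one>\<^bsub>Q\<^esub>" "\<phi> q = t"
      using surj by blast
    obtain f where "f \<in> carrier Z1" "f a = q" using cocycle_exists[OF q(1,2)] .
    then show "t \<in> ?ev ` carrier Z1" using q(3) by (intro image_eqI[of _ _ f]) auto
  next
    fix t assume "t \<in> ?ev ` carrier Z1"
    then show "t \<in> carrier T" using E.hom_closed by blast
  qed
  ultimately show ?thesis
    using E.FactGroup_iso unfolding cohomology1_def by simp
qed

end

section \<open>Tensor products by their universal property\<close>

text \<open>
  Automorphisms act on quotients by taking images of cosets. The action is compatible with passing
  to cosets of \<open>N\<close> only if \<open>N\<close> is mapped onto itself, not merely into itself.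
\<close>

lemma image_r_coset:
  assumes "\<theta> \<in> hom G H" "N \<subseteq> carrier G" "x \<in> carrier G"
  shows "\<theta> ` (N #>\<^bsub>G\<^esub> x) = (\<theta> ` N) #>\<^bsub>H\<^esub> \<theta> x"
proof -
  have "\<theta> (n \<otimes>\<^bsub>G\<^esub> x) = \<theta> n \<otimes>\<^bsub>H\<^esub> \<theta> x" if "n \<in> N" for n
    using assms that by (auto simp: hom_def)
  then show ?thesis by (auto simp: r_coset_def image_iff)
qed

lemma (in comm_group) image_hom_FactGroup:
  assumes N: "subgroup N G" and \<theta>: "\<theta> \<in> hom G G" "\<theta> ` N = N"
  shows "(\<lambda>C. \<theta> ` C) \<in> hom (G Mod N) (G Mod N)"
proof -
  interpret N: normal N G using N by (rule subgroup_imp_normal)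
  have im: "\<theta> ` (N #> x) = N #> \<theta> x" if "x \<in> carrier G" for x
    using image_r_coset[OF \<theta>(1) N.subset that] \<theta>(2) by simp
  have cl: "\<theta> x \<in> carrier G" if "x \<in> carrier G" for x using \<theta>(1) that by (auto simp: hom_def)
  show ?thesis
  proof (rule homI)
    fix C assume "C \<in> carrier (G Mod N)"
    then show "\<theta> ` C \<in> carrier (G Mod N)" using im cl by (auto simp: carrier_FactGroup)
  next
    fix C D assume "C \<in> carrier (G Mod N)" "D \<in> carrier (G Mod N)"
    then obtain x y where xy: "x \<in> carrier G" "y \<in> carrier G" "C = N #> x" "D = N #> y"
      by (auto simp: carrier_FactGroup)
    have "\<theta> (x \<otimes> y) = \<theta> x \<otimes> \<theta> y" using \<theta>(1) xy by (auto simp: hom_def)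
    then show "\<theta> ` (C \<otimes>\<^bsub>G Mod N\<^esub> D) = \<theta> ` C \<otimes>\<^bsub>G Mod N\<^esub> \<theta> ` D"
      using xy im cl by (simp add: N.rcos_sum)
  qed
qed

lemma (in comm_group) coset_eq_iff:
  assumes "subgroup N G" "x \<in> carrier G" "y \<in> carrier G"
  shows "N #> x = N #> y \<longleftrightarrow> x \<otimes> inv y \<in> N"
proof -
  have "N #> x = N #> y \<longleftrightarrow> x \<in> N #> y"
  proof
    assume "N #> x = N #> y"
    then show "x \<in> N #> y" using rcos_self[OF assms(2,1)] by simp
  next
    assume "x \<in> N #> y"
    then show "N #> x = N #> y" using repr_independence[OF _ assms(3,1)] by simp
  qed
  then show ?thesis using subgroup.rcos_module[OF assms(1) is_group assms(3,2)] by simp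
qed

locale tensor_pair =
  fixes R :: "('r, 'k) ring_scheme" and A :: "('r, 'a, 'm) module_scheme"
    and B :: "('r, 'b, 'n) module_scheme"
  assumes abelian_A: "abelian_group A" and abelian_B: "abelian_group B"
    and smult_A: "r \<in> carrier R \<Longrightarrow> x \<in> carrier A \<Longrightarrow> r \<odot>\<^bsub>A\<^esub> x \<in> carrier A"
    and smult_B: "r \<in> carrier R \<Longrightarrow> y \<in> carrier B \<Longrightarrow> r \<odot>\<^bsub>B\<^esub> y \<in> carrier B"
begin

sublocale A: abelian_group A by (rule abelian_A)
sublocale B: abelian_group B by (rule abelian_B)

abbreviation "S \<equiv> carrier A \<times> carrier B"
abbreviation "T \<equiv> tensor_group A B"
abbreviation "N \<equiv> tensor_relations R A B"
abbreviation "V \<equiv> tensor_product R A B"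
abbreviation "pure \<equiv> pure_tensor R A B"

text \<open>The generators of \<open>tensor_relations\<close>: maps out of the quotient and into it are checked on them.\<close>

definition gens :: "('a \<times> 'b \<Rightarrow>\<^sub>0 int) set" where
  "gens = {frag_of (x \<oplus>\<^bsub>A\<^esub> x', y) - frag_of (x, y) - frag_of (x', y) |x x' y.
         x \<in> carrier A \<and> x' \<in> carrier A \<and> y \<in> carrier B} \<union>
      {frag_of (x, y \<oplus>\<^bsub>B\<^esub> y') - frag_of (x, y) - frag_of (x, y') |x y y'.
         x \<in> carrier A \<and> y \<in> carrier B \<and> y' \<in> carrier B} \<union>
      {frag_of (r \<odot>\<^bsub>A\<^esub> x, y) - frag_of (x, r \<odot>\<^bsub>B\<^esub> y) |r x y.
         r \<in> carrier R \<and> x \<in> carrier A \<and> y \<in> carrier B}"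

lemma gens_add_left: "x \<in> carrier A \<Longrightarrow> x' \<in> carrier A \<Longrightarrow> y \<in> carrier B \<Longrightarrow>
    frag_of (x \<oplus>\<^bsub>A\<^esub> x', y) - frag_of (x, y) - frag_of (x', y) \<in> gens"
  unfolding gens_def by blast

lemma gens_add_right: "x \<in> carrier A \<Longrightarrow> y \<in> carrier B \<Longrightarrow> y' \<in> carrier B \<Longrightarrow>
    frag_of (x, y \<oplus>\<^bsub>B\<^esub> y') - frag_of (x, y) - frag_of (x, y') \<in> gens"
  unfolding gens_def by blast

lemma gens_smult: "r \<in> carrier R \<Longrightarrow> x \<in> carrier A \<Longrightarrow> y \<in> carrier B \<Longrightarrow>
    frag_of (r \<odot>\<^bsub>A\<^esub> x, y) - frag_of (x, r \<odot>\<^bsub>B\<^esub> y) \<in> gens"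
  unfolding gens_def by blast

lemma gens_cases [consumes 1, case_names add_left add_right smult]:
  assumes "c \<in> gens"
  obtains x x' y where "x \<in> carrier A" "x' \<in> carrier A" "y \<in> carrier B"
      "c = frag_of (x \<oplus>\<^bsub>A\<^esub> x', y) - frag_of (x, y) - frag_of (x', y)"
    | x y y' where "x \<in> carrier A" "y \<in> carrier B" "y' \<in> carrier B"
      "c = frag_of (x, y \<oplus>\<^bsub>B\<^esub> y') - frag_of (x, y) - frag_of (x, y')"
    | r x y where "r \<in> carrier R" "x \<in> carrier A" "y \<in> carrier B"
      "c = frag_of (r \<odot>\<^bsub>A\<^esub> x, y) - frag_of (x, r \<odot>\<^bsub>B\<^esub> y)"
  using assms unfolding gens_def
  by (elim UnE CollectE exE conjE) (rule that; assumption)+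

lemma relations_eq: "N = generate T gens"
  by (simp add: tensor_relations_def gens_def)

lemma T_eq: "T = free_Abelian_group S"
  by (simp add: tensor_group_def)

sublocale T: comm_group T
  unfolding T_eq by (rule abelian_free_Abelian_group)

lemma T_mult: "c \<otimes>\<^bsub>T\<^esub> d = c + d"
  by (simp add: T_eq)

lemma diff_mem_T: "c \<in> carrier T \<Longrightarrow> d \<in> carrier T \<Longrightarrow> c - d \<in> carrier T"
  using keys_diff[of c d] by (auto simp: T_eq)

lemma frag_mem_T: "x \<in> carrier A \<Longrightarrow> y \<in> carrier B \<Longrightarrow> frag_of (x, y) \<in> carrier T"
  by (simp add: T_eq)

lemma gens_subset: "gens \<subseteq> carrier T"
  unfolding gens_def
  by (auto intro!: diff_mem_T frag_mem_T smult_A smult_B simp del: carrier_free_Abelian_group_iff)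

lemma N_subgroup: "subgroup N T"
  unfolding relations_eq by (rule T.generate_is_subgroup[OF gens_subset])

lemma gens_mem_N: "c \<in> gens \<Longrightarrow> c \<in> N"
  unfolding relations_eq by (rule generate.incl)

sublocale N: normal N T
  using N_subgroup by (rule T.subgroup_imp_normal)

sublocale V: comm_group V
  unfolding tensor_product_def by (rule T.abelian_FactGroup[OF N_subgroup])

lemma carrier_V: "carrier V = (\<lambda>c. N #>\<^bsub>T\<^esub> c) ` carrier T"
  by (simp add: tensor_product_def carrier_FactGroup)

lemma V_mult: "c \<in> carrier T \<Longrightarrow> d \<in> carrier T \<Longrightarrow>
    (N #>\<^bsub>T\<^esub> c) \<otimes>\<^bsub>V\<^esub> (N #>\<^bsub>T\<^esub> d) = N #>\<^bsub>T\<^esub> (c + d)"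
  by (simp add: tensor_product_def N.rcos_sum T_mult)

lemma coset_eqI:
  assumes "c \<in> carrier T" "d \<in> carrier T" "c - d \<in> N"
  shows "N #>\<^bsub>T\<^esub> c = N #>\<^bsub>T\<^esub> d"
proof -
  have "c \<otimes>\<^bsub>T\<^esub> inv\<^bsub>T\<^esub> d = c - d" using assms(2) by (simp add: T_eq)
  then show ?thesis using T.coset_eq_iff[OF N_subgroup assms(1,2)] assms(3) by simp
qed

lemma pure_closed: "x \<in> carrier A \<Longrightarrow> y \<in> carrier B \<Longrightarrow> pure x y \<in> carrier V"
  unfolding carrier_V pure_tensor_def by (intro imageI frag_mem_T)

lemma pure_add_left:
  assumes "x \<in> carrier A" "x' \<in> carrier A" "y \<in> carrier B"
  shows "pure (x \<oplus>\<^bsub>A\<^esub> x') y = pure x y \<otimes>\<^bsub>V\<^esub> pure x' y"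
proof -
  have "N #>\<^bsub>T\<^esub> frag_of (x \<oplus>\<^bsub>A\<^esub> x', y) = N #>\<^bsub>T\<^esub> (frag_of (x, y) + frag_of (x', y))"
  proof (rule coset_eqI)
    show "frag_of (x \<oplus>\<^bsub>A\<^esub> x', y) - (frag_of (x, y) + frag_of (x', y)) \<in> N"
      using gens_mem_N[OF gens_add_left[OF assms]] by (simp only: diff_diff_eq)
    show "frag_of (x, y) + frag_of (x', y) \<in> carrier T"
      unfolding T_mult[symmetric] using assms by (intro T.m_closed frag_mem_T)
  qed (use assms in \<open>auto intro: frag_mem_T\<close>)
  then show ?thesis
    unfolding pure_tensor_def using assms by (simp add: V_mult frag_mem_T)
qed

lemma pure_add_right:
  assumes "x \<in> carrier A" "y \<in> carrier B" "y' \<in> carrier B"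
  shows "pure x (y \<oplus>\<^bsub>B\<^esub> y') = pure x y \<otimes>\<^bsub>V\<^esub> pure x y'"
proof -
  have "N #>\<^bsub>T\<^esub> frag_of (x, y \<oplus>\<^bsub>B\<^esub> y') = N #>\<^bsub>T\<^esub> (frag_of (x, y) + frag_of (x, y'))"
  proof (rule coset_eqI)
    show "frag_of (x, y \<oplus>\<^bsub>B\<^esub> y') - (frag_of (x, y) + frag_of (x, y')) \<in> N"
      using gens_mem_N[OF gens_add_right[OF assms]] by (simp only: diff_diff_eq)
    show "frag_of (x, y) + frag_of (x, y') \<in> carrier T"
      unfolding T_mult[symmetric] using assms by (intro T.m_closed frag_mem_T)
  qed (use assms in \<open>auto intro: frag_mem_T\<close>)
  then show ?thesis
    unfolding pure_tensor_def using assms by (simp add: V_mult frag_mem_T)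
qed

lemma pure_smult:
  assumes "r \<in> carrier R" "x \<in> carrier A" "y \<in> carrier B"
  shows "pure (r \<odot>\<^bsub>A\<^esub> x) y = pure x (r \<odot>\<^bsub>B\<^esub> y)"
proof -
  have "N #>\<^bsub>T\<^esub> frag_of (r \<odot>\<^bsub>A\<^esub> x, y) = N #>\<^bsub>T\<^esub> frag_of (x, r \<odot>\<^bsub>B\<^esub> y)"
    using assms by (intro coset_eqI frag_mem_T gens_mem_N gens_smult smult_A smult_B)
  then show ?thesis
    unfolding pure_tensor_def .
qed

text \<open>
  Every element is a sum of pure tensors and their inverses.
\<close>

lemma V_induct [consumes 1, case_names one pure diff]:
  assumes "v \<in> carrier V"
    and one: "P \<one>\<^bsub>V\<^esub>"
    and pure: "\<And>x y. x \<in> carrier A \<Longrightarrow> y \<in> carrier B \<Longrightarrow> P (pure x y)"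
    and that_diff: "\<And>v w. v \<in> carrier V \<Longrightarrow> w \<in> carrier V \<Longrightarrow> P v \<Longrightarrow> P w \<Longrightarrow> P (v \<otimes>\<^bsub>V\<^esub> inv\<^bsub>V\<^esub> w)"
  shows "P v"
proof -
  obtain c where c: "Poly_Mapping.keys c \<subseteq> S" "v = N #>\<^bsub>T\<^esub> c"
    using assms(1) unfolding carrier_V by (auto simp: T_eq)
  have "P (N #>\<^bsub>T\<^esub> c)"
    using c(1)
  proof (induction c rule: free_Abelian_group_induct[consumes 1, case_names zero diff of])
    case zero
    have "N #>\<^bsub>T\<^esub> 0 = N"
      using T.coset_join2[OF T.one_closed N_subgroup subgroup.one_closed[OF N_subgroup]] by (simp add: T_eq)
    then show ?case using one by (simp add: tensor_product_def)
  next
    case (diff c d)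
    then have cd: "c \<in> carrier T" "d \<in> carrier T" by (auto simp: T_eq)
    then have V: "N #>\<^bsub>T\<^esub> c \<in> carrier V" "N #>\<^bsub>T\<^esub> d \<in> carrier V" "N #>\<^bsub>T\<^esub> (c - d) \<in> carrier V"
      unfolding carrier_V using diff_mem_T by auto
    have "(N #>\<^bsub>T\<^esub> (c - d)) \<otimes>\<^bsub>V\<^esub> (N #>\<^bsub>T\<^esub> d) = N #>\<^bsub>T\<^esub> c"
      using V_mult[OF diff_mem_T[OF cd] cd(2)] by simp
    then have "N #>\<^bsub>T\<^esub> (c - d) = (N #>\<^bsub>T\<^esub> c) \<otimes>\<^bsub>V\<^esub> inv\<^bsub>V\<^esub> (N #>\<^bsub>T\<^esub> d)"
      using V by (metis V.inv_solve_right)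
    then show ?case using that_diff[OF V(1,2) diff(3,4)] by simp
  next
    case (of s)
    then show ?case using pure by (auto simp: pure_tensor_def)
  qed
  then show ?thesis using c(2) by simp
qed

lemma hom_eq_on_pure:
  assumes H: "group H" and h: "h \<in> hom V H" "k \<in> hom V H"
    and pure: "\<And>x y. x \<in> carrier A \<Longrightarrow> y \<in> carrier B \<Longrightarrow> h (pure x y) = k (pure x y)"
    and v: "v \<in> carrier V"
  shows "h v = k v"
proof -
  interpret h: group_hom V H h
    using H h by (simp add: group_hom_def group_hom_axioms_def V.is_group)
  interpret k: group_hom V H k
    using H h by (simp add: group_hom_def group_hom_axioms_def V.is_group)
  show ?thesis using v by (induction rule: V_induct) (simp_all add: pure)
qed

text \<open>
  The universal property: a bilinear and \<open>R\<close>-balanced map extends to the free abelian group, where it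
  annihilates the generators of the relations.
\<close>

lemma bilinear_extends:
  assumes H: "comm_group H"
    and closed: "\<And>x y. x \<in> carrier A \<Longrightarrow> y \<in> carrier B \<Longrightarrow> b x y \<in> carrier H"
    and left: "\<And>x x' y. x \<in> carrier A \<Longrightarrow> x' \<in> carrier A \<Longrightarrow> y \<in> carrier B \<Longrightarrow>
      b (x \<oplus>\<^bsub>A\<^esub> x') y = b x y \<otimes>\<^bsub>H\<^esub> b x' y"
    and right: "\<And>x y y'. x \<in> carrier A \<Longrightarrow> y \<in> carrier B \<Longrightarrow> y' \<in> carrier B \<Longrightarrow>
      b x (y \<oplus>\<^bsub>B\<^esub> y') = b x y \<otimes>\<^bsub>H\<^esub> b x y'"
    and smult_b: "\<And>r x y. r \<in> carrier R \<Longrightarrow> x \<in> carrier A \<Longrightarrow> y \<in> carrier B \<Longrightarrow>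
      b (r \<odot>\<^bsub>A\<^esub> x) y = b x (r \<odot>\<^bsub>B\<^esub> y)"
  obtains h where "h \<in> hom V H" "\<And>x y. x \<in> carrier A \<Longrightarrow> y \<in> carrier B \<Longrightarrow> h (pure x y) = b x y"
proof -
  interpret H: comm_group H by (rule H)
  have "case_prod b ` S \<subseteq> carrier H" using closed by auto
  then obtain k where "k \<in> hom (free_Abelian_group S) H" "\<And>s. s \<in> S \<Longrightarrow> k (frag_of s) = case_prod b s"
    by (rule H.free_Abelian_group_universal) blast
  then have k: "k \<in> hom T H" "\<And>x y. x \<in> carrier A \<Longrightarrow> y \<in> carrier B \<Longrightarrow> k (frag_of (x, y)) = b x y"
    unfolding T_eq by auto
  interpret k: group_hom T H k
    using k(1) by (simp add: group_hom_def group_hom_axioms_def T.is_group H.is_group)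
  have kd: "k (c - d) = k c \<otimes>\<^bsub>H\<^esub> inv\<^bsub>H\<^esub> k d" if "c \<in> carrier T" "d \<in> carrier T" for c d
  proof -
    have "c - d = c \<otimes>\<^bsub>T\<^esub> inv\<^bsub>T\<^esub> d" using that by (simp add: T_eq)
    then show ?thesis using that by simp
  qed
  have kg: "gens \<subseteq> kernel T H k"
  proof
    fix c assume "c \<in> gens"
    moreover from this have "c \<in> carrier T" using gens_subset by blast
    moreover have "k c = \<one>\<^bsub>H\<^esub>"
      using \<open>c \<in> gens\<close>
    proof (cases rule: gens_cases)
      case (add_left x x' y)
      then show ?thesis
        by (simp add: kd diff_mem_T frag_mem_T k(2) left closed H.m_ac)
    next
      case (add_right x y y')
      then show ?thesis
        by (simp add: kd diff_mem_T frag_mem_T k(2) right closed H.m_ac)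
    next
      case (smult r x y)
      then show ?thesis
        by (simp add: kd frag_mem_T k(2) smult_b closed smult_A smult_B)
    qed
    ultimately show "c \<in> kernel T H k" by (simp add: kernel_def)
  qed
  have kN: "N \<subseteq> kernel T H k"
    unfolding relations_eq by (rule T.generate_subgroup_incl[OF kg k.subgroup_kernel])
  have ker: "k c = k d" if "c \<in> carrier T" "d \<in> carrier T" "N #>\<^bsub>T\<^esub> c = N #>\<^bsub>T\<^esub> d" for c d
  proof -
    have "c \<otimes>\<^bsub>T\<^esub> inv\<^bsub>T\<^esub> d \<in> N" using T.coset_eq_iff[OF N_subgroup that(1,2)] that(3) by simp
    then have "k (c \<otimes>\<^bsub>T\<^esub> inv\<^bsub>T\<^esub> d) = \<one>\<^bsub>H\<^esub>" using kN by (auto simp: kernel_def)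
    then show ?thesis using that by (simp add: H.inv_solve_right')
  qed
  obtain h where h: "h \<in> hom (T Mod N) H" "\<And>c. c \<in> carrier T \<Longrightarrow> h (N #>\<^bsub>T\<^esub> c) = k c"
    using FactGroup_universal[OF k(1) N.normal_axioms ker] by blast
  show ?thesis
    by (rule that[of h]) (use h k(2) frag_mem_T in \<open>auto simp: tensor_product_def pure_tensor_def\<close>)
qed

text \<open>
  The image of a coset under a map of the free abelian group is a coset because an invertible
  \<open>R\<close>-linear map permutes the defining relations.
\<close>

lemma tensor_map:
  assumes closed: "\<And>y. y \<in> carrier B \<Longrightarrow> t y \<in> carrier B"
    and add: "\<And>y y'. y \<in> carrier B \<Longrightarrow> y' \<in> carrier B \<Longrightarrow> t (y \<oplus>\<^bsub>B\<^esub> y') = t y \<oplus>\<^bsub>B\<^esub> t y'"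
    and lin: "\<And>r y. r \<in> carrier R \<Longrightarrow> y \<in> carrier B \<Longrightarrow> t (r \<odot>\<^bsub>B\<^esub> y) = r \<odot>\<^bsub>B\<^esub> t y"
    and surj: "\<And>y. y \<in> carrier B \<Longrightarrow> \<exists>y'\<in>carrier B. t y' = y"
  defines "\<theta> \<equiv> frag_extend (\<lambda>(x, y). frag_of (x, t y))"
  shows "(\<lambda>C. \<theta> ` C) \<in> hom V V"
    and "\<And>x y. x \<in> carrier A \<Longrightarrow> y \<in> carrier B \<Longrightarrow> \<theta> ` pure x y = pure x (t y)"
proof -
  have \<theta>_of: "\<theta> (frag_of (x, y)) = frag_of (x, t y)" for x y by (simp add: \<theta>_def)
  have \<theta>_diff: "\<theta> (c - d) = \<theta> c - \<theta> d" for c d by (simp add: \<theta>_def frag_extend_diff)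
  have \<theta>_closed: "\<theta> c \<in> carrier T" if "c \<in> carrier T" for c
  proof -
    have "Poly_Mapping.keys c \<subseteq> S" using that by (simp add: T_eq)
    then show ?thesis
    proof (induction c rule: free_Abelian_group_induct[consumes 1, case_names zero diff of])
      case zero
      show ?case by (simp add: \<theta>_def T_eq)
    next
      case (diff c d)
      then show ?case unfolding \<theta>_diff by (intro diff_mem_T)
    next
      case (of s)
      then show ?case using closed frag_mem_T by (cases s) (auto simp: \<theta>_of)
    qed
  qed
  have hom: "\<theta> \<in> hom T T"
    using \<theta>_closed by (intro homI) (simp_all only: T_mult, simp add: \<theta>_def frag_extend_add)
  interpret \<theta>: group_hom T T \<theta>
    using hom by (simp add: group_hom_def group_hom_axioms_def T.is_group)
  have "\<theta> ` gens = gens"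
  proof (intro subset_antisym subsetI)
    fix c assume "c \<in> \<theta> ` gens"
    then obtain d where c: "c = \<theta> d" and "d \<in> gens" by blast
    from this(2) show "c \<in> gens"
    proof (cases rule: gens_cases)
      case (add_left x x' y)
      then show ?thesis unfolding c by (simp add: \<theta>_diff \<theta>_of gens_add_left closed)
    next
      case (add_right x y y')
      then show ?thesis unfolding c by (simp add: \<theta>_diff \<theta>_of add gens_add_right closed)
    next
      case (smult r x y)
      then show ?thesis unfolding c by (simp add: \<theta>_diff \<theta>_of lin gens_smult closed)
    qed
  next
    fix c assume "c \<in> gens"
    then show "c \<in> \<theta> ` gens"
    proof (cases rule: gens_cases)
      case (add_left x x' y)
      obtain z where "z \<in> carrier B" "t z = y" using surj add_left(3) by blast
      then show ?thesis using add_left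
        by (intro image_eqI[OF _ gens_add_left[of x x' z]]) (simp_all add: \<theta>_diff \<theta>_of)
    next
      case (add_right x y y')
      obtain z where z: "z \<in> carrier B" "t z = y" using surj add_right(2) by blast
      obtain z' where z': "z' \<in> carrier B" "t z' = y'" using surj add_right(3) by blast
      show ?thesis using add_right z z'
        by (intro image_eqI[OF _ gens_add_right[of x z z']]) (simp_all add: \<theta>_diff \<theta>_of add)
    next
      case (smult r x y)
      obtain z where "z \<in> carrier B" "t z = y" using surj smult(3) by blast
      then show ?thesis using smult
        by (intro image_eqI[OF _ gens_smult[of r x z]]) (simp_all add: \<theta>_diff \<theta>_of lin)
    qed
  qed
  then have \<theta>N: "\<theta> ` N = N"
    using \<theta>.generate_img[OF gens_subset] by (simp add: relations_eq)
  show "(\<lambda>C. \<theta> ` C) \<in> hom V V"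
    unfolding tensor_product_def by (rule T.image_hom_FactGroup[OF N_subgroup hom \<theta>N])
  show "\<theta> ` pure x y = pure x (t y)" if "x \<in> carrier A" "y \<in> carrier B" for x y
    unfolding pure_tensor_def
    using image_r_coset[OF hom N.subset frag_mem_T[OF that]] \<theta>N by (simp add: \<theta>_of)
qed

end

section \<open>Cohomology of the module generated by a divisor\<close>

lemma (in cyclic_action) partial_norm_mult:
  "q \<in> carrier Q \<Longrightarrow> r \<in> carrier Q \<Longrightarrow>
    partial_norm (q \<otimes>\<^bsub>Q\<^esub> r) n = partial_norm q n \<otimes>\<^bsub>Q\<^esub> partial_norm r n"
  by (induction n) (simp_all add: act_prod act_closed a_mem partial_norm_closed Q.m_ac)

lemma geometric_monom: "[:-1, 1:] * (\<Sum>i<n. Polynomial.monom 1 i) = Polynomial.monom 1 n - (1 :: 'a::field poly)"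
proof -
  have "(\<Sum>i<n. Polynomial.monom (1 :: 'a) i) = (\<Sum>i<n. [:0, 1:] ^ i)"
    by (simp add: monom_altdef)
  moreover have "[:0, 1:] ^ n - 1 = ([:0, 1:] - 1) * (\<Sum>i<n. ([:0, 1:] :: 'a poly) ^ i)"
    by (rule power_diff_1_eq)
  ultimately show ?thesis by (simp add: monom_altdef one_pCons)
qed

lemma (in type_subring) poly_over_split_at_1:
  assumes "h \<in> poly_over A"
  shows "\<exists>k\<in>poly_over A. h = [:poly h 1:] + [:-1, 1:] * k"
  using assms
proof (induction h)
  case 0
  show ?case by (intro bexI[of _ 0]) (auto simp: poly_over_def zero_mem)
next
  case (pCons c h)
  have ch: "c \<in> A" "h \<in> poly_over A"
    using pCons.prems by (auto simp: poly_over_def coeff_pCons split: nat.splits)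
  obtain k where k: "k \<in> poly_over A" "h = [:poly h 1:] + [:-1, 1:] * k"
    using pCons.IH[OF ch(2)] by blast
  have "pCons (poly h 1) k \<in> poly_over A"
    using k(1) poly_mem[OF ch(2) one_mem] by (auto simp: poly_over_def coeff_pCons split: nat.splits)
  moreover have "pCons c h = [:poly (pCons c h) 1:] + [:-1, 1:] * pCons (poly h 1) k"
  proof -
    have "pCons c h = [:c:] + [:0, 1:] * ([:poly h 1:] + [:-1, 1:] * k)"
      using k(2) by simp
    then show ?thesis by (simp add: algebra_simps)
  qed
  ultimately show ?case by blast
qed

text \<open>
  The data of the second half of the argument: \<open>\<theta>\<close> is the factor complementary to \<open>\<eta>\<close>, through which
  the norm element belongs to the module, and \<open>j\<close> embeds \<open>A\<close> in the coefficient field \<open>F\<close>.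
\<close>

locale divisor_extension = divisor_module G a p A \<eta>
  for G :: "'g monoid" (structure) and a p and A :: "'a::field set" and \<eta> +
  fixes F :: "'f ring" and j :: "'a \<Rightarrow> 'f" and \<theta> :: "'a poly"
  assumes F: "field F" and j_hom: "j \<in> ring_hom (subring_record A) F" and j_inj: "inj_on j A"
    and \<eta>_over: "\<eta> \<in> poly_over A" and \<theta>_over: "\<theta> \<in> poly_over A"
    and factor: "\<eta> * \<theta> = (\<Sum>i<p. Polynomial.monom 1 i)"
    and p_nonzero: "of_nat p \<noteq> (0 :: 'a)"
begin

sublocale F: field F by (rule F)

lemma j_closed: "r \<in> A \<Longrightarrow> j r \<in> carrier F"
  using ring_hom_closed[OF j_hom] by simp
lemma j_add: "r \<in> A \<Longrightarrow> s \<in> A \<Longrightarrow> j (r + s) = j r \<oplus>\<^bsub>F\<^esub> j s"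
  using ring_hom_add[OF j_hom] by simp
lemma j_mult: "r \<in> A \<Longrightarrow> s \<in> A \<Longrightarrow> j (r * s) = j r \<otimes>\<^bsub>F\<^esub> j s"
  using ring_hom_mult[OF j_hom] by simp
lemma j_one: "j 1 = \<one>\<^bsub>F\<^esub>"
  using ring_hom_one[OF j_hom] by simp
lemma j_zero: "j 0 = \<zero>\<^bsub>F\<^esub>"
proof -
  have "j 0 \<oplus>\<^bsub>F\<^esub> j 0 = j 0" using j_add[OF A.zero_mem A.zero_mem] by simp
  then show ?thesis using j_closed[OF A.zero_mem] by (metis F.add.l_cancel_one')
qed

abbreviation "RR \<equiv> subring_record A"
abbreviation "FA \<equiv> algebra_module F j"
abbreviation "MB \<equiv> scalar_module RR G M"
abbreviation "gact g m \<equiv> group_ring_term RR G 1 g \<odot>\<^bsub>M\<^esub> m"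
abbreviation "act \<equiv> base_change_act RR G M"

lemma FA_simps: "carrier FA = carrier F" "x \<oplus>\<^bsub>FA\<^esub> y = x \<oplus>\<^bsub>F\<^esub> y" "r \<odot>\<^bsub>FA\<^esub> x = j r \<otimes>\<^bsub>F\<^esub> x"
  "\<zero>\<^bsub>FA\<^esub> = \<zero>\<^bsub>F\<^esub>"
  by (simp_all add: algebra_module_def module_of_def)

lemma MB_simps: "carrier MB = carrier M" "m \<oplus>\<^bsub>MB\<^esub> n = m \<oplus>\<^bsub>M\<^esub> n" "\<zero>\<^bsub>MB\<^esub> = \<zero>\<^bsub>M\<^esub>"
  by (simp_all add: scalar_module_def module_of_def)

lemma MB_smult: "r \<odot>\<^bsub>MB\<^esub> pv h = pv (Polynomial.smult r h)"
proof -
  have "group_ring_term RR G r \<one> = pv [:r:]"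
    using pv_monom_term[where i = 0 and r = r and A = A] by (simp add: monom_0)
  then show ?thesis by (simp add: scalar_module_def module_of_def M_smult)
qed

lemma gact_pv: "gact (a [^] i) (pv h) = pv (Polynomial.monom 1 i * h)"
  unfolding pv_monom_term[where i = i and r = 1 and A = A, symmetric] by (rule M_smult)

sublocale M: abelian_group M by (rule abelian_group_M)

lemma abelian_group_FA: "abelian_group FA"
  by (rule abelian_groupI) (auto simp: FA_simps F.add.m_assoc F.add.m_comm F.add.m_lcomm intro: F.add.l_inv_ex)

lemma abelian_group_MB: "abelian_group MB"
  by (rule abelian_groupI) (auto simp: MB_simps M.add.m_assoc M.add.m_comm M.add.m_lcomm intro: M.add.l_inv_ex)

lemma monom_mem: "Polynomial.monom 1 i * h \<in> poly_over A" if "h \<in> poly_over A"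
  using that by (intro AP.mult_mem A.monom_poly_over A.one_mem)

lemma MB_smult_closed:
  assumes "r \<in> A" "m \<in> carrier M"
  shows "r \<odot>\<^bsub>MB\<^esub> m \<in> carrier M"
proof -
  obtain h where h: "h \<in> poly_over A" "m = pv (\<eta> * h)" using assms(2) by (rule obtain_M)
  have "Polynomial.smult r h \<in> poly_over A"
    using AP.mult_mem[OF A.const_poly_over[OF assms(1)] h(1)] by simp
  then show ?thesis using M_mem[of "Polynomial.smult r h"] h(2) by (simp add: MB_smult)
qed

sublocale TP: tensor_pair RR FA MB
  using abelian_group_FA abelian_group_MB j_closed MB_smult_closed
  by (intro tensor_pair.intro) (auto simp: FA_simps MB_simps(1))

abbreviation "V \<equiv> base_change RR G F j M"
abbreviation "pure \<equiv> pure_tensor RR FA MB"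

lemma V_eq: "V = TP.V" by (simp add: base_change_def)

sublocale V: comm_group V unfolding V_eq by (rule TP.V.comm_group_axioms)

lemmas pure_closed = TP.pure_closed[folded V_eq, unfolded FA_simps MB_simps]
lemmas pure_add_left = TP.pure_add_left[folded V_eq, unfolded FA_simps MB_simps]
lemmas pure_add_right = TP.pure_add_right[folded V_eq, unfolded FA_simps MB_simps]
lemmas pure_smult = TP.pure_smult[folded V_eq, unfolded FA_simps MB_simps, simplified]
lemmas V_induct [consumes 1, case_names one pure diff] = TP.V_induct[folded V_eq, unfolded FA_simps MB_simps]
lemmas hom_eq_on_pure = TP.hom_eq_on_pure[folded V_eq, unfolded FA_simps MB_simps]

lemma pure_hom_left: "m \<in> carrier M \<Longrightarrow> (\<lambda>f. pure f m) \<in> hom (add_monoid F) V"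
  by (rule homI) (auto simp: pure_closed pure_add_left)

lemma pure_hom_right: "f \<in> carrier F \<Longrightarrow> (\<lambda>m. pure f m) \<in> hom (add_monoid M) V"
  by (rule homI) (auto simp: pure_closed pure_add_right)

lemma pure_zero_right: "f \<in> carrier F \<Longrightarrow> pure f \<zero>\<^bsub>M\<^esub> = \<one>\<^bsub>V\<^esub>"
  using hom_one[OF pure_hom_right M.a_group V.is_group] by simp

lemma pure_zero_left: "m \<in> carrier M \<Longrightarrow> pure \<zero>\<^bsub>F\<^esub> m = \<one>\<^bsub>V\<^esub>"
  using hom_one[OF pure_hom_left F.a_group V.is_group] by simp

text \<open>
  This yields two homomorphisms on \<open>F \<otimes> M\<close>: from the augmentation, and from the coefficient at the
  identity of the group.
\<close>

lemma linear_functional_extends: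
  assumes "\<And>m. m \<in> carrier M \<Longrightarrow> l m \<in> A"
    and "\<And>m n. m \<in> carrier M \<Longrightarrow> n \<in> carrier M \<Longrightarrow> l (m \<oplus>\<^bsub>M\<^esub> n) = l m + l n"
    and "\<And>r m. r \<in> A \<Longrightarrow> m \<in> carrier M \<Longrightarrow> l (r \<odot>\<^bsub>MB\<^esub> m) = r * l m"
  obtains h where "h \<in> hom V (add_monoid F)"
    "\<And>f m. f \<in> carrier F \<Longrightarrow> m \<in> carrier M \<Longrightarrow> h (pure f m) = f \<otimes>\<^bsub>F\<^esub> j (l m)"
proof (rule TP.bilinear_extends[where H = "add_monoid F" and b = "\<lambda>f m. f \<otimes>\<^bsub>F\<^esub> j (l m)",
      folded V_eq, unfolded FA_simps MB_simps])
  show "comm_group (add_monoid F)" by (rule F.a_comm_group)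
qed (use assms in \<open>auto simp: j_closed j_add j_mult F.l_distr F.r_distr F.m_ac intro: that\<close>)

subsection \<open>The action of the group\<close>

lemma gact_closed: "g \<in> carrier G \<Longrightarrow> m \<in> carrier M \<Longrightarrow> gact g m \<in> carrier M"
proof -
  assume "g \<in> carrier G" "m \<in> carrier M"
  then obtain i :: nat and h where h: "g = a [^] i" "h \<in> poly_over A" "m = pv (\<eta> * h)"
    by (metis obtain_pow obtain_M)
  show ?thesis using M_mem[OF monom_mem[OF h(2), of i]] unfolding h gact_pv by (simp add: mult.left_commute)
qed

lemma gact_mult:
  assumes "g \<in> carrier G" "k \<in> carrier G" "m \<in> carrier M"
  shows "gact (g \<otimes> k) m = gact g (gact k m)"
proof -
  obtain i :: nat where i: "g = a [^] i" using assms(1) by (rule obtain_pow)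
  obtain n :: nat where n: "k = a [^] n" using assms(2) by (rule obtain_pow)
  obtain h where h: "m = pv (\<eta> * h)" using assms(3) by (rule obtain_M)
  have "g \<otimes> k = a [^] (i + n)" using a_mem i n by (simp add: nat_pow_mult)
  moreover have "Polynomial.monom (1::'a) (i + n) = Polynomial.monom 1 i * Polynomial.monom 1 n"
    by (simp add: mult_monom)
  ultimately show ?thesis unfolding h i n gact_pv by (simp only: gact_pv mult.assoc)
qed

lemma gact_one: "m \<in> carrier M \<Longrightarrow> gact \<one> m = m"
proof -
  assume "m \<in> carrier M"
  then obtain h where h: "m = pv (\<eta> * h)" by (rule obtain_M)
  have "gact (a [^] (0 :: nat)) m = m" unfolding h gact_pv by (simp add: monom_0)
  then show ?thesis by simp
qed

lemma gact_surj:
  assumes "g \<in> carrier G" "m \<in> carrier M"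
  shows "\<exists>n\<in>carrier M. gact g n = m"
proof
  have "gact g (gact (inv g) m) = gact (g \<otimes> inv g) m"
    using assms by (intro gact_mult[symmetric]) simp_all
  then show "gact g (gact (inv g) m) = m" using assms gact_one by simp
  show "gact (inv g) m \<in> carrier M" using assms by (intro gact_closed) simp_all
qed

lemma gact_add: "g \<in> carrier G \<Longrightarrow> m \<in> carrier M \<Longrightarrow> n \<in> carrier M \<Longrightarrow>
    gact g (m \<oplus>\<^bsub>M\<^esub> n) = gact g m \<oplus>\<^bsub>M\<^esub> gact g n"
proof -
  assume "g \<in> carrier G" "m \<in> carrier M" "n \<in> carrier M"
  then obtain i :: nat and h k where h: "g = a [^] i" "m = pv (\<eta> * h)" "n = pv (\<eta> * k)"
    by (metis obtain_pow obtain_M)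
  show ?thesis unfolding h gact_pv M_add by (simp add: distrib_left)
qed

lemma gact_smult: "g \<in> carrier G \<Longrightarrow> m \<in> carrier M \<Longrightarrow> gact g (r \<odot>\<^bsub>MB\<^esub> m) = r \<odot>\<^bsub>MB\<^esub> gact g m"
proof -
  assume "g \<in> carrier G" "m \<in> carrier M"
  then obtain i :: nat and h where h: "g = a [^] i" "m = pv (\<eta> * h)"
    by (metis obtain_pow obtain_M)
  show ?thesis unfolding h gact_pv MB_smult by simp
qed

lemma act_hom: "g \<in> carrier G \<Longrightarrow> act g \<in> hom V V"
  and act_pure: "g \<in> carrier G \<Longrightarrow> f \<in> carrier F \<Longrightarrow> m \<in> carrier M \<Longrightarrow> act g (pure f m) = pure f (gact g m)"
proof -
  assume g: "g \<in> carrier G"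
  have eq: "act g = (\<lambda>C. frag_extend (\<lambda>(f, m). frag_of (f, gact g m)) ` C)"
    by (simp add: base_change_act_def fun_eq_iff)
  show "act g \<in> hom V V"
    unfolding eq V_eq using g
    by (intro TP.tensor_map) (auto simp: MB_simps gact_closed gact_add gact_smult gact_surj)
  show "act g (pure f m) = pure f (gact g m)" if "f \<in> carrier F" "m \<in> carrier M"
    unfolding eq V_eq using g that
    by (intro TP.tensor_map) (auto simp: MB_simps FA_simps gact_closed gact_add gact_smult gact_surj)
qed

sublocale VA: cyclic_action G a p V act
proof
  show "act g \<in> hom V V" if "g \<in> carrier G" for g using that by (rule act_hom)
  show "act (g \<otimes> k) v = act g (act k v)"
    if "g \<in> carrier G" "k \<in> carrier G" "v \<in> carrier V" for g k v
  proof -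
    have "act (g \<otimes> k) v = (act g \<circ> act k) v"
      by (rule hom_eq_on_pure[OF V.is_group act_hom
            Group.hom_compose[OF act_hom[OF that(2)] act_hom[OF that(1)]] _ that(3)])
        (use that in \<open>simp_all add: act_pure gact_mult gact_closed\<close>)
    then show ?thesis by simp
  qed
  show "act \<one> v = v" if "v \<in> carrier V" for v
  proof -
    have id: "id \<in> hom V V" by (rule homI) auto
    have "act \<one> v = id v"
      by (rule hom_eq_on_pure[OF V.is_group act_hom[OF one_closed] id _ that])
        (simp add: act_pure gact_one)
    then show ?thesis by simp
  qed
qed

subsection \<open>The quotient by the lattice\<close>

definition W where "W = pure \<one>\<^bsub>F\<^esub> ` carrier M"

abbreviation "Q \<equiv> hat_module RR G F j M"
abbreviation "qact \<equiv> hat_act RR G M"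

lemma Q_eq: "Q = V Mod W"
  by (simp add: hat_module_def W_def)

lemma W_subgroup: "subgroup W V"
proof -
  interpret h: group_hom "add_monoid M" V "pure \<one>\<^bsub>F\<^esub>"
    using pure_hom_right[OF F.one_closed] M.a_group V.is_group
    by (simp add: group_hom_def group_hom_axioms_def)
  show ?thesis using h.img_is_subgroup by (simp add: W_def)
qed

sublocale W: normal W V
  using W_subgroup by (rule V.subgroup_imp_normal)

sublocale Q: comm_group Q
  unfolding Q_eq by (rule V.abelian_FactGroup[OF W_subgroup])

lemma act_W: "g \<in> carrier G \<Longrightarrow> act g ` W = W"
proof (intro subset_antisym subsetI)
  assume g: "g \<in> carrier G"
  show "w \<in> W" if "w \<in> act g ` W" for w
    using that g by (auto simp: W_def act_pure gact_closed)
  show "w \<in> act g ` W" if w: "w \<in> W" for w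
  proof -
    obtain m where m: "m \<in> carrier M" "w = pure \<one>\<^bsub>F\<^esub> m" using w by (auto simp: W_def)
    obtain n where n: "n \<in> carrier M" "gact g n = m" using gact_surj[OF g m(1)] by blast
    have "w = act g (pure \<one>\<^bsub>F\<^esub> n)" using act_pure[OF g F.one_closed n(1)] n m by simp
    then show ?thesis using n(1) by (auto simp: W_def)
  qed
qed

abbreviation "\<kappa> v \<equiv> W #>\<^bsub>V\<^esub> v"

lemma qact_\<kappa>: "g \<in> carrier G \<Longrightarrow> v \<in> carrier V \<Longrightarrow> qact g (\<kappa> v) = \<kappa> (act g v)"
  using image_r_coset[OF act_hom W.subset, of g v] act_W[of g] by (simp add: hat_act_def)

lemma carrier_Q: "carrier Q = \<kappa> ` carrier V"
  by (simp add: Q_eq carrier_FactGroup)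

lemma \<kappa>_mult: "v \<in> carrier V \<Longrightarrow> w \<in> carrier V \<Longrightarrow> \<kappa> v \<otimes>\<^bsub>Q\<^esub> \<kappa> w = \<kappa> (v \<otimes>\<^bsub>V\<^esub> w)"
  by (simp add: Q_eq W.rcos_sum)

lemma \<kappa>_hom: "group_hom V Q \<kappa>"
  by (intro group_hom.intro group_hom_axioms.intro V.is_group Q.is_group homI)
    (simp_all add: carrier_Q \<kappa>_mult)

lemma \<kappa>_eq_one_iff: "v \<in> carrier V \<Longrightarrow> \<kappa> v = \<one>\<^bsub>Q\<^esub> \<longleftrightarrow> v \<in> W"
  using V.coset_join2[OF _ W_subgroup, of v] V.rcos_self[OF _ W_subgroup, of v] by (auto simp: Q_eq)

sublocale QA: cyclic_action G a p Q qact
proof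
  show "qact g \<in> hom Q Q" if "g \<in> carrier G" for g
    using V.image_hom_FactGroup[OF W_subgroup act_hom[OF that] act_W[OF that]]
    unfolding Q_eq hat_act_def .
qed (auto simp: carrier_Q qact_\<kappa> VA.act_closed VA.act_mult VA.act_one)

lemma partial_norm_\<kappa>: "v \<in> carrier V \<Longrightarrow> QA.partial_norm (\<kappa> v) n = \<kappa> (VA.partial_norm v n)"
proof (induction n)
  case 0
  show ?case using \<kappa>_eq_one_iff[OF V.one_closed] W_subgroup by (simp add: subgroup.one_closed)
next
  case (Suc n)
  then show ?case by (simp add: qact_\<kappa> \<kappa>_mult VA.act_closed VA.partial_norm_closed a_mem)
qed

subsection \<open>The augmentation and the norm\<close>

abbreviation "\<Phi> \<equiv> (\<Sum>i<p. Polynomial.monom 1 i) :: 'a poly"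
abbreviation "e1 \<equiv> poly \<eta> 1"

lemma e1_mem: "e1 \<in> A"
  using \<eta>_over A.one_mem by (rule A.poly_mem)

lemma e1_nonzero: "e1 \<noteq> 0"
proof -
  have "e1 * poly \<theta> 1 = of_nat p"
    using arg_cong[OF factor, of "\<lambda>f. poly f 1"] by (simp add: poly_sum poly_monom)
  then show ?thesis using p_nonzero by auto
qed

lemma j_e1: "j e1 \<in> carrier F - {\<zero>\<^bsub>F\<^esub>}"
  using j_closed[OF e1_mem] inj_onD[OF j_inj _ e1_mem A.zero_mem] j_zero e1_nonzero by auto

definition aug :: "('g \<Rightarrow> 'a) \<Rightarrow> 'a" where
  "aug m = (\<Sum>g\<in>carrier G. m g)"

lemma aug_pv: "aug (pv h) = poly h 1"
  by (simp add: aug_def sum_pv)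

lemma aug_mem: "m \<in> carrier M \<Longrightarrow> aug m \<in> A"
proof -
  assume "m \<in> carrier M"
  then obtain h where h: "h \<in> poly_over A" "m = pv (\<eta> * h)" by (rule obtain_M)
  then show ?thesis
    using A.mult_mem[OF e1_mem A.poly_mem[OF h(1) A.one_mem]] by (simp add: aug_pv)
qed

definition ev where
  "ev = (SOME h. h \<in> hom V (add_monoid F) \<and>
    (\<forall>f\<in>carrier F. \<forall>m\<in>carrier M. h (pure f m) = f \<otimes>\<^bsub>F\<^esub> j (aug m)))"

lemma ev: "ev \<in> hom V (add_monoid F)"
  "f \<in> carrier F \<Longrightarrow> m \<in> carrier M \<Longrightarrow> ev (pure f m) = f \<otimes>\<^bsub>F\<^esub> j (aug m)"
proof -
  obtain h where "h \<in> hom V (add_monoid F)"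
    "\<And>f m. f \<in> carrier F \<Longrightarrow> m \<in> carrier M \<Longrightarrow> h (pure f m) = f \<otimes>\<^bsub>F\<^esub> j (aug m)"
  proof (rule linear_functional_extends[of aug])
    show "aug (m \<oplus>\<^bsub>M\<^esub> n) = aug m + aug n" if mn: "m \<in> carrier M" "n \<in> carrier M" for m n
    proof -
      obtain h k where "m = pv (\<eta> * h)" "n = pv (\<eta> * k)" using mn by (metis obtain_M)
      then show ?thesis by (simp add: M_add aug_pv)
    qed
    show "aug (r \<odot>\<^bsub>MB\<^esub> m) = r * aug m" if m: "m \<in> carrier M" for r m
    proof -
      obtain h where "m = pv (\<eta> * h)" using m by (rule obtain_M)
      then show ?thesis by (simp add: MB_smult aug_pv)
    qed
  qed (auto intro: aug_mem)
  then have "\<exists>h. h \<in> hom V (add_monoid F) \<and>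
      (\<forall>f\<in>carrier F. \<forall>m\<in>carrier M. h (pure f m) = f \<otimes>\<^bsub>F\<^esub> j (aug m))" by blast
  from someI_ex[OF this] show "ev \<in> hom V (add_monoid F)"
    "f \<in> carrier F \<Longrightarrow> m \<in> carrier M \<Longrightarrow> ev (pure f m) = f \<otimes>\<^bsub>F\<^esub> j (aug m)"
    unfolding ev_def by blast+
qed

sublocale ev: group_hom V "add_monoid F" ev
  using ev(1) F.a_group V.is_group by (simp add: group_hom_def group_hom_axioms_def)

lemma ev_closed: "v \<in> carrier V \<Longrightarrow> ev v \<in> carrier F"
  using ev.hom_closed by simp

lemma ev_act:
  assumes "g \<in> carrier G" "v \<in> carrier V"
  shows "ev (act g v) = ev v"
proof -
  have "aug (gact g m) = aug m" if m: "m \<in> carrier M" for m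
  proof -
    obtain i :: nat and h where h: "g = a [^] i" "m = pv (\<eta> * h)"
      using assms(1) m by (metis obtain_pow obtain_M)
    show ?thesis unfolding h gact_pv aug_pv by (simp add: poly_monom)
  qed
  then have "(ev \<circ> act g) v = ev v"
    using assms(1)
    by - (rule hom_eq_on_pure[OF F.a_group Group.hom_compose[OF act_hom[OF assms(1)] ev(1)] ev(1) _ assms(2)],
      simp add: act_pure gact_closed ev(2))
  then show ?thesis by simp
qed

abbreviation "\<nu> \<equiv> pv \<Phi>"

lemma \<nu>_mem: "\<nu> \<in> carrier M"
  using M_mem[OF \<theta>_over] factor by simp

text \<open>
  The norm element absorbs the group: modulo \<open>x ^ p - 1 = (x - 1) \<Phi>\<close>, multiplying \<open>\<Phi>\<close> by \<open>k\<close> only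
  depends on \<open>k(1)\<close>.
\<close>

lemma norm_mult: "pv (\<Phi> * k) = pv (Polynomial.smult (poly k 1) \<Phi>)"
proof -
  have "[:-1, 1:] dvd k - [:poly k 1:]"
    using poly_eq_0_iff_dvd[of "k - [:poly k 1:]" 1] by simp
  then have "[:-1, 1:] * \<Phi> dvd (k - [:poly k 1:]) * \<Phi>" by (rule mult_dvd_mono) simp
  moreover have "(k - [:poly k 1:]) * \<Phi> = \<Phi> * k - Polynomial.smult (poly k 1) \<Phi>"
    by (simp add: algebra_simps)
  ultimately have "Polynomial.monom 1 p - 1 dvd \<Phi> * k - Polynomial.smult (poly k 1) \<Phi>"
    by (simp only: geometric_monom)
  then show ?thesis by (subst pv_diff_eq) (simp only: pv_eq_0_iff)
qed

lemma partial_norm_pure: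
  assumes f: "f \<in> carrier F" and h: "h \<in> poly_over A"
  shows "VA.partial_norm (pure f (pv (\<eta> * h))) n = pure f (pv (\<eta> * ((\<Sum>i<n. Polynomial.monom 1 i) * h)))"
proof (induction n)
  case 0
  show ?case using pure_zero_right[OF f] by (simp add: M_zero)
next
  case (Suc n)
  let ?s = "\<lambda>n. (\<Sum>i<n. Polynomial.monom 1 i) :: 'a poly"
  have s: "?s n * h \<in> poly_over A"
    using h by (intro AP.mult_mem AP.sum_mem A.monom_poly_over A.one_mem)
  have sn: "?s (Suc n) = Polynomial.monom 1 1 * ?s n + 1"
    unfolding sum.lessThan_Suc_shift by (simp add: sum_distrib_left mult_monom)
  have ga: "gact a (pv (\<eta> * (?s n * h))) = pv (Polynomial.monom 1 1 * (\<eta> * (?s n * h)))"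
    using gact_pv[of 1] a_mem by simp
  have "VA.partial_norm (pure f (pv (\<eta> * h))) (Suc n)
      = pure f (gact a (pv (\<eta> * (?s n * h)))) \<otimes>\<^bsub>V\<^esub> pure f (pv (\<eta> * h))"
    using Suc a_mem f M_mem[OF s] by (simp add: act_pure)
  also have "\<dots> = pure f (gact a (pv (\<eta> * (?s n * h))) \<oplus>\<^bsub>M\<^esub> pv (\<eta> * h))"
    using f gact_closed[OF a_mem M_mem[OF s]] M_mem[OF h] by (intro pure_add_right[symmetric])
  also have "gact a (pv (\<eta> * (?s n * h))) \<oplus>\<^bsub>M\<^esub> pv (\<eta> * h) = pv (\<eta> * (?s (Suc n) * h))"
    unfolding ga M_add sn by (simp add: algebra_simps)
  finally show ?case .
qed

text \<open>
  On a pure tensor \<open>f \<otimes> m\<close> the norm is \<open>f \<otimes> \<Phi>(a) m = f \<otimes> aug(m) \<Phi>(a)\<close>, and the scalar moves to the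
  left factor.
\<close>

lemma norm_eq:
  assumes "v \<in> carrier V"
  shows "VA.partial_norm v p = pure (ev v) \<nu>"
proof (rule hom_eq_on_pure[OF V.is_group _ _ _ assms])
  show "(\<lambda>v. VA.partial_norm v p) \<in> hom V V"
    by (rule homI) (simp_all add: VA.partial_norm_closed VA.partial_norm_mult)
  show "(\<lambda>v. pure (ev v) \<nu>) \<in> hom V V"
    using Group.hom_compose[OF ev(1) pure_hom_left[OF \<nu>_mem]] by (simp add: comp_def)
  fix f m assume fm: "f \<in> carrier F" "m \<in> carrier M"
  then obtain h where h: "h \<in> poly_over A" "m = pv (\<eta> * h)" by (metis obtain_M)
  have "pv (\<eta> * (\<Phi> * h)) = aug m \<odot>\<^bsub>MB\<^esub> \<nu>"
    using norm_mult[of "\<eta> * h"] by (simp add: h(2) aug_pv MB_smult mult.left_commute)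
  then have "VA.partial_norm (pure f m) p = pure f (aug m \<odot>\<^bsub>MB\<^esub> \<nu>)"
    using partial_norm_pure[OF fm(1) h(1), of p] by (simp add: h(2))
  also have "\<dots> = pure (j (aug m) \<otimes>\<^bsub>F\<^esub> f) \<nu>"
    using fm \<nu>_mem aug_mem by (intro pure_smult[symmetric])
  finally show "VA.partial_norm (pure f m) p = pure (ev (pure f m)) \<nu>"
    using fm by (simp add: ev(2) F.m_comm j_closed aug_mem)
qed

text \<open>
  The coefficient at the identity is \<open>1\<close> on the norm element and lies in \<open>A\<close> on \<open>M\<close>, because \<open>\<eta>\<close> has
  coefficients in \<open>A\<close>. Extended to \<open>F \<otimes> M\<close>, it recovers \<open>x\<close> from \<open>x \<otimes> \<Phi>(a)\<close>.
\<close>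

lemma pure_\<nu>_mem_W_iff:
  assumes x: "x \<in> carrier F"
  shows "pure x \<nu> \<in> W \<longleftrightarrow> x \<in> j ` A"
proof
  assume "x \<in> j ` A"
  then obtain r where r: "r \<in> A" "x = j r" by blast
  have "pure x \<nu> = pure \<one>\<^bsub>F\<^esub> (r \<odot>\<^bsub>MB\<^esub> \<nu>)"
    using pure_smult[OF r(1) F.one_closed \<nu>_mem] r by (simp add: j_closed)
  then show "pure x \<nu> \<in> W" using MB_smult_closed[OF r(1) \<nu>_mem] by (simp add: W_def)
next
  assume "pure x \<nu> \<in> W"
  then obtain m where m: "m \<in> carrier M" "pure x \<nu> = pure \<one>\<^bsub>F\<^esub> m" by (auto simp: W_def)
  have val: "n \<one> \<in> A" if n: "n \<in> carrier M" for n
  proof -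
    obtain h where h: "h \<in> poly_over A" "n = pv (\<eta> * h)" using n by (rule obtain_M)
    show ?thesis using pv_closed[OF A AP.mult_mem[OF \<eta>_over h(1)]] h(2) by (auto simp: PiE_iff)
  qed
  obtain h where h: "h \<in> hom V (add_monoid F)"
    "\<And>f m. f \<in> carrier F \<Longrightarrow> m \<in> carrier M \<Longrightarrow> h (pure f m) = f \<otimes>\<^bsub>F\<^esub> j (m \<one>)"
  proof (rule linear_functional_extends[of "\<lambda>m. m \<one>"])
    show "(m \<oplus>\<^bsub>M\<^esub> n) \<one> = m \<one> + n \<one>" if mn: "m \<in> carrier M" "n \<in> carrier M" for m n
    proof -
      obtain h k where "m = pv (\<eta> * h)" "n = pv (\<eta> * k)" using mn by (metis obtain_M)
      then show ?thesis by (simp add: M_add pv_add_apply)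
    qed
    show "(r \<odot>\<^bsub>MB\<^esub> m) \<one> = r * m \<one>" if m: "m \<in> carrier M" for r m
    proof -
      obtain h where "m = pv (\<eta> * h)" using m by (rule obtain_M)
      then show ?thesis by (simp add: MB_smult pv_smult_apply)
    qed
  qed (auto intro: val)
  have "Polynomial.coeff \<Phi> k = 0" if "k \<ge> p" for k
    using that by (simp add: coeff_sum)
  then have "Polynomial.degree \<Phi> < p" using p_pos by (intro degree_lessI) auto
  then have "\<nu> \<one> = 1"
    using pv_apply_pow[of \<Phi> 0] p_pos by (simp add: coeff_sum)
  then have "x = j (m \<one>)"
    using h(2)[OF x \<nu>_mem] h(2)[OF F.one_closed m(1)] m x val[OF m(1)] by (simp add: j_one j_closed)
  then show "x \<in> j ` A" using val[OF m(1)] by blast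
qed

lemma norm_trivial_iff:
  "v \<in> carrier V \<Longrightarrow> QA.partial_norm (\<kappa> v) p = \<one>\<^bsub>Q\<^esub> \<longleftrightarrow> ev v \<in> j ` A"
  by (simp add: partial_norm_\<kappa> \<kappa>_eq_one_iff norm_eq pure_closed ev_closed \<nu>_mem pure_\<nu>_mem_W_iff)

text \<open>
  Modulo \<open>a - 1\<close>, everything is a multiple of the generator \<open>\<eta>(a)\<close>, and the multiple is determined by
  \<open>ev\<close>.
\<close>

lemma mod_augmentation:
  assumes "v \<in> carrier V"
  shows "\<exists>y\<in>carrier V. v = pure (ev v \<otimes>\<^bsub>F\<^esub> inv\<^bsub>F\<^esub> j e1) (pv \<eta>) \<otimes>\<^bsub>V\<^esub> (act a y \<otimes>\<^bsub>V\<^esub> inv\<^bsub>V\<^esub> y)"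
  using assms
proof (induction rule: V_induct)
  case one
  have "pure (\<zero>\<^bsub>F\<^esub> \<otimes>\<^bsub>F\<^esub> inv\<^bsub>F\<^esub> j e1) (pv \<eta>) = \<one>\<^bsub>V\<^esub>"
    using j_e1 M_mem[OF AP.one_mem] by (simp add: F.field_Units pure_zero_left)
  then show ?case using VA.act_id[OF a_mem] ev.hom_one by (intro bexI[of _ "\<one>\<^bsub>V\<^esub>"]) simp_all
next
  case (pure f m)
  obtain h where h: "h \<in> poly_over A" "m = pv (\<eta> * h)" using pure(2) by (rule obtain_M)
  \<comment> \<open>With \<open>h = h(1) + (x - 1) k\<close>, the element \<open>\<eta>(a) h(a)\<close> is \<open>h(1) \<eta>(a)\<close> up to \<open>(a - 1) n\<close>.\<close>
  obtain k where k: "k \<in> poly_over A" "h = [:poly h 1:] + [:-1, 1:] * k"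
    using A.poly_over_split_at_1[OF h(1)] by blast
  define n where "n = pv (\<eta> * k)"
  have n: "n \<in> carrier M" unfolding n_def by (rule M_mem[OF k(1)])
  have h1: "poly h 1 \<in> A" using A.poly_mem[OF h(1) A.one_mem] .
  have one: "pv \<eta> \<in> carrier M" using M_mem[OF AP.one_mem] by simp
  have inv: "inv\<^bsub>F\<^esub> j e1 \<in> carrier F" "j e1 \<otimes>\<^bsub>F\<^esub> inv\<^bsub>F\<^esub> j e1 = \<one>\<^bsub>F\<^esub>"
    using j_e1 by (auto simp: F.field_Units)
  have "m \<oplus>\<^bsub>M\<^esub> n = (poly h 1 \<odot>\<^bsub>MB\<^esub> pv \<eta>) \<oplus>\<^bsub>M\<^esub> gact a n"
  proof -
    have "gact a n = pv (Polynomial.monom 1 1 * (\<eta> * k))"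
      unfolding n_def using gact_pv[of 1] a_mem by simp
    moreover have "\<eta> * h + \<eta> * k = Polynomial.smult (poly h 1) \<eta> + Polynomial.monom 1 1 * (\<eta> * k)"
      by (subst k(2)) (simp add: algebra_simps monom_altdef)
    ultimately show ?thesis by (simp add: h(2) n_def M_add MB_smult)
  qed
  then have "pure f m \<otimes>\<^bsub>V\<^esub> pure f n = pure f (poly h 1 \<odot>\<^bsub>MB\<^esub> pv \<eta>) \<otimes>\<^bsub>V\<^esub> act a (pure f n)"
    using pure n one h1 a_mem
    by (simp add: pure_add_right[symmetric] act_pure gact_closed MB_smult_closed)
  also have "pure f (poly h 1 \<odot>\<^bsub>MB\<^esub> pv \<eta>) = pure (j (poly h 1) \<otimes>\<^bsub>F\<^esub> f) (pv \<eta>)"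
    using pure h1 one by (intro pure_smult[symmetric])
  also have "j (poly h 1) \<otimes>\<^bsub>F\<^esub> f = ev (pure f m) \<otimes>\<^bsub>F\<^esub> inv\<^bsub>F\<^esub> j e1"
  proof -
    have "ev (pure f m) = f \<otimes>\<^bsub>F\<^esub> (j e1 \<otimes>\<^bsub>F\<^esub> j (poly h 1))"
      using pure h h1 e1_mem by (simp add: ev(2) aug_pv j_mult)
    also have "\<dots> \<otimes>\<^bsub>F\<^esub> inv\<^bsub>F\<^esub> j e1 = j (poly h 1) \<otimes>\<^bsub>F\<^esub> f \<otimes>\<^bsub>F\<^esub> (j e1 \<otimes>\<^bsub>F\<^esub> inv\<^bsub>F\<^esub> j e1)"
      using pure h1 e1_mem inv(1) by (simp add: j_closed F.m_ac)
    finally show ?thesis using pure h1 inv by (simp add: j_closed)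
  qed
  finally have eq: "pure f m \<otimes>\<^bsub>V\<^esub> pure f n
      = pure (ev (pure f m) \<otimes>\<^bsub>F\<^esub> inv\<^bsub>F\<^esub> j e1) (pv \<eta>) \<otimes>\<^bsub>V\<^esub> act a (pure f n)" .
  have c: "pure f m \<in> carrier V" "pure f n \<in> carrier V" "act a (pure f n) \<in> carrier V"
    "pure (ev (pure f m) \<otimes>\<^bsub>F\<^esub> inv\<^bsub>F\<^esub> j e1) (pv \<eta>) \<in> carrier V"
    using pure n one inv(1) a_mem by (simp_all add: pure_closed VA.act_closed ev_closed)
  have "pure f m = pure (ev (pure f m) \<otimes>\<^bsub>F\<^esub> inv\<^bsub>F\<^esub> j e1) (pv \<eta>) \<otimes>\<^bsub>V\<^esub> act a (pure f n) \<otimes>\<^bsub>V\<^esub> inv\<^bsub>V\<^esub> pure f n"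
    using eq c by (simp add: V.inv_solve_right)
  then show ?case using c by (intro bexI[of _ "pure f n"]) (simp_all add: V.m_assoc)
next
  case (diff v w)
  then obtain y z where y: "y \<in> carrier V"
      "v = pure (ev v \<otimes>\<^bsub>F\<^esub> inv\<^bsub>F\<^esub> j e1) (pv \<eta>) \<otimes>\<^bsub>V\<^esub> (act a y \<otimes>\<^bsub>V\<^esub> inv\<^bsub>V\<^esub> y)"
    and z: "z \<in> carrier V"
      "w = pure (ev w \<otimes>\<^bsub>F\<^esub> inv\<^bsub>F\<^esub> j e1) (pv \<eta>) \<otimes>\<^bsub>V\<^esub> (act a z \<otimes>\<^bsub>V\<^esub> inv\<^bsub>V\<^esub> z)"
    by blast
  define c where "c x = pure (x \<otimes>\<^bsub>F\<^esub> inv\<^bsub>F\<^esub> j e1) (pv \<eta>)" for x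
  have one: "pv \<eta> \<in> carrier M" using M_mem[OF AP.one_mem] by simp
  have inv: "inv\<^bsub>F\<^esub> j e1 \<in> carrier F" using j_e1 by (auto simp: F.field_Units)
  interpret c: group_hom "add_monoid F" V c
    using F.a_group V.is_group one inv
    by (auto simp: group_hom_def group_hom_axioms_def c_def F.l_distr pure_add_left pure_closed intro!: homI)
  have cd: "c (ev (v \<otimes>\<^bsub>V\<^esub> inv\<^bsub>V\<^esub> w)) = c (ev v) \<otimes>\<^bsub>V\<^esub> inv\<^bsub>V\<^esub> c (ev w)"
    using diff(1,2) ev.hom_closed
    by (simp only: ev.hom_mult ev.hom_inv c.hom_mult c.hom_inv V.inv_closed group.inv_closed[OF F.a_group])
  have cl: "c (ev v) \<in> carrier V" "c (ev w) \<in> carrier V" "act a y \<in> carrier V" "act a z \<in> carrier V"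
    using diff(1,2) ev_closed c.hom_closed y(1) z(1) a_mem by (simp_all add: VA.act_closed)
  have "v \<otimes>\<^bsub>V\<^esub> inv\<^bsub>V\<^esub> w = c (ev v) \<otimes>\<^bsub>V\<^esub> (act a y \<otimes>\<^bsub>V\<^esub> inv\<^bsub>V\<^esub> y) \<otimes>\<^bsub>V\<^esub>
      inv\<^bsub>V\<^esub> (c (ev w) \<otimes>\<^bsub>V\<^esub> (act a z \<otimes>\<^bsub>V\<^esub> inv\<^bsub>V\<^esub> z))"
    using y(2) z(2) unfolding c_def by simp
  also have "\<dots> = c (ev v) \<otimes>\<^bsub>V\<^esub> inv\<^bsub>V\<^esub> c (ev w) \<otimes>\<^bsub>V\<^esub>
      (act a (y \<otimes>\<^bsub>V\<^esub> inv\<^bsub>V\<^esub> z) \<otimes>\<^bsub>V\<^esub> inv\<^bsub>V\<^esub> (y \<otimes>\<^bsub>V\<^esub> inv\<^bsub>V\<^esub> z))"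
    using y(1) z(1) cl a_mem
    by (simp add: V.inv_mult VA.act_prod VA.act_inv V.m_ac)
  finally show ?case
    unfolding cd[symmetric] unfolding c_def by (rule bexI) (simp add: y(1) z(1))
qed

end

context divisor_extension
begin

abbreviation "I \<equiv> PIdl\<^bsub>RR\<^esub> e1"

sublocale RR: cring RR by (rule cring_subring_record[OF A])

sublocale I: ideal I RR
  using e1_mem by (intro RR.cgenideal_ideal) simp

lemma I_eq: "I = {r * e1 |r. r \<in> A}"
  by (simp add: cgenideal_def)

lemma \<kappa>_closed: "v \<in> carrier V \<Longrightarrow> \<kappa> v \<in> carrier Q"
  unfolding carrier_Q by (rule imageI)

text \<open>
  The argument is a coset of \<open>W\<close>, that is, a set of elements of \<open>F \<otimes> M\<close>. On the representatives of one
  coset the values of \<open>ev\<close> differ by elements of \<open>\<eta>(1) A\<close>, so that the set collects exactly one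
  residue class as soon as one of these values comes from \<open>A\<close>.
\<close>

definition ev_class where
  "ev_class q = {r \<in> A. \<exists>v\<in>q. ev v = j r}"

lemma ev_class_\<kappa>:
  assumes v: "v \<in> carrier V" and r: "r \<in> A" "ev v = j r"
  shows "ev_class (\<kappa> v) = I +>\<^bsub>RR\<^esub> r"
proof -
  have evw: "ev (pure \<one>\<^bsub>F\<^esub> m \<otimes>\<^bsub>V\<^esub> v) = j (aug m + r)" if m: "m \<in> carrier M" for m
    using m v r by (simp add: pure_closed ev(2) j_closed aug_mem j_add)
  have "s \<in> ev_class (\<kappa> v) \<longleftrightarrow> s \<in> A \<and> (\<exists>m\<in>carrier M. j (aug m + r) = j s)" for s
    by (auto simp: ev_class_def r_coset_def W_def evw)
  also have "\<dots> s \<longleftrightarrow> (\<exists>m\<in>carrier M. s = aug m + r)" for s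
    using inj_onD[OF j_inj] A.add_mem[OF aug_mem r(1)] by auto
  also have "\<dots> s \<longleftrightarrow> (\<exists>i\<in>I. s = i + r)" for s
  proof -
    have "aug ` carrier M = I"
    proof (intro subset_antisym subsetI)
      fix x assume "x \<in> aug ` carrier M"
      then obtain h where "h \<in> poly_over A" "x = aug (pv (\<eta> * h))" by (auto simp: M_carrier)
      then show "x \<in> I" using A.poly_mem[OF _ A.one_mem] by (auto simp: I_eq aug_pv)
    next
      fix x assume "x \<in> I"
      then obtain c where c: "c \<in> A" "x = c * e1" by (auto simp: I_eq)
      have "x = aug (pv (\<eta> * [:c:]))" using c by (simp add: aug_pv)
      then show "x \<in> aug ` carrier M" using M_mem[OF A.const_poly_over[OF c(1)]] by blast
    qed
    then show ?thesis by (simp flip: \<open>aug ` carrier M = I\<close>)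
  qed
  finally show ?thesis by (auto simp: a_r_coset_def')
qed

text \<open>
  Surjectivity uses \<open>r / \<eta>(1) \<otimes> \<eta>(a)\<close>, on which \<open>ev\<close> takes the value \<open>r\<close>. If the value at \<open>v\<close> is in
  \<open>\<eta>(1) A\<close>, then subtracting an element of \<open>M\<close> makes it zero, and \<open>v\<close> becomes a multiple of \<open>a - 1\<close>.
\<close>

theorem cohomology1_divisor_module:
  "cohomology1 G Q qact \<cong> add_monoid (RR Quot I)"
proof (rule QA.cohomology1_iso[where \<phi> = ev_class])
  have T_mult: "(I +>\<^bsub>RR\<^esub> r) \<otimes>\<^bsub>add_monoid (RR Quot I)\<^esub> (I +>\<^bsub>RR\<^esub> s) = I +>\<^bsub>RR\<^esub> (r + s)"
    if "r \<in> A" "s \<in> A" for r s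
    using I.a_rcos_sum[of r s] that by (simp add: FactRing_def)
  have T_one: "\<one>\<^bsub>add_monoid (RR Quot I)\<^esub> = I" by (simp add: FactRing_def)
  have T_carrier: "carrier (add_monoid (RR Quot I)) = (\<lambda>r. I +>\<^bsub>RR\<^esub> r) ` A"
    by (auto simp: FactRing_def A_RCOSETS_def')
  have rep: "\<exists>v r. v \<in> carrier V \<and> r \<in> A \<and> q = \<kappa> v \<and> ev v = j r"
    if q: "q \<in> carrier Q" "QA.partial_norm q p = \<one>\<^bsub>Q\<^esub>" for q
  proof -
    obtain v where v: "v \<in> carrier V" "q = \<kappa> v" using q(1) by (auto simp: carrier_Q)
    then have "ev v \<in> j ` A" using norm_trivial_iff[OF v(1)] q(2) by simp
    then show ?thesis using v by blast
  qed
  have one: "pv \<eta> \<in> carrier M" using M_mem[OF AP.one_mem] by simp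
  have inv: "inv\<^bsub>F\<^esub> j e1 \<in> carrier F" "inv\<^bsub>F\<^esub> j e1 \<otimes>\<^bsub>F\<^esub> j e1 = \<one>\<^bsub>F\<^esub>"
    using j_e1 by (auto simp: F.field_Units)
  show "group (add_monoid (RR Quot I))"
    by (rule abelian_group.a_group[OF ring.is_abelian_group[OF I.quotient_is_ring]])
  show "ev_class q \<in> carrier (add_monoid (RR Quot I))"
    if q: "q \<in> carrier Q" "QA.partial_norm q p = \<one>\<^bsub>Q\<^esub>" for q
    using rep[OF q] ev_class_\<kappa> unfolding T_carrier by auto
  show "ev_class (q \<otimes>\<^bsub>Q\<^esub> q') = ev_class q \<otimes>\<^bsub>add_monoid (RR Quot I)\<^esub> ev_class q'"
    if qq: "q \<in> carrier Q" "q' \<in> carrier Q" "QA.partial_norm q p = \<one>\<^bsub>Q\<^esub>" "QA.partial_norm q' p = \<one>\<^bsub>Q\<^esub>"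
    for q q'
  proof -
    obtain v r where v: "v \<in> carrier V" "r \<in> A" "q = \<kappa> v" "ev v = j r" using rep[OF qq(1,3)] by blast
    obtain w s where w: "w \<in> carrier V" "s \<in> A" "q' = \<kappa> w" "ev w = j s" using rep[OF qq(2,4)] by blast
    have "q \<otimes>\<^bsub>Q\<^esub> q' = \<kappa> (v \<otimes>\<^bsub>V\<^esub> w)" using v w \<kappa>_mult by simp
    moreover have "ev (v \<otimes>\<^bsub>V\<^esub> w) = j (r + s)" using v w by (simp add: j_add)
    ultimately have "ev_class (q \<otimes>\<^bsub>Q\<^esub> q') = I +>\<^bsub>RR\<^esub> (r + s)"
      using ev_class_\<kappa>[of "v \<otimes>\<^bsub>V\<^esub> w" "r + s"] v w A.add_mem by simp
    then show ?thesis
      using T_mult[OF v(2) w(2)] ev_class_\<kappa>[OF v(1,2,4)] ev_class_\<kappa>[OF w(1,2,4)] v(3) w(3) by simp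
  qed
  show "\<exists>q\<in>carrier Q. QA.partial_norm q p = \<one>\<^bsub>Q\<^esub> \<and> ev_class q = t"
    if t: "t \<in> carrier (add_monoid (RR Quot I))" for t
  proof -
    obtain r where r: "r \<in> A" "t = I +>\<^bsub>RR\<^esub> r" using t unfolding T_carrier by blast
    define v where "v = pure (j r \<otimes>\<^bsub>F\<^esub> inv\<^bsub>F\<^esub> j e1) (pv \<eta>)"
    have v: "v \<in> carrier V" using r(1) one inv(1) by (simp add: v_def pure_closed j_closed)
    have "ev v = j r \<otimes>\<^bsub>F\<^esub> (inv\<^bsub>F\<^esub> j e1 \<otimes>\<^bsub>F\<^esub> j e1)"
      using r(1) one inv(1) e1_mem by (simp add: v_def ev(2) aug_pv j_closed F.m_assoc)
    then have evv: "ev v = j r" using inv r(1) by (simp add: j_closed)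
    show ?thesis
    proof (intro bexI conjI)
      show "\<kappa> v \<in> carrier Q" using v by (rule \<kappa>_closed)
      show "QA.partial_norm (\<kappa> v) p = \<one>\<^bsub>Q\<^esub>"
        unfolding norm_trivial_iff[OF v] evv using r(1) by (rule imageI)
      show "ev_class (\<kappa> v) = t" using ev_class_\<kappa>[OF v r(1) evv] r(2) by simp
    qed
  qed
  show "ev_class q = \<one>\<^bsub>add_monoid (RR Quot I)\<^esub> \<longleftrightarrow> (\<exists>y\<in>carrier Q. q = qact a y \<otimes>\<^bsub>Q\<^esub> inv\<^bsub>Q\<^esub> y)"
    if q: "q \<in> carrier Q" "QA.partial_norm q p = \<one>\<^bsub>Q\<^esub>" for q
  proof -
    interpret \<kappa>: group_hom V Q "\<lambda>v. \<kappa> v" by (rule \<kappa>_hom)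
    have cob: "qact a (\<kappa> y) \<otimes>\<^bsub>Q\<^esub> inv\<^bsub>Q\<^esub> \<kappa> y = \<kappa> (act a y \<otimes>\<^bsub>V\<^esub> inv\<^bsub>V\<^esub> y)" if "y \<in> carrier V" for y
      unfolding qact_\<kappa>[OF a_mem that] \<kappa>.hom_inv[OF that, symmetric]
      using that a_mem by (intro \<kappa>_mult) (simp_all add: VA.act_closed)
    obtain v r where v: "v \<in> carrier V" "r \<in> A" "q = \<kappa> v" "ev v = j r" using rep[OF q] by blast
    show ?thesis
    proof
      assume "ev_class q = \<one>\<^bsub>add_monoid (RR Quot I)\<^esub>"
      then have "I +>\<^bsub>RR\<^esub> r = I" using ev_class_\<kappa>[OF v(1,2,4)] v(3) T_one by simp
      then have "r \<in> I" using I.a_rcos_self[of r] v(2) by simp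
      then obtain c where c: "c \<in> A" "r = c * e1" by (auto simp: I_eq)
      define m where "m = pv (\<eta> * [:c:])"
      have m: "m \<in> carrier M" unfolding m_def by (rule M_mem[OF A.const_poly_over[OF c(1)]])
      define w where "w = inv\<^bsub>V\<^esub> pure \<one>\<^bsub>F\<^esub> m \<otimes>\<^bsub>V\<^esub> v"
      have pm: "pure \<one>\<^bsub>F\<^esub> m \<in> carrier V" using m by (simp add: pure_closed)
      then have w: "w \<in> carrier V" using v(1) by (simp add: w_def)
      have vw: "v = pure \<one>\<^bsub>F\<^esub> m \<otimes>\<^bsub>V\<^esub> w" using pm v(1) by (simp add: w_def flip: V.m_assoc)
      have "\<kappa> (pure \<one>\<^bsub>F\<^esub> m) = \<one>\<^bsub>Q\<^esub>" using \<kappa>_eq_one_iff[OF pm] m by (auto simp: W_def)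
      then have "\<kappa> (pure \<one>\<^bsub>F\<^esub> m \<otimes>\<^bsub>V\<^esub> w) = \<kappa> w"
        unfolding \<kappa>_mult[OF pm w, symmetric] using Q.l_one[OF \<kappa>_closed[OF w]] by simp
      then have "q = \<kappa> w" using v(3) vw by simp
      have "j r = ev (pure \<one>\<^bsub>F\<^esub> m) \<oplus>\<^bsub>F\<^esub> ev w" using v(4) vw pm w by simp
      also have "ev (pure \<one>\<^bsub>F\<^esub> m) = j r" using m c by (simp add: ev(2) j_closed aug_mem) (simp add: m_def aug_pv mult.commute)
      finally have "ev w = \<zero>\<^bsub>F\<^esub>" using j_closed[OF v(2)] ev_closed[OF w] by simp
      then obtain y where y: "y \<in> carrier V"
          "w = pure (\<zero>\<^bsub>F\<^esub> \<otimes>\<^bsub>F\<^esub> inv\<^bsub>F\<^esub> j e1) (pv \<eta>) \<otimes>\<^bsub>V\<^esub> (act a y \<otimes>\<^bsub>V\<^esub> inv\<^bsub>V\<^esub> y)"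
        using mod_augmentation[OF w] by auto
      then have "w = act a y \<otimes>\<^bsub>V\<^esub> inv\<^bsub>V\<^esub> y"
        using inv(1) one a_mem by (simp add: pure_zero_left VA.act_closed)
      then show "\<exists>y\<in>carrier Q. q = qact a y \<otimes>\<^bsub>Q\<^esub> inv\<^bsub>Q\<^esub> y"
        using \<open>q = \<kappa> w\<close> cob[OF y(1)] by (intro bexI[OF _ \<kappa>_closed[OF y(1)]]) simp
    next
      assume "\<exists>y\<in>carrier Q. q = qact a y \<otimes>\<^bsub>Q\<^esub> inv\<^bsub>Q\<^esub> y"
      then obtain y' where y': "y' \<in> carrier Q" "q = qact a y' \<otimes>\<^bsub>Q\<^esub> inv\<^bsub>Q\<^esub> y'" by blast
      obtain y where y: "y \<in> carrier V" "y' = \<kappa> y"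
        using y'(1) unfolding carrier_Q by blast
      have q_eq: "q = \<kappa> (act a y \<otimes>\<^bsub>V\<^esub> inv\<^bsub>V\<^esub> y)" using y'(2) cob[OF y(1)] y(2) by simp
      have c: "act a y \<in> carrier V" using y(1) a_mem by (simp add: VA.act_closed)
      have "ev (act a y \<otimes>\<^bsub>V\<^esub> inv\<^bsub>V\<^esub> y) = ev (act a y) \<otimes>\<^bsub>add_monoid F\<^esub> inv\<^bsub>add_monoid F\<^esub> ev y"
        using c y(1) by (simp only: ev.hom_mult ev.hom_inv V.inv_closed)
      also have "\<dots> = \<one>\<^bsub>add_monoid F\<^esub>"
        unfolding ev_act[OF a_mem y(1)] using ev.hom_closed[OF y(1)] by (rule group.r_inv[OF F.a_group])
      finally have "ev (act a y \<otimes>\<^bsub>V\<^esub> inv\<^bsub>V\<^esub> y) = j 0" by (simp add: j_zero)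
      then have "ev_class q = I +>\<^bsub>RR\<^esub> 0"
        unfolding q_eq using c y(1) by (intro ev_class_\<kappa> A.zero_mem) simp_all
      also have "\<dots> = I" using I.a_rcos_const[of 0] I.zero_closed by simp
      finally show "ev_class q = \<one>\<^bsub>add_monoid (RR Quot I)\<^esub>" using T_one by simp
    qed
  qed
qed

end

theorem theorem1:
  fixes p :: nat
    and \<iota> :: "(nat \<Rightarrow> int) \<Rightarrow> 'a::field"
    and R :: "'a ring"
    and F :: "'f ring"
    and j :: "'a \<Rightarrow> 'f"
    and G :: "'g monoid"
    and a :: 'g
    and \<eta> :: "'a poly"
    and M :: "('g \<Rightarrow> 'a, 'g \<Rightarrow> 'a) module"
  assumes "Factorial_Ring.prime p"
    and "finite_padic_extension p \<iota>"
    and "R = ring_of_integers p \<iota>"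
    and "ramified p R"
    and "field F" and "j \<in> ring_hom R F" and "inj_on j (carrier R)"
    and "group G" and "a \<in> carrier G" and "generate G {a} = carrier G" and "Coset.order G = p"
    and "\<eta> dvd (\<Sum>i<p. Polynomial.monom 1 i)"
    and "Polynomial.degree \<eta> < p - 1"
    and "Polynomial.lead_coeff \<eta> \<in> Units R"
    and "M = poly_module R G a \<eta>"
  shows "indecomposable_module (group_ring R G) M \<and>
         cohomology1 G (hat_module R G F j M) (hat_act R G M) \<cong>
           add_monoid (R Quot (PIdl\<^bsub>R\<^esub> (poly \<eta> 1)))"
proof -
  note p = assms(1)
  have p1: "p > 1" using p by (rule prime_gt_1_nat)
  then have p0: "p > 0" by simp
  define Zp where "Zp = \<iota> ` carrier (padic_ints p)"
  define A where "A = integral_over Zp"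
  have Zp: "field_subring Zp"
    unfolding Zp_def using assms(2) p0 by (intro padic_image_subring) (auto simp: finite_padic_extension_def)
  interpret Zp: field_subring Zp by (rule Zp)
  interpret A: field_subring A
    unfolding A_def field_subring_def by (rule Zp.integral_over_subring)
  have R: "R = subring_record A"
    unfolding assms(3) A_def Zp_def by (rule ring_of_integers_eq)
  have p_nonzero: "of_nat p \<noteq> (0 :: 'a)"
    using p1 assms(2) by (rule padic_extension_of_nat_nonzero)
  let ?X = "Polynomial.monom 1 p - 1 :: 'a poly"
  let ?\<Phi> = "(\<Sum>i<p. Polynomial.monom 1 i) :: 'a poly"
  have X: "?X = [:-1, 1:] * ?\<Phi>" by (rule geometric_monom[symmetric])
  obtain \<theta> where \<theta>: "\<eta> * \<theta> = ?\<Phi>" using assms(12) unfolding dvd_def by metis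
  have \<Phi>_coeff: "Polynomial.coeff ?\<Phi> k = (if k < p then 1 else 0)" for k
    by (simp add: coeff_sum)
  have \<Phi>_lead: "Polynomial.lead_coeff ?\<Phi> = 1"
  proof -
    have "Polynomial.degree ?\<Phi> = p - 1"
      using p0 by (intro antisym degree_le le_degree) (auto simp: \<Phi>_coeff)
    then show ?thesis using p0 by (simp add: \<Phi>_coeff)
  qed
  obtain u where u: "u \<in> A" "u * Polynomial.lead_coeff \<eta> = 1" and lc: "Polynomial.lead_coeff \<eta> \<in> A"
    using assms(14) unfolding R Units_def by auto
  have "Polynomial.lead_coeff \<eta> * Polynomial.lead_coeff \<theta> = 1"
    using \<Phi>_lead unfolding \<theta>[symmetric] lead_coeff_mult .
  then have "Polynomial.lead_coeff \<theta> = u"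
    using u(2) by (metis mult.assoc mult.left_neutral mult.right_neutral)
  then have lc': "Polynomial.lead_coeff \<theta> \<in> A" using u(1) by simp
  have dvdX: "\<eta> dvd ?X" "\<theta> dvd ?X" unfolding X \<theta>[symmetric] by (intro dvd_mult dvd_triv_left dvd_triv_right)+
  have \<eta>_over: "\<eta> \<in> poly_over A" and \<theta>_over: "\<theta> \<in> poly_over A"
    unfolding A_def by (rule unity_divisor_integral[OF Zp _ p0]; use dvdX lc lc' A_def in simp)+
  have G: "finite_cyclic G a p"
    using assms(8-11) p0 by (simp add: finite_cyclic_def finite_cyclic_axioms_def)
  interpret D: divisor_extension G a p A \<eta> F j \<theta>
    using G A.field_subring_axioms assms(5-7) \<eta>_over \<theta>_over \<theta> p_nonzero
    by (simp add: divisor_extension_def divisor_extension_axioms_def divisor_module_def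
        divisor_module_axioms_def R)
  obtain P where P: "1 \<notin> P" "\<And>x y. x \<in> P \<Longrightarrow> y \<in> P \<Longrightarrow> x + y \<in> P"
    "\<And>r. r \<in> A \<Longrightarrow> of_nat p * r \<in> P" "\<And>x n. x \<in> A \<Longrightarrow> x ^ n \<in> P \<Longrightarrow> x \<in> P"
    using ramified_prime[OF A.field_subring_axioms assms(4)[unfolded R]] by blast
  have cancel: "?X dvd m" if "s \<in> poly_over A" "poly s 1 \<notin> P" "?X dvd s * m" for s m
  proof (rule unity_poly_dvd_cancel[OF Zp p p_nonzero _ _ that(3)])
    show "s \<in> poly_over (integral_over Zp)" using that(1) by (simp add: A_def)
    show "\<not> (\<exists>r\<in>integral_over Zp. poly s 1 ^ p = of_nat p * r)"
    proof
      assume "\<exists>r\<in>integral_over Zp. poly s 1 ^ p = of_nat p * r"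
      then obtain r where "r \<in> A" "poly s 1 ^ p = of_nat p * r" by (auto simp: A_def)
      then have "poly s 1 ^ p \<in> P" using P(3) by simp
      then show False using P(4)[OF A.poly_mem[OF that(1) A.one_mem]] that(2) by blast
    qed
  qed
  have "indecomposable_module (group_algebra A G) (poly_module (subring_record A) G a \<eta>)"
  proof (rule D.indecomposable_M)
    have "\<eta> \<noteq> 0" using \<theta> \<Phi>_lead by (metis leading_coeff_0_iff mult_zero_left zero_neq_one)
    moreover have "Polynomial.degree ?X = p"
      using p0 by (intro antisym degree_le le_degree) auto
    ultimately show "\<not> ?X dvd \<eta>" using assms(13) dvd_imp_degree_le[of ?X \<eta>] by auto
    fix s assume s: "s \<in> poly_over A"
    have s': "1 - s \<in> poly_over A" by (rule D.AP.diff_mem[OF D.AP.one_mem s])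
    have "poly s 1 \<notin> P \<or> poly (1 - s) 1 \<notin> P"
      using P(2)[of "poly s 1" "poly (1 - s) 1"] P(1) by auto
    then show "(\<forall>m. ?X dvd s * m \<longrightarrow> ?X dvd m) \<or> (\<forall>m. ?X dvd (1 - s) * m \<longrightarrow> ?X dvd m)"
    proof
      assume "poly s 1 \<notin> P"
      then show ?thesis using cancel[OF s] by (intro disjI1) blast
    next
      assume "poly (1 - s) 1 \<notin> P"
      then show ?thesis using cancel[OF s'] by (intro disjI2) blast
    qed
  qed
  then show ?thesis
    using D.cohomology1_divisor_module unfolding assms(15) R by blast
qed

end
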